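(* Let $A\to B$ be a morphism of finite resolving algebras. Then there exists a resolution $A\to B'\to B$ of $A\to B$ (with $A\to B'$ resolving and $B'\to B$ a quasi-isomorphism, the composite being the given morphism) such that $A\to B'$ is a finite resolving morphism.
   Context: $k$ is a field of characteristic $0$; dg algebras are graded-commutative unital $k$-algebras with differential of degree $+1$. A morphism $A\to B$ of dg algebras is resolving if $B^\natural\cong A^\natural\otimes_kk[x_i]$ for a family of homogeneous $x_i\in B$ of degrees $\le0$ (free graded-commutative algebra); it is finite if such a family can be chosen finite. A finite resolving algebra is a dg algebra $B$ with $k\to B$ a finite resolving morphism. *)

theory Defs
  imports "HOL-Algebra.Module"
begin

record ('k, 'a) dga = "('k, 'a) module" +
  differential :: "'a \<Rightarrow> 'a"
  homog :: "int \<Rightarrow> 'a set"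

definition sgn_mul :: "('k, 'a, 'm) dga_scheme \<Rightarrow> int \<Rightarrow> 'a \<Rightarrow> 'a" where
  "sgn_mul A m x = (if odd m then \<ominus>\<^bsub>A\<^esub> x else x)"

definition is_dga :: "('k::field_char_0, 'a, 'm) dga_scheme \<Rightarrow> bool" where
  "is_dga A \<longleftrightarrow>
     ring A \<and>
     \<comment> \<open>k-vector space and k-algebra structure\<close>
     (\<forall>c x. x \<in> carrier A \<longrightarrow> c \<odot>\<^bsub>A\<^esub> x \<in> carrier A) \<and>
     (\<forall>c d x. x \<in> carrier A \<longrightarrow> (c + d) \<odot>\<^bsub>A\<^esub> x = (c \<odot>\<^bsub>A\<^esub> x) \<oplus>\<^bsub>A\<^esub> (d \<odot>\<^bsub>A\<^esub> x)) \<and>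
     (\<forall>c x y. x \<in> carrier A \<longrightarrow> y \<in> carrier A \<longrightarrow>
        c \<odot>\<^bsub>A\<^esub> (x \<oplus>\<^bsub>A\<^esub> y) = (c \<odot>\<^bsub>A\<^esub> x) \<oplus>\<^bsub>A\<^esub> (c \<odot>\<^bsub>A\<^esub> y)) \<and>
     (\<forall>c d x. x \<in> carrier A \<longrightarrow> (c * d) \<odot>\<^bsub>A\<^esub> x = c \<odot>\<^bsub>A\<^esub> (d \<odot>\<^bsub>A\<^esub> x)) \<and>
     (\<forall>x. x \<in> carrier A \<longrightarrow> (1::'k) \<odot>\<^bsub>A\<^esub> x = x) \<and>
     (\<forall>c x y. x \<in> carrier A \<longrightarrow> y \<in> carrier A \<longrightarrow>
        (c \<odot>\<^bsub>A\<^esub> x) \<otimes>\<^bsub>A\<^esub> y = c \<odot>\<^bsub>A\<^esub> (x \<otimes>\<^bsub>A\<^esub> y) \<and>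
        x \<otimes>\<^bsub>A\<^esub> (c \<odot>\<^bsub>A\<^esub> y) = c \<odot>\<^bsub>A\<^esub> (x \<otimes>\<^bsub>A\<^esub> y)) \<and>
     \<comment> \<open>Z-grading: homogeneous components are subspaces, A is their direct sum\<close>
     (\<forall>n. homog A n \<subseteq> carrier A \<and> \<zero>\<^bsub>A\<^esub> \<in> homog A n \<and>
        (\<forall>x y. x \<in> homog A n \<longrightarrow> y \<in> homog A n \<longrightarrow> x \<oplus>\<^bsub>A\<^esub> y \<in> homog A n) \<and>
        (\<forall>c x. x \<in> homog A n \<longrightarrow> c \<odot>\<^bsub>A\<^esub> x \<in> homog A n)) \<and>
     (\<forall>x \<in> carrier A. \<exists>!h. (\<forall>n. h n \<in> homog A n) \<and> finite {n. h n \<noteq> \<zero>\<^bsub>A\<^esub>} \<and>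
        x = finsum A h {n. h n \<noteq> \<zero>\<^bsub>A\<^esub>}) \<and>
     \<one>\<^bsub>A\<^esub> \<in> homog A 0 \<and>
     (\<forall>m n x y. x \<in> homog A m \<longrightarrow> y \<in> homog A n \<longrightarrow> x \<otimes>\<^bsub>A\<^esub> y \<in> homog A (m + n)) \<and>
     \<comment> \<open>graded commutativity\<close>
     (\<forall>m n x y. x \<in> homog A m \<longrightarrow> y \<in> homog A n \<longrightarrow>
        x \<otimes>\<^bsub>A\<^esub> y = sgn_mul A (m * n) (y \<otimes>\<^bsub>A\<^esub> x)) \<and>
     \<comment> \<open>differential: k-linear, degree +1, square zero, Leibniz rule\<close>
     (\<forall>x y. x \<in> carrier A \<longrightarrow> y \<in> carrier A \<longrightarrow>
        differential A (x \<oplus>\<^bsub>A\<^esub> y) = differential A x \<oplus>\<^bsub>A\<^esub> differential A y) \<and>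
     (\<forall>c x. x \<in> carrier A \<longrightarrow> differential A (c \<odot>\<^bsub>A\<^esub> x) = c \<odot>\<^bsub>A\<^esub> differential A x) \<and>
     (\<forall>n x. x \<in> homog A n \<longrightarrow> differential A x \<in> homog A (n + 1)) \<and>
     (\<forall>x. x \<in> carrier A \<longrightarrow> differential A (differential A x) = \<zero>\<^bsub>A\<^esub>) \<and>
     (\<forall>m x y. x \<in> homog A m \<longrightarrow> y \<in> carrier A \<longrightarrow>
        differential A (x \<otimes>\<^bsub>A\<^esub> y) =
          (differential A x \<otimes>\<^bsub>A\<^esub> y) \<oplus>\<^bsub>A\<^esub> sgn_mul A m (x \<otimes>\<^bsub>A\<^esub> differential A y))"

definition dga_hom :: "('k::field_char_0, 'a, 'm) dga_scheme \<Rightarrow> ('k, 'b, 'n) dga_scheme \<Rightarrow> ('a \<Rightarrow> 'b) \<Rightarrow> bool" where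
  "dga_hom A B f \<longleftrightarrow>
     f \<in> carrier A \<rightarrow> carrier B \<and>
     (\<forall>x \<in> carrier A. \<forall>y \<in> carrier A. f (x \<oplus>\<^bsub>A\<^esub> y) = f x \<oplus>\<^bsub>B\<^esub> f y) \<and>
     (\<forall>c. \<forall>x \<in> carrier A. f (c \<odot>\<^bsub>A\<^esub> x) = c \<odot>\<^bsub>B\<^esub> f x) \<and>
     (\<forall>x \<in> carrier A. \<forall>y \<in> carrier A. f (x \<otimes>\<^bsub>A\<^esub> y) = f x \<otimes>\<^bsub>B\<^esub> f y) \<and>
     f \<one>\<^bsub>A\<^esub> = \<one>\<^bsub>B\<^esub> \<and>
     (\<forall>x \<in> carrier A. f (differential A x) = differential B (f x)) \<and>
     (\<forall>n. \<forall>x \<in> homog A n. f x \<in> homog B n)"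

text \<open>Quasi-isomorphism: the induced map on every cohomology group H^n is bijective
  (written out: injective and surjective on cohomology classes).\<close>
definition cocycles :: "('k, 'a, 'm) dga_scheme \<Rightarrow> int \<Rightarrow> 'a set" where
  "cocycles A n = {z \<in> homog A n. differential A z = \<zero>\<^bsub>A\<^esub>}"

definition quasi_iso :: "('k::field_char_0, 'a, 'm) dga_scheme \<Rightarrow> ('k, 'b, 'n) dga_scheme \<Rightarrow> ('a \<Rightarrow> 'b) \<Rightarrow> bool" where
  "quasi_iso A B f \<longleftrightarrow> dga_hom A B f \<and>
     (\<forall>n. \<forall>z \<in> cocycles A n.
        (\<exists>b \<in> homog B (n - 1). f z = differential B b) \<longrightarrow>
        (\<exists>a \<in> homog A (n - 1). z = differential A a)) \<and>
     (\<forall>n. \<forall>z \<in> cocycles B n. \<exists>z' \<in> cocycles A n. \<exists>b \<in> homog B (n - 1).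
        f z' = z \<oplus>\<^bsub>B\<^esub> differential B b)"

definition exps :: "nat \<Rightarrow> (nat \<Rightarrow> int) \<Rightarrow> (nat \<Rightarrow> nat) set" where
  "exps n dg = {e. (\<forall>i. n \<le> i \<longrightarrow> e i = 0) \<and> (\<forall>i < n. odd (dg i) \<longrightarrow> e i \<le> 1)}"

definition monomial :: "('k, 'b, 'm) dga_scheme \<Rightarrow> (nat \<Rightarrow> 'b) \<Rightarrow> nat \<Rightarrow> (nat \<Rightarrow> nat) \<Rightarrow> 'b" where
  "monomial B x n e = foldr (\<lambda>i acc. (x i [^]\<^bsub>B\<^esub> e i) \<otimes>\<^bsub>B\<^esub> acc) [0..<n] \<one>\<^bsub>B\<^esub>"

text \<open>A morphism f : A \<rightarrow> B is finite resolving if there are finitely many homogeneous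
  x_0..x_{n-1} in B of degrees \<le> 0 such that the canonical map
  A^nat \<otimes>_k k[x_i] \<rightarrow> B^nat, a \<otimes> m \<mapsto> f(a) m, is bijective, i.e. the monomials in the x_i
  form a basis of B as a (left) A-module via f.\<close>
definition fin_resolving :: "('k::field_char_0, 'a, 'm) dga_scheme \<Rightarrow> ('k, 'b, 'n) dga_scheme \<Rightarrow> ('a \<Rightarrow> 'b) \<Rightarrow> bool" where
  "fin_resolving A B f \<longleftrightarrow> dga_hom A B f \<and>
     (\<exists>n x dg. (\<forall>i < n. dg i \<le> 0 \<and> x i \<in> homog B (dg i)) \<and>
        (\<forall>b \<in> carrier B. \<exists>a. (\<forall>e \<in> exps n dg. a e \<in> carrier A) \<and>
            finite {e \<in> exps n dg. a e \<noteq> \<zero>\<^bsub>A\<^esub>} \<and>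
            b = finsum B (\<lambda>e. f (a e) \<otimes>\<^bsub>B\<^esub> monomial B x n e) {e \<in> exps n dg. a e \<noteq> \<zero>\<^bsub>A\<^esub>}) \<and>
        (\<forall>a. (\<forall>e \<in> exps n dg. a e \<in> carrier A) \<and>
            finite {e \<in> exps n dg. a e \<noteq> \<zero>\<^bsub>A\<^esub>} \<and>
            finsum B (\<lambda>e. f (a e) \<otimes>\<^bsub>B\<^esub> monomial B x n e) {e \<in> exps n dg. a e \<noteq> \<zero>\<^bsub>A\<^esub>} = \<zero>\<^bsub>B\<^esub>
            \<longrightarrow> (\<forall>e \<in> exps n dg. a e = \<zero>\<^bsub>A\<^esub>)))"

definition ground_dga :: "('k::field_char_0, 'k) dga" where
  "ground_dga = \<lparr>carrier = UNIV, mult = (*), one = 1, zero = 0, add = (+),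
     smult = (*), differential = (\<lambda>_. 0), homog = (\<lambda>n. if n = 0 then UNIV else {0})\<rparr>"

definition fin_resolving_alg :: "('k::field_char_0, 'a, 'm) dga_scheme \<Rightarrow> bool" where
  "fin_resolving_alg A \<longleftrightarrow> is_dga A \<and>
     fin_resolving (ground_dga :: ('k, 'k) dga) A (\<lambda>c. c \<odot>\<^bsub>A\<^esub> \<one>\<^bsub>A\<^esub>)"

end

theory Submission
  imports Defs
begin

text \<open>Let \<open>A\<close> be freely generated by \<open>x\<^sub>1, \<dots>, x\<^sub>n\<close>, attached in order of decreasing degree, so that
  \<open>\<partial> x\<^sub>j\<close> lies in the subalgebra \<open>A\<^sub>j\<close> generated by the earlier variables. Start with \<open>A\<^sub>0 = k\<close> and \<open>B\<close> itself.
  Given a resolution \<open>A\<^sub>j \<rightarrow> D \<rightarrow> B\<close> with surjective quasi-isomorphism \<open>h : D \<rightarrow> B\<close>, the image of \<open>\<partial> x\<^sub>j\<close> in \<open>D\<close> equals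
  \<open>\<partial> b\<close> for some \<open>b\<close> with \<open>h b = f x\<^sub>j\<close>. Adjoin to \<open>D\<close> variables \<open>y\<close>, \<open>\<eta>\<close> with \<open>\<partial> y = 0\<close> and \<open>\<partial> \<eta> = y\<close>. In
  characteristic 0 this extension \<open>E\<close> retracts onto \<open>D\<close> by a quasi-isomorphism, and \<open>x\<^sub>j \<mapsto> y + b\<close>
  extends \<open>A\<^sub>j \<rightarrow> D\<close> to the next subalgebra. After the change of variables from \<open>y\<close> to \<open>y + b\<close>, the generators
  of \<open>D\<close> over \<open>A\<^sub>j\<close> together with \<open>\<eta>\<close> freely generate \<open>E\<close> over \<open>A\<^sub>j[x\<^sub>j]\<close>.\<close>

section \<open>Additive maps and direct sums\<close>

text \<open>Characteristic 0 enters through division. For odd \<open>d\<close> the variable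
  \<open>\<eta>\<close> has even degree and the differential of \<open>\<eta>^(n+1)\<close> is
  \<open>(n+1) y \<eta>^n\<close>, so the contracting homotopy divides by \<open>n+1\<close>;
  squares of odd elements vanish only after dividing by 2. Degrees at most 0 make the order of
  attachment work: \<open>\<partial> x_j\<close> has larger degree than \<open>x_j\<close>, so it
  cannot involve a generator of the same or smaller degree. Surjectivity of \<open>h\<close> is
  carried along because the triangle over \<open>B\<close> must commute strictly: one
  \<open>b\<close> has to satisfy both the condition on \<open>\<partial> b\<close> and
  \<open>h b = f x_j\<close>. The list of generators stays finite since each step adds only
  \<open>\<eta>\<close> to it. A formal obstacle shapes the rest. Adjoining a variable to an algebra
  on a type T yields an algebra on sequences in T. The induction therefore runs in a single T with
  an injection of \<open>nat \<Rightarrow> T\<close> into T, and the carrier type of the theorem is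
  such a T with room for a copy of \<open>B\<close>. Freeness is expressed by additive coordinate
  functions, so that towers, shifts and reorderings of bases become compositions of maps.\<close>

definition asub :: "('a, 'm) ring_scheme \<Rightarrow> 'a set \<Rightarrow> bool" where
  "asub N S \<longleftrightarrow> S \<subseteq> carrier N \<and> \<zero>\<^bsub>N\<^esub> \<in> S \<and> (\<forall>x\<in>S. \<forall>y\<in>S. x \<oplus>\<^bsub>N\<^esub> y \<in> S) \<and> (\<forall>x\<in>S. \<ominus>\<^bsub>N\<^esub> x \<in> S)"

text \<open>Additivity is relative to a set \<open>S\<close>, so that maps living only on a
  subalgebra or on a span need no ring record of their own; values outside \<open>S\<close> are
  arbitrary.\<close>

definition add_map :: "('a, 'm) ring_scheme \<Rightarrow> ('b, 'n) ring_scheme \<Rightarrow> 'a set \<Rightarrow> ('a \<Rightarrow> 'b) \<Rightarrow> bool" where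
  "add_map N M S f \<longleftrightarrow> f \<in> S \<rightarrow> carrier M \<and> (\<forall>x\<in>S. \<forall>y\<in>S. f (x \<oplus>\<^bsub>N\<^esub> y) = f x \<oplus>\<^bsub>M\<^esub> f y)"

text \<open>Sums are built one generator at a time, which gives an induction rule for spans. No
  negatives are added; the span is a subgroup once \<open>G\<close> is closed under negation, as
  images of subgroups are.\<close>

inductive_set aspan :: "('a, 'm) ring_scheme \<Rightarrow> 'a set \<Rightarrow> 'a set" for M G where
  aspan_zero: "\<zero>\<^bsub>M\<^esub> \<in> aspan M G"
| aspan_step: "g \<in> G \<Longrightarrow> x \<in> aspan M G \<Longrightarrow> g \<oplus>\<^bsub>M\<^esub> x \<in> aspan M G"

lemma asubD:
  assumes "asub N S"
  shows "S \<subseteq> carrier N" "\<zero>\<^bsub>N\<^esub> \<in> S" "x \<in> S \<Longrightarrow> y \<in> S \<Longrightarrow> x \<oplus>\<^bsub>N\<^esub> y \<in> S" "x \<in> S \<Longrightarrow> \<ominus>\<^bsub>N\<^esub> x \<in> S"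
    "x \<in> S \<Longrightarrow> x \<in> carrier N"
  using assms by (auto simp: asub_def)

lemma add_mapD:
  assumes "add_map N M S f"
  shows "x \<in> S \<Longrightarrow> f x \<in> carrier M" "x \<in> S \<Longrightarrow> y \<in> S \<Longrightarrow> f (x \<oplus>\<^bsub>N\<^esub> y) = f x \<oplus>\<^bsub>M\<^esub> f y"
  using assms by (auto simp: add_map_def)

lemma add_mapI:
  assumes "\<And>x. x \<in> S \<Longrightarrow> f x \<in> carrier M" "\<And>x y. x \<in> S \<Longrightarrow> y \<in> S \<Longrightarrow> f (x \<oplus>\<^bsub>N\<^esub> y) = f x \<oplus>\<^bsub>M\<^esub> f y"
  shows "add_map N M S f"
  using assms by (auto simp: add_map_def)

lemma aspan_least: "asub M T \<Longrightarrow> G \<subseteq> T \<Longrightarrow> aspan M G \<subseteq> T"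
proof
  fix x assume T: "asub M T" "G \<subseteq> T" "x \<in> aspan M G"
  from T(3) show "x \<in> T" by induction (use T in \<open>auto dest: asubD\<close>)
qed

context abelian_group
begin

lemma asub_carrier: "asub G (carrier G)"
  by (auto simp: asub_def)

lemma aspan_closed: "S \<subseteq> carrier G \<Longrightarrow> aspan G S \<subseteq> carrier G"
  using aspan_least[OF asub_carrier] .

lemma aspan_base: "g \<in> S \<Longrightarrow> S \<subseteq> carrier G \<Longrightarrow> g \<in> aspan G S"
  using aspan_step[of g S \<zero> G] aspan_zero[of G S] by force

lemma aspan_add:
  assumes "S \<subseteq> carrier G" "x \<in> aspan G S" "y \<in> aspan G S"
  shows "x \<oplus> y \<in> aspan G S"
  using assms(2)
proof induction
  case aspan_zero
  then show ?case using assms aspan_closed[OF assms(1)] by (subst l_zero) auto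
next
  case (aspan_step g x)
  have "g \<in> carrier G" "x \<in> carrier G" "y \<in> carrier G"
    using aspan_step assms aspan_closed by auto
  then show ?case using aspan_step by (auto simp: a_assoc intro: aspan.intros)
qed

lemma asub_aspan:
  assumes "S \<subseteq> carrier G" "\<And>x. x \<in> S \<Longrightarrow> \<ominus> x \<in> S"
  shows "asub G (aspan G S)"
proof -
  have "\<ominus> x \<in> aspan G S" if "x \<in> aspan G S" for x
    using that
  proof induction
    case aspan_zero
    have "\<ominus> \<zero> = \<zero>" by (rule minus_equality) auto
    then show ?case by (metis aspan.aspan_zero)
  next
    case (aspan_step g x)
    have "g \<in> carrier G" "x \<in> carrier G"
      using aspan_step assms aspan_closed by auto
    then show ?case using aspan_step assms by (auto simp: minus_add intro: aspan.intros)
  qed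
  then show ?thesis using assms aspan_closed aspan_add by (auto simp: asub_def aspan_zero)
qed

lemma asub_finsum:
  assumes "asub G S" "\<And>i. i \<in> J \<Longrightarrow> f i \<in> S"
  shows "finsum G f J \<in> S"
proof (cases "finite J")
  case True
  then show ?thesis using assms(2)
  proof (induction J rule: finite_induct)
    case empty
    then show ?case using asubD(2)[OF assms(1)] by simp
  next
    case (insert i J)
    then have "finsum G f (insert i J) = f i \<oplus> finsum G f J"
      using asubD[OF assms(1)] by (subst finsum_insert) auto
    then show ?case using insert asubD[OF assms(1)] by auto
  qed
next
  case False
  then show ?thesis using asubD(2)[OF assms(1)] by simp
qed

lemma finsum_enlarge:
  assumes "finite J'" "J \<subseteq> J'" "\<And>i. i \<in> J' - J \<Longrightarrow> f i = \<zero>" "f \<in> J' \<rightarrow> carrier G"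
  shows "finsum G f J = finsum G f J'"
  using assms by (intro add.finprod_mono_neutral_cong_left) auto

end

lemma add_map_zero:
  assumes "abelian_group N" "abelian_group M" "asub N S" "add_map N M S f"
  shows "f \<zero>\<^bsub>N\<^esub> = \<zero>\<^bsub>M\<^esub>"
proof -
  interpret N: abelian_group N by fact
  interpret M: abelian_group M by fact
  have z: "\<zero>\<^bsub>N\<^esub> \<in> S" using asubD(2)[OF assms(3)] .
  have "f \<zero>\<^bsub>N\<^esub> \<oplus>\<^bsub>M\<^esub> f \<zero>\<^bsub>N\<^esub> = f \<zero>\<^bsub>N\<^esub>"
    using add_mapD(2)[OF assms(4) z z] by simp
  then show ?thesis using add_mapD(1)[OF assms(4) z] by (metis M.add.r_cancel_one')
qed

lemma add_map_minus:
  assumes "abelian_group N" "abelian_group M" "asub N S" "add_map N M S f" "x \<in> S"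
  shows "f (\<ominus>\<^bsub>N\<^esub> x) = \<ominus>\<^bsub>M\<^esub> f x"
proof -
  interpret N: abelian_group N by fact
  interpret M: abelian_group M by fact
  have x: "x \<in> carrier N" "\<ominus>\<^bsub>N\<^esub> x \<in> S" using assms asubD by auto
  have "f (\<ominus>\<^bsub>N\<^esub> x) \<oplus>\<^bsub>M\<^esub> f x = \<zero>\<^bsub>M\<^esub>"
    using add_mapD(2)[OF assms(4) x(2) assms(5)] x(1) add_map_zero[OF assms(1-4)] by (simp add: N.l_neg)
  then show ?thesis using add_mapD(1)[OF assms(4)] assms(5) x by (metis M.minus_equality)
qed

lemma add_map_finsum:
  assumes "abelian_group N" "abelian_group M" "asub N S" "add_map N M S f" "\<And>i. i \<in> J \<Longrightarrow> g i \<in> S"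
  shows "f (finsum N g J) = finsum M (\<lambda>i. f (g i)) J"
proof -
  interpret N: abelian_group N by fact
  interpret M: abelian_group M by fact
  note S = asubD[OF assms(3)]
  note f = add_mapD[OF assms(4)]
  show ?thesis
  proof (cases "finite J")
    case True
    then show ?thesis using assms(5)
    proof (induction J rule: finite_induct)
      case empty
      then show ?case using add_map_zero[OF assms(1-4)] by simp
    next
      case (insert i J)
      have "f (finsum N g (insert i J)) = f (g i \<oplus>\<^bsub>N\<^esub> finsum N g J)"
        using insert S by (subst N.finsum_insert) auto
      also have "\<dots> = f (g i) \<oplus>\<^bsub>M\<^esub> f (finsum N g J)"
        using insert N.asub_finsum[OF assms(3), of J g] by (subst f) auto
      also have "\<dots> = finsum M (\<lambda>i. f (g i)) (insert i J)"
        using insert f by (subst M.finsum_insert) auto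
      finally show ?case .
    qed
  next
    case False
    then show ?thesis using add_map_zero[OF assms(1-4)] by simp
  qed
qed

lemma add_map_comp:
  assumes "add_map N M S f" "add_map M L S' f'" "\<And>x. x \<in> S \<Longrightarrow> f x \<in> S'"
  shows "add_map N L S (\<lambda>x. f' (f x))"
  using assms by (auto simp: add_map_def)

lemma add_map_subset: "add_map N M S f \<Longrightarrow> S' \<subseteq> S \<Longrightarrow> add_map N M S' f"
  by (auto simp: add_map_def)

lemma add_map_eq_aspan:
  assumes "abelian_group N" "abelian_group M" "G \<subseteq> carrier N" "\<And>x. x \<in> G \<Longrightarrow> \<ominus>\<^bsub>N\<^esub> x \<in> G"
    "add_map N M (aspan N G) f" "add_map N M (aspan N G) f'" "\<And>x. x \<in> G \<Longrightarrow> f x = f' x"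
    "x \<in> aspan N G"
  shows "f x = f' x"
proof -
  interpret N: abelian_group N by fact
  note a = N.asub_aspan[OF assms(3,4)]
  from assms(8) show ?thesis
  proof induction
    case aspan_zero
    then show ?case using add_map_zero[OF assms(1,2) a] assms by metis
  next
    case (aspan_step g x)
    then show ?case using add_mapD(2)[OF assms(5), of g x] add_mapD(2)[OF assms(6), of g x]
       N.aspan_base[OF _ assms(3)] assms by auto
  qed
qed

section \<open>Direct sums described by coordinate functions\<close>

definition dgen :: "'i set \<Rightarrow> ('i \<Rightarrow> 's set) \<Rightarrow> ('i \<Rightarrow> 's \<Rightarrow> 'a) \<Rightarrow> 'a set" where
  "dgen I S j = (\<Union>i\<in>I. j i ` S i)"

text \<open>Dual coordinates: \<open>\<kappa> i\<close> recovers the summand \<open>i\<close> and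
  kills the others. This forces every \<open>j i\<close> to be injective on \<open>S i\<close> and
  the sum of the images to be direct.\<close>

definition coords :: "('s, 'n) ring_scheme \<Rightarrow> ('a, 'm) ring_scheme \<Rightarrow> 'i set \<Rightarrow> ('i \<Rightarrow> 's set) \<Rightarrow>
    ('i \<Rightarrow> 's \<Rightarrow> 'a) \<Rightarrow> ('i \<Rightarrow> 'a \<Rightarrow> 's) \<Rightarrow> bool" where
  "coords N M I S j \<kappa> \<longleftrightarrow> (\<forall>i\<in>I. add_map M N (aspan M (dgen I S j)) (\<kappa> i) \<and>
       (\<forall>l\<in>I. \<forall>s\<in>S l. \<kappa> i (j l s) = (if i = l then s else \<zero>\<^bsub>N\<^esub>)))"

text \<open>The span of the images of the \<open>j i\<close> is the direct sum of the groups \<open>S i\<close>; directness is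
  expressed by the existence of additive coordinate functions.\<close>
definition dsum :: "('s, 'n) ring_scheme \<Rightarrow> ('a, 'm) ring_scheme \<Rightarrow> 'i set \<Rightarrow> ('i \<Rightarrow> 's set) \<Rightarrow>
    ('i \<Rightarrow> 's \<Rightarrow> 'a) \<Rightarrow> bool" where
  "dsum N M I S j \<longleftrightarrow> (\<forall>i\<in>I. asub N (S i) \<and> add_map N M (S i) (j i)) \<and> (\<exists>\<kappa>. coords N M I S j \<kappa>)"

lemma dgen_props:
  assumes "abelian_group N" "abelian_group M" "\<forall>i\<in>I. asub N (S i) \<and> add_map N M (S i) (j i)"
  shows "dgen I S j \<subseteq> carrier M" "x \<in> dgen I S j \<Longrightarrow> \<ominus>\<^bsub>M\<^esub> x \<in> dgen I S j"
    "asub M (aspan M (dgen I S j))" "i \<in> I \<Longrightarrow> s \<in> S i \<Longrightarrow> j i s \<in> aspan M (dgen I S j)"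
    "aspan M (dgen I S j) \<subseteq> carrier M"
proof -
  interpret N: abelian_group N by fact
  interpret M: abelian_group M by fact
  show 1: "dgen I S j \<subseteq> carrier M" using assms(3) by (auto simp: dgen_def add_map_def)
  show 2: "\<ominus>\<^bsub>M\<^esub> x \<in> dgen I S j" if x: "x \<in> dgen I S j" for x
  proof -
    have "\<exists>i\<in>I. \<exists>s\<in>S i. x = j i s" using x by (simp only: dgen_def UN_iff image_iff)
    then obtain i s where i: "i \<in> I" "s \<in> S i" "x = j i s" by (elim bexE)
    then have "\<ominus>\<^bsub>M\<^esub> x = j i (\<ominus>\<^bsub>N\<^esub> s)" using add_map_minus[OF assms(1,2)] assms(3) by metis
    moreover have "asub N (S i)" using assms(3) i by simp
    then have "\<ominus>\<^bsub>N\<^esub> s \<in> S i" using i by (simp add: asubD(4))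
    ultimately show ?thesis using i by (auto simp: dgen_def)
  qed
  show "asub M (aspan M (dgen I S j))" by (rule M.asub_aspan[OF 1 2])
  then show "aspan M (dgen I S j) \<subseteq> carrier M" by (rule asubD)
  show "j i s \<in> aspan M (dgen I S j)" if "i \<in> I" "s \<in> S i"
    by (rule M.aspan_base[OF _ 1]) (use that in \<open>auto simp: dgen_def\<close>)
qed

text \<open>Induction over the span: adding a generator from summand \<open>l\<close> changes only
  the coordinate \<open>l\<close>, and changes it by an element of \<open>S l\<close>.\<close>

lemma coords_props:
  assumes "abelian_group N" "abelian_group M" "\<forall>i\<in>I. asub N (S i) \<and> add_map N M (S i) (j i)"
    "coords N M I S j \<kappa>" "x \<in> aspan M (dgen I S j)"
  shows "i \<in> I \<Longrightarrow> \<kappa> i x \<in> S i" "finite {i\<in>I. \<kappa> i x \<noteq> \<zero>\<^bsub>N\<^esub>}"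
proof -
  interpret N: abelian_group N by fact
  interpret M: abelian_group M by fact
  note P = dgen_props[OF assms(1-3)]
  have z: "\<kappa> i \<zero>\<^bsub>M\<^esub> = \<zero>\<^bsub>N\<^esub>" if "i \<in> I" for i
    using add_map_zero[OF assms(2,1) P(3)] assms(4) that by (auto simp: coords_def)
  have a: "\<kappa> i (j l s \<oplus>\<^bsub>M\<^esub> x) = (if i = l then s else \<zero>\<^bsub>N\<^esub>) \<oplus>\<^bsub>N\<^esub> \<kappa> i x"
    if "i \<in> I" "l \<in> I" "s \<in> S l" "x \<in> aspan M (dgen I S j)" for i l s x
  proof -
    have "\<kappa> i (j l s \<oplus>\<^bsub>M\<^esub> x) = \<kappa> i (j l s) \<oplus>\<^bsub>N\<^esub> \<kappa> i x"
      using assms(4) that P(4) by (intro add_mapD(2)) (auto simp: coords_def)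
    then show ?thesis using assms(4) that by (auto simp: coords_def)
  qed
  show "\<kappa> i x \<in> S i" if i: "i \<in> I"
    using assms(5)
  proof induction
    case aspan_zero
    then show ?case using z i assms asubD by fastforce
  next
    case (aspan_step g x)
    then obtain l s where l: "l \<in> I" "s \<in> S l" "g = j l s" by (auto simp: dgen_def)
    have S: "asub N (S i)" using i assms(3) by auto
    then show ?case using a[OF i l(1,2) aspan_step(2)] l aspan_step asubD[OF S] by auto
  qed
  show "finite {i\<in>I. \<kappa> i x \<noteq> \<zero>\<^bsub>N\<^esub>}"
    using assms(5)
  proof induction
    case aspan_zero
    then show ?case using z by (auto intro: finite_subset[of _ "{}"])
  next
    case (aspan_step g x)
    then obtain l s where l: "l \<in> I" "s \<in> S l" "g = j l s" by (auto simp: dgen_def)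
    have "{i\<in>I. \<kappa> i (g \<oplus>\<^bsub>M\<^esub> x) \<noteq> \<zero>\<^bsub>N\<^esub>} \<subseteq> insert l {i\<in>I. \<kappa> i x \<noteq> \<zero>\<^bsub>N\<^esub>}"
      using a[OF _ l(1,2) aspan_step(2)] l by auto
    then show ?case using aspan_step finite_subset by blast
  qed
qed

text \<open>Universal property of the direct sum, with an explicit formula for the induced map.
  Additivity is seen by evaluating all sums over the union of the two supports, where the extra
  terms are images of zero.\<close>

lemma coords_ext:
  assumes "abelian_group N" "abelian_group M" "abelian_group L"
    "\<forall>i\<in>I. asub N (S i) \<and> add_map N M (S i) (j i)" "coords N M I S j \<kappa>"
    "\<And>i. i \<in> I \<Longrightarrow> add_map N L (S i) (F i)"
  defines "H \<equiv> \<lambda>x. finsum L (\<lambda>i. F i (\<kappa> i x)) {i\<in>I. \<kappa> i x \<noteq> \<zero>\<^bsub>N\<^esub>}"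
  shows "add_map M L (aspan M (dgen I S j)) H" "i \<in> I \<Longrightarrow> s \<in> S i \<Longrightarrow> H (j i s) = F i s"
proof -
  interpret N: abelian_group N by fact
  interpret M: abelian_group M by fact
  interpret L: abelian_group L by fact
  let ?X = "aspan M (dgen I S j)"
  note P = dgen_props[OF assms(1,2,4)]
  note C = coords_props[OF assms(1,2,4,5)]
  have Fc: "F i (\<kappa> i x) \<in> carrier L" if "i \<in> I" "x \<in> ?X" for i x
    using assms(6) C(1) that add_mapD(1) by metis
  have F0: "F i \<zero>\<^bsub>N\<^esub> = \<zero>\<^bsub>L\<^esub>" if "i \<in> I" for i
    using add_map_zero[OF assms(1,3) _ assms(6)] assms(4) that by auto
  have H: "H x = finsum L (\<lambda>i. F i (\<kappa> i x)) J"
    if "x \<in> ?X" "finite J" "J \<subseteq> I" "{i\<in>I. \<kappa> i x \<noteq> \<zero>\<^bsub>N\<^esub>} \<subseteq> J" for x J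
    unfolding H_def using that F0 Fc by (intro L.finsum_enlarge) auto
  show "add_map M L ?X H"
  proof (rule add_mapI)
    show "H x \<in> carrier L" if "x \<in> ?X" for x
      unfolding H_def using Fc that by (intro L.finsum_closed) auto
    fix x y assume xy: "x \<in> ?X" "y \<in> ?X"
    let ?J = "{i\<in>I. \<kappa> i x \<noteq> \<zero>\<^bsub>N\<^esub>} \<union> {i\<in>I. \<kappa> i y \<noteq> \<zero>\<^bsub>N\<^esub>}"
    have k: "\<kappa> i (x \<oplus>\<^bsub>M\<^esub> y) = \<kappa> i x \<oplus>\<^bsub>N\<^esub> \<kappa> i y" if "i \<in> I" for i
      using assms(5) that xy by (auto simp: coords_def add_map_def)
    have fin: "finite ?J" using C(2) xy by auto
    have "H (x \<oplus>\<^bsub>M\<^esub> y) = finsum L (\<lambda>i. F i (\<kappa> i (x \<oplus>\<^bsub>M\<^esub> y))) ?J"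
      using asubD(3)[OF P(3)] xy fin k by (intro H) auto
    also have "\<dots> = finsum L (\<lambda>i. F i (\<kappa> i x) \<oplus>\<^bsub>L\<^esub> F i (\<kappa> i y)) ?J"
      using k xy Fc C(1) add_mapD(2)[OF assms(6)] by (intro L.finsum_cong') auto
    also have "\<dots> = finsum L (\<lambda>i. F i (\<kappa> i x)) ?J \<oplus>\<^bsub>L\<^esub> finsum L (\<lambda>i. F i (\<kappa> i y)) ?J"
      using xy Fc by (intro L.finsum_addf) auto
    also have "\<dots> = H x \<oplus>\<^bsub>L\<^esub> H y"
      using H[OF xy(1) fin] H[OF xy(2) fin] by auto
    finally show "H (x \<oplus>\<^bsub>M\<^esub> y) = H x \<oplus>\<^bsub>L\<^esub> H y" .
  qed
  assume i: "i \<in> I" "s \<in> S i"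
  have k: "\<kappa> l (j i s) = (if l = i then s else \<zero>\<^bsub>N\<^esub>)" if "l \<in> I" for l
    using assms(5) i that by (auto simp: coords_def)
  have "F i s \<in> carrier L" using assms(6) i add_mapD(1) by metis
  have "H (j i s) = finsum L (\<lambda>l. F l (\<kappa> l (j i s))) {i}"
    using k i P(4)[OF i] by (intro H) (auto split: if_splits)
  also have "\<dots> = F i s" using k[OF i(1)] \<open>F i s \<in> carrier L\<close> by simp
  finally show "H (j i s) = F i s" .
qed

lemma dsum_ext:
  assumes "abelian_group N" "abelian_group M" "abelian_group L" "dsum N M I S j"
    "\<And>i. i \<in> I \<Longrightarrow> add_map N L (S i) (F i)"
  obtains H where "add_map M L (aspan M (dgen I S j)) H" "\<And>i s. i \<in> I \<Longrightarrow> s \<in> S i \<Longrightarrow> H (j i s) = F i s"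
proof -
  obtain \<kappa> where \<kappa>: "coords N M I S j \<kappa>" and S: "\<forall>i\<in>I. asub N (S i) \<and> add_map N M (S i) (j i)"
    using assms(4) unfolding dsum_def by blast
  show thesis
    by (rule that[OF coords_ext[OF assms(1-3) S \<kappa> assms(5)]])
qed

text \<open>The right side is the map induced by the family \<open>j\<close> itself; it agrees with
  the identity on the generators, hence on their span.\<close>

lemma coords_finsum:
  assumes "abelian_group N" "abelian_group M" "\<forall>i\<in>I. asub N (S i) \<and> add_map N M (S i) (j i)"
    "coords N M I S j \<kappa>" "x \<in> aspan M (dgen I S j)"
  shows "x = finsum M (\<lambda>i. j i (\<kappa> i x)) {i\<in>I. \<kappa> i x \<noteq> \<zero>\<^bsub>N\<^esub>}"
proof -
  note P = dgen_props[OF assms(1-3)]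
  note E = coords_ext[OF assms(1,2,2,3,4), of j]
  show ?thesis
    by (rule add_map_eq_aspan[OF assms(2,2) P(1,2) _ E(1) _ assms(5)])
      (use assms P E(2) in \<open>auto simp: add_map_def dgen_def\<close>)
qed

lemma coords_unique:
  assumes "abelian_group N" "abelian_group M" "\<forall>i\<in>I. asub N (S i) \<and> add_map N M (S i) (j i)"
    "coords N M I S j \<kappa>" "finite J" "J \<subseteq> I" "\<And>i. i \<in> J \<Longrightarrow> g i \<in> S i" "l \<in> I"
  shows "\<kappa> l (finsum M (\<lambda>i. j i (g i)) J) = (if l \<in> J then g l else \<zero>\<^bsub>N\<^esub>)"
proof -
  interpret N: abelian_group N by fact
  interpret M: abelian_group M by fact
  note P = dgen_props[OF assms(1-3)]
  have "\<kappa> l (finsum M (\<lambda>i. j i (g i)) J) = finsum N (\<lambda>i. \<kappa> l (j i (g i))) J"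
    by (rule add_map_finsum[OF assms(2,1) P(3)]) (use assms P(4) in \<open>auto simp: coords_def\<close>)
  also have "\<dots> = finsum N (\<lambda>i. if l = i then g i else \<zero>\<^bsub>N\<^esub>) J"
  proof (intro N.finsum_cong')
    have "g i \<in> carrier N" if "i \<in> J" for i
    proof (rule asubD(5))
      show "asub N (S i)" using assms(3,6) that by auto
    qed (rule assms(7)[OF that])
    then show "(\<lambda>i. if l = i then g i else \<zero>\<^bsub>N\<^esub>) \<in> J \<rightarrow> carrier N" by simp
    show "\<kappa> l (j i (g i)) = (if l = i then g i else \<zero>\<^bsub>N\<^esub>)" if "i \<in> J" for i
      using assms(4) assms(6-8) that by (auto simp: coords_def)
  qed auto
  also have "\<dots> = (if l \<in> J then g l else \<zero>\<^bsub>N\<^esub>)"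
  proof (cases "l \<in> J")
    case True
    have "g i \<in> carrier N" if "i \<in> J" for i
    proof (rule asubD(5))
      show "asub N (S i)" using assms(3,6) that by auto
    qed (rule assms(7)[OF that])
    then have "g \<in> J \<rightarrow> carrier N" by simp
    then show ?thesis using N.finsum_singleton[of l J g] assms(5) True by simp
  next
    case False
    then have "finsum N (\<lambda>i. if l = i then g i else \<zero>\<^bsub>N\<^esub>) J = finsum N (\<lambda>i. \<zero>\<^bsub>N\<^esub>) J"
      by (intro N.finsum_cong') auto
    then show ?thesis using False by simp
  qed
  finally show ?thesis .
qed

text \<open>Independence makes the representation of each element of the span unique, so any choice
  of representations is additive and provides the coordinates.\<close>

lemma dsum_of_independent:
  assumes "abelian_group N" "abelian_group M" "\<forall>i\<in>I. asub N (S i) \<and> add_map N M (S i) (j i)"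
    "\<And>g J. finite J \<Longrightarrow> J \<subseteq> I \<Longrightarrow> (\<And>i. i \<in> I \<Longrightarrow> g i \<in> S i) \<Longrightarrow> finsum M (\<lambda>i. j i (g i)) J = \<zero>\<^bsub>M\<^esub>
        \<Longrightarrow> (\<forall>i\<in>J. g i = \<zero>\<^bsub>N\<^esub>)"
  shows "dsum N M I S j"
proof -
  interpret N: abelian_group N by fact
  interpret M: abelian_group M by fact
  let ?X = "aspan M (dgen I S j)"
  note P = dgen_props[OF assms(1-3)]
  \<comment> \<open>\<open>R x g J\<close> says that the family \<open>g\<close>, supported in
    \<open>J\<close>, represents \<open>x\<close>. Allowing \<open>J\<close> to exceed the support
    lets two representations be put over a common index set.\<close>
  define R where "R x g J \<longleftrightarrow> finite J \<and> J \<subseteq> I \<and> (\<forall>i\<in>I. g i \<in> S i) \<and> (\<forall>i\<in>I-J. g i = \<zero>\<^bsub>N\<^esub>) \<and>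
     x = finsum M (\<lambda>i. j i (g i)) J" for x g J
  have S: "asub N (S i)" "add_map N M (S i) (j i)" if "i \<in> I" for i using assms(3) that by auto
  have j0: "j i \<zero>\<^bsub>N\<^esub> = \<zero>\<^bsub>M\<^esub>" if "i \<in> I" for i using add_map_zero[OF assms(1,2)] S that by metis
  have jc: "j i s \<in> carrier M" if "i \<in> I" "s \<in> S i" for i s using S that add_mapD(1) by metis
  have R_enlarge: "R x g J'" if "R x g J" "finite J'" "J \<subseteq> J'" "J' \<subseteq> I" for x g J J'
  proof -
    have "finsum M (\<lambda>i. j i (g i)) J = finsum M (\<lambda>i. j i (g i)) J'"
      using that j0 jc by (intro M.finsum_enlarge) (auto simp: R_def)
    then show ?thesis using that by (auto simp: R_def)
  qed
  have R_single: "R (j l s) (\<lambda>i. if i = l then s else \<zero>\<^bsub>N\<^esub>) {l}" if "l \<in> I" "s \<in> S l" for l s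
    using that jc[OF that] S asubD(2) by (auto simp: R_def)
  have R_add: "R (x \<oplus>\<^bsub>M\<^esub> y) (\<lambda>i. g i \<oplus>\<^bsub>N\<^esub> g' i) (J \<union> J')" if "R x g J" "R y g' J'" for x y g g' J J'
  proof -
    have "R x g (J \<union> J')" "R y g' (J \<union> J')"
      by (rule R_enlarge[OF that(1)] R_enlarge[OF that(2)]; use that in \<open>simp add: R_def\<close>)+
    moreover from this have "finsum M (\<lambda>i. j i (g i \<oplus>\<^bsub>N\<^esub> g' i)) (J \<union> J') = 
        finsum M (\<lambda>i. j i (g i) \<oplus>\<^bsub>M\<^esub> j i (g' i)) (J \<union> J')"
    proof (intro M.finsum_cong')
      fix i assume "i \<in> J \<union> J'"
      then have "i \<in> I" "g i \<in> S i" "g' i \<in> S i" using that by (auto simp: R_def)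
      then show "j i (g i \<oplus>\<^bsub>N\<^esub> g' i) = j i (g i) \<oplus>\<^bsub>M\<^esub> j i (g' i)"
        using add_mapD(2)[OF S(2)] by simp
    next
      have "i \<in> I \<and> g i \<in> S i \<and> g' i \<in> S i" if "i \<in> J \<union> J'" for i
        using that \<open>R x g J\<close> \<open>R y g' J'\<close> by (auto simp: R_def)
      then show "(\<lambda>i. j i (g i) \<oplus>\<^bsub>M\<^esub> j i (g' i)) \<in> J \<union> J' \<rightarrow> carrier M"
        using jc by simp
    qed simp
    moreover have "\<dots> = finsum M (\<lambda>i. j i (g i)) (J \<union> J') \<oplus>\<^bsub>M\<^esub> finsum M (\<lambda>i. j i (g' i)) (J \<union> J')"
    proof (rule M.finsum_addf)
      have "i \<in> I \<and> g i \<in> S i \<and> g' i \<in> S i" if "i \<in> J \<union> J'" for i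
        using that \<open>R x g J\<close> \<open>R y g' J'\<close> by (auto simp: R_def)
      then show "(\<lambda>i. j i (g i)) \<in> J \<union> J' \<rightarrow> carrier M" "(\<lambda>i. j i (g' i)) \<in> J \<union> J' \<rightarrow> carrier M"
        using jc by simp_all
    qed
    ultimately have "x \<oplus>\<^bsub>M\<^esub> y = finsum M (\<lambda>i. j i (g i \<oplus>\<^bsub>N\<^esub> g' i)) (J \<union> J')"
      by (simp only: R_def)
    moreover have "\<forall>i\<in>I. g i \<oplus>\<^bsub>N\<^esub> g' i \<in> S i"
      using that asubD(3)[OF S(1)] by (simp add: R_def)
    moreover have "\<forall>i\<in>I - (J \<union> J'). g i \<oplus>\<^bsub>N\<^esub> g' i = \<zero>\<^bsub>N\<^esub>"
      using that by (simp add: R_def)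
    moreover have "finite (J \<union> J')" "J \<union> J' \<subseteq> I" using that by (simp_all add: R_def)
    ultimately show ?thesis by (simp only: R_def simp_thms)
  qed
  have R_ex: "\<exists>g J. R x g J" if "x \<in> ?X" for x
    using that
  proof induction
    case aspan_zero
    have "R \<zero>\<^bsub>M\<^esub> (\<lambda>_. \<zero>\<^bsub>N\<^esub>) {}" using S asubD(2) by (auto simp: R_def)
    then show ?case by blast
  next
    case (aspan_step h x)
    then obtain l s where "l \<in> I" "s \<in> S l" "h = j l s" by (auto simp: dgen_def)
    moreover obtain g J where "R x g J" using aspan_step by blast
    ultimately show ?case using R_add[OF R_single] by blast
  qed
  have R_uniq: "g i = g' i" if "R x g J" "R x g' J'" "i \<in> I" for x g g' J J' i
  proof -
    \<comment> \<open>The negated family represents \<open>- x\<close>; adding it to the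
      representation \<open>g\<close> of \<open>x\<close> represents zero, to which independence
      applies.\<close>
    let ?m = "\<lambda>i. \<ominus>\<^bsub>N\<^esub> g' i"
    have xc: "x \<in> carrier M" using that(1) jc by (auto simp: R_def intro!: M.finsum_closed)
    have m: "finsum M (\<lambda>i. j i (?m i)) J' = \<ominus>\<^bsub>M\<^esub> x"
    proof -
      have g': "i \<in> I" "g' i \<in> S i" "j i (g' i) \<in> carrier M" if "i \<in> J'" for i
        using that \<open>R x g' J'\<close> jc by (auto simp: R_def)
      have "j i (?m i) = \<ominus>\<^bsub>M\<^esub> (j i (g' i))" if "i \<in> J'" for i
        by (rule add_map_minus[OF assms(1,2) S[OF g'(1)[OF that]] g'(2)[OF that]])
      then have "finsum M (\<lambda>i. j i (?m i)) J' = finsum M (\<lambda>i. \<ominus>\<^bsub>M\<^esub> (j i (g' i))) J'"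
        by (intro M.finsum_cong') (auto simp: g'(3))
      also have "\<dots> = \<ominus>\<^bsub>M\<^esub> finsum M (\<lambda>i. j i (g' i)) J'"
        by (rule add_map_finsum[symmetric, OF assms(2,2) M.asub_carrier])
          (auto simp: g'(3) M.minus_add intro!: add_mapI)
      also have "finsum M (\<lambda>i. j i (g' i)) J' = x" using \<open>R x g' J'\<close> by (simp only: R_def)
      finally show ?thesis .
    qed
    have "R (\<ominus>\<^bsub>M\<^esub> x) ?m J'"
      unfolding R_def using that(2) m asubD(4)[OF S(1)] by (simp add: R_def)
    from R_add[OF that(1) this] have r: "R \<zero>\<^bsub>M\<^esub> (\<lambda>i. g i \<oplus>\<^bsub>N\<^esub> \<ominus>\<^bsub>N\<^esub> g' i) (J \<union> J')"
      using xc by (simp add: M.r_neg)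
    have "g i \<oplus>\<^bsub>N\<^esub> \<ominus>\<^bsub>N\<^esub> g' i = \<zero>\<^bsub>N\<^esub>"
    proof (cases "i \<in> J \<union> J'")
      case True
      have "\<forall>i\<in>J \<union> J'. g i \<oplus>\<^bsub>N\<^esub> \<ominus>\<^bsub>N\<^esub> g' i = \<zero>\<^bsub>N\<^esub>"
        by (rule assms(4)) (use r in \<open>simp_all only: R_def\<close>)
      with True show ?thesis by blast
    next
      case False
      then show ?thesis using r that(3) by (simp add: R_def)
    qed
    moreover have "g i \<in> carrier N" "g' i \<in> carrier N"
      using that asubD(5)[OF S(1)[OF that(3)]] by (auto simp: R_def)
    ultimately show "g i = g' i" using N.minus_equality[of "g i" "\<ominus>\<^bsub>N\<^esub> g' i"] by simp
  qed
  \<comment> \<open>The representation is chosen for \<open>x\<close> before the index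
    \<open>i\<close> is applied, so all coordinates of \<open>x\<close> come from one and the same
    family.\<close>
  define \<kappa> where "\<kappa> i x = (SOME g. \<exists>J. R x g J) i" for i x
  have \<kappa>: "\<exists>J. R x (\<lambda>i. \<kappa> i x) J" if "x \<in> ?X" for x
    unfolding \<kappa>_def using someI_ex[OF R_ex[OF that]] by simp
  have "coords N M I S j \<kappa>"
    unfolding coords_def
  proof (intro ballI conjI add_mapI)
    fix i x y assume i: "i \<in> I" and x: "x \<in> ?X"
    obtain J where "R x (\<lambda>i. \<kappa> i x) J" using \<kappa>[OF x] by blast
    then show "\<kappa> i x \<in> carrier N" using asubD(5)[OF S(1)[OF i]] i by (simp add: R_def)
    assume y: "y \<in> ?X"
    have xy: "x \<oplus>\<^bsub>M\<^esub> y \<in> ?X" using x y P(3) by (auto dest: asubD)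
    show "\<kappa> i (x \<oplus>\<^bsub>M\<^esub> y) = \<kappa> i x \<oplus>\<^bsub>N\<^esub> \<kappa> i y"
    proof -
      obtain J J' J'' where "R x (\<lambda>i. \<kappa> i x) J" "R y (\<lambda>i. \<kappa> i y) J'"
        and 3: "R (x \<oplus>\<^bsub>M\<^esub> y) (\<lambda>i. \<kappa> i (x \<oplus>\<^bsub>M\<^esub> y)) J''"
        using \<kappa>[OF x] \<kappa>[OF y] \<kappa>[OF xy] by blast
      from R_uniq[OF 3 R_add[OF this(1,2)] i] show ?thesis .
    qed
  next
    fix i l s assume i: "i \<in> I" and l: "l \<in> I" "s \<in> S l"
    show "\<kappa> i (j l s) = (if i = l then s else \<zero>\<^bsub>N\<^esub>)"
    proof -
      obtain J where "R (j l s) (\<lambda>i. \<kappa> i (j l s)) J" using \<kappa>[OF P(4)[OF l]] by blast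
      from R_uniq[OF this R_single[OF l] i] show ?thesis .
    qed
  qed
  then show ?thesis using assms(3) unfolding dsum_def by blast
qed

section \<open>Differential graded algebras\<close>

lemma is_dgaD:
  assumes "is_dga D"
  shows "ring D"
    "x \<in> carrier D \<Longrightarrow> c \<odot>\<^bsub>D\<^esub> x \<in> carrier D"
    "x \<in> carrier D \<Longrightarrow> (c + d) \<odot>\<^bsub>D\<^esub> x = (c \<odot>\<^bsub>D\<^esub> x) \<oplus>\<^bsub>D\<^esub> (d \<odot>\<^bsub>D\<^esub> x)"
    "x \<in> carrier D \<Longrightarrow> y \<in> carrier D \<Longrightarrow> c \<odot>\<^bsub>D\<^esub> (x \<oplus>\<^bsub>D\<^esub> y) = (c \<odot>\<^bsub>D\<^esub> x) \<oplus>\<^bsub>D\<^esub> (c \<odot>\<^bsub>D\<^esub> y)"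
    "x \<in> carrier D \<Longrightarrow> (c * d) \<odot>\<^bsub>D\<^esub> x = c \<odot>\<^bsub>D\<^esub> (d \<odot>\<^bsub>D\<^esub> x)"
    "x \<in> carrier D \<Longrightarrow> 1 \<odot>\<^bsub>D\<^esub> x = x"
    "x \<in> carrier D \<Longrightarrow> y \<in> carrier D \<Longrightarrow> (c \<odot>\<^bsub>D\<^esub> x) \<otimes>\<^bsub>D\<^esub> y = c \<odot>\<^bsub>D\<^esub> (x \<otimes>\<^bsub>D\<^esub> y)"
    "x \<in> carrier D \<Longrightarrow> y \<in> carrier D \<Longrightarrow> x \<otimes>\<^bsub>D\<^esub> (c \<odot>\<^bsub>D\<^esub> y) = c \<odot>\<^bsub>D\<^esub> (x \<otimes>\<^bsub>D\<^esub> y)"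
    "homog D n \<subseteq> carrier D" "\<zero>\<^bsub>D\<^esub> \<in> homog D n"
    "x \<in> homog D n \<Longrightarrow> y \<in> homog D n \<Longrightarrow> x \<oplus>\<^bsub>D\<^esub> y \<in> homog D n"
    "x \<in> homog D n \<Longrightarrow> c \<odot>\<^bsub>D\<^esub> x \<in> homog D n"
    "x \<in> carrier D \<Longrightarrow> \<exists>!h. (\<forall>n. h n \<in> homog D n) \<and> finite {n. h n \<noteq> \<zero>\<^bsub>D\<^esub>} \<and> 
        x = finsum D h {n. h n \<noteq> \<zero>\<^bsub>D\<^esub>}"
    "\<one>\<^bsub>D\<^esub> \<in> homog D 0"
    "x \<in> homog D m \<Longrightarrow> y \<in> homog D n \<Longrightarrow> x \<otimes>\<^bsub>D\<^esub> y \<in> homog D (m + n)"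
    "x \<in> homog D m \<Longrightarrow> y \<in> homog D n \<Longrightarrow> x \<otimes>\<^bsub>D\<^esub> y = sgn_mul D (m * n) (y \<otimes>\<^bsub>D\<^esub> x)"
    "x \<in> carrier D \<Longrightarrow> y \<in> carrier D \<Longrightarrow> differential D (x \<oplus>\<^bsub>D\<^esub> y) = differential D x \<oplus>\<^bsub>D\<^esub> differential D y"
    "x \<in> carrier D \<Longrightarrow> differential D (c \<odot>\<^bsub>D\<^esub> x) = c \<odot>\<^bsub>D\<^esub> differential D x"
    "x \<in> homog D n \<Longrightarrow> differential D x \<in> homog D (n + 1)"
    "x \<in> carrier D \<Longrightarrow> differential D (differential D x) = \<zero>\<^bsub>D\<^esub>"
    "x \<in> homog D m \<Longrightarrow> y \<in> carrier D \<Longrightarrow> differential D (x \<otimes>\<^bsub>D\<^esub> y) =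
          (differential D x \<otimes>\<^bsub>D\<^esub> y) \<oplus>\<^bsub>D\<^esub> sgn_mul D m (x \<otimes>\<^bsub>D\<^esub> differential D y)"
proof -
  note r0 = assms[unfolded is_dga_def]
  note r1 = r0[THEN conjunct2]
  note r2 = r1[THEN conjunct2]
  note r3 = r2[THEN conjunct2]
  note r4 = r3[THEN conjunct2]
  note r5 = r4[THEN conjunct2]
  note r6 = r5[THEN conjunct2]
  note r7 = r6[THEN conjunct2]
  note r8 = r7[THEN conjunct2]
  note r9 = r8[THEN conjunct2]
  note r10 = r9[THEN conjunct2]
  note r11 = r10[THEN conjunct2]
  note r12 = r11[THEN conjunct2]
  note r13 = r12[THEN conjunct2]
  note r14 = r13[THEN conjunct2]
  note r15 = r14[THEN conjunct2]
  note r16 = r15[THEN conjunct2]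
  show "ring D"
    by (rule r0[THEN conjunct1, rule_format])
  show "x \<in> carrier D \<Longrightarrow> c \<odot>\<^bsub>D\<^esub> x \<in> carrier D"
    by (rule r1[THEN conjunct1, rule_format])
  show "x \<in> carrier D \<Longrightarrow> (c + d) \<odot>\<^bsub>D\<^esub> x = (c \<odot>\<^bsub>D\<^esub> x) \<oplus>\<^bsub>D\<^esub> (d \<odot>\<^bsub>D\<^esub> x)"
    by (rule r2[THEN conjunct1, rule_format])
  show "x \<in> carrier D \<Longrightarrow> y \<in> carrier D \<Longrightarrow> c \<odot>\<^bsub>D\<^esub> (x \<oplus>\<^bsub>D\<^esub> y) = (c \<odot>\<^bsub>D\<^esub> x) \<oplus>\<^bsub>D\<^esub> (c \<odot>\<^bsub>D\<^esub> y)"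
    by (rule r3[THEN conjunct1, rule_format])
  show "x \<in> carrier D \<Longrightarrow> (c * d) \<odot>\<^bsub>D\<^esub> x = c \<odot>\<^bsub>D\<^esub> (d \<odot>\<^bsub>D\<^esub> x)"
    by (rule r4[THEN conjunct1, rule_format])
  show "x \<in> carrier D \<Longrightarrow> 1 \<odot>\<^bsub>D\<^esub> x = x"
    by (rule r5[THEN conjunct1, rule_format])
  show "x \<in> carrier D \<Longrightarrow> y \<in> carrier D \<Longrightarrow> (c \<odot>\<^bsub>D\<^esub> x) \<otimes>\<^bsub>D\<^esub> y = c \<odot>\<^bsub>D\<^esub> (x \<otimes>\<^bsub>D\<^esub> y)"
    using r6[THEN conjunct1, rule_format] by blast
  show "x \<in> carrier D \<Longrightarrow> y \<in> carrier D \<Longrightarrow> x \<otimes>\<^bsub>D\<^esub> (c \<odot>\<^bsub>D\<^esub> y) = c \<odot>\<^bsub>D\<^esub> (x \<otimes>\<^bsub>D\<^esub> y)"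
    using r6[THEN conjunct1, rule_format] by blast
  show "homog D n \<subseteq> carrier D"
    using r7[THEN conjunct1] by blast
  show "\<zero>\<^bsub>D\<^esub> \<in> homog D n"
    using r7[THEN conjunct1] by blast
  show "x \<in> homog D n \<Longrightarrow> y \<in> homog D n \<Longrightarrow> x \<oplus>\<^bsub>D\<^esub> y \<in> homog D n"
    using r7[THEN conjunct1, THEN spec, THEN conjunct2, THEN conjunct2, THEN conjunct1] by blast
  show "x \<in> homog D n \<Longrightarrow> c \<odot>\<^bsub>D\<^esub> x \<in> homog D n"
    using r7[THEN conjunct1, THEN spec, THEN conjunct2, THEN conjunct2, THEN conjunct2] by blast
  show "x \<in> carrier D \<Longrightarrow> \<exists>!h. (\<forall>n. h n \<in> homog D n) \<and> finite {n. h n \<noteq> \<zero>\<^bsub>D\<^esub>} \<and> 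
        x = finsum D h {n. h n \<noteq> \<zero>\<^bsub>D\<^esub>}"
    using r8[THEN conjunct1] by blast
  show "\<one>\<^bsub>D\<^esub> \<in> homog D 0"
    by (rule r9[THEN conjunct1, rule_format])
  show "x \<in> homog D m \<Longrightarrow> y \<in> homog D n \<Longrightarrow> x \<otimes>\<^bsub>D\<^esub> y \<in> homog D (m + n)"
    by (rule r10[THEN conjunct1, rule_format])
  show "x \<in> homog D m \<Longrightarrow> y \<in> homog D n \<Longrightarrow> x \<otimes>\<^bsub>D\<^esub> y = sgn_mul D (m * n) (y \<otimes>\<^bsub>D\<^esub> x)"
    by (rule r11[THEN conjunct1, rule_format])
  show "x \<in> carrier D \<Longrightarrow> y \<in> carrier D \<Longrightarrow> differential D (x \<oplus>\<^bsub>D\<^esub> y) = differential D x \<oplus>\<^bsub>D\<^esub> differential D y"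
    by (rule r12[THEN conjunct1, rule_format])
  show "x \<in> carrier D \<Longrightarrow> differential D (c \<odot>\<^bsub>D\<^esub> x) = c \<odot>\<^bsub>D\<^esub> differential D x"
    by (rule r13[THEN conjunct1, rule_format])
  show "x \<in> homog D n \<Longrightarrow> differential D x \<in> homog D (n + 1)"
    by (rule r14[THEN conjunct1, rule_format])
  show "x \<in> carrier D \<Longrightarrow> differential D (differential D x) = \<zero>\<^bsub>D\<^esub>"
    by (rule r15[THEN conjunct1, rule_format])
  show "x \<in> homog D m \<Longrightarrow> y \<in> carrier D \<Longrightarrow> differential D (x \<otimes>\<^bsub>D\<^esub> y) =
          (differential D x \<otimes>\<^bsub>D\<^esub> y) \<oplus>\<^bsub>D\<^esub> sgn_mul D m (x \<otimes>\<^bsub>D\<^esub> differential D y)"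
    by (rule r16[rule_format])
qed

text \<open>Projection to the component of degree \<open>n\<close>: the coordinates of the grading,
  read as a direct sum decomposition. They exist by \<open>hcomp_coords\<close>.\<close>

definition hcomp :: "('k, 'a, 'm) dga_scheme \<Rightarrow> int \<Rightarrow> 'a \<Rightarrow> 'a" where
  "hcomp D = (SOME \<kappa>. coords D D UNIV (homog D) (\<lambda>_ x. x) \<kappa>)"

text \<open>The grading involution, acting by \<open>(-1)^n\<close> in degree \<open>n\<close>. It
  makes Koszul signs available for inhomogeneous elements.\<close>

definition par :: "('k, 'a, 'm) dga_scheme \<Rightarrow> 'a \<Rightarrow> 'a" where
  "par D = (SOME H. add_map D D (carrier D) H \<and> (\<forall>n. \<forall>x\<in>homog D n. H x = sgn_mul D n x))"

text \<open>A graded subalgebra: closure under \<open>hcomp\<close> permits induction over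
  homogeneous elements inside \<open>S\<close>. Stability under the differential is the separate
  notion \<open>dclosed\<close>.\<close>

definition gsub :: "('k, 'a, 'm) dga_scheme \<Rightarrow> 'a set \<Rightarrow> bool" where
  "gsub D S \<longleftrightarrow> asub D S \<and> \<one>\<^bsub>D\<^esub> \<in> S \<and> (\<forall>x\<in>S. \<forall>y\<in>S. x \<otimes>\<^bsub>D\<^esub> y \<in> S) \<and> (\<forall>c. \<forall>x\<in>S. c \<odot>\<^bsub>D\<^esub> x \<in> S) \<and>
     (\<forall>n. \<forall>x\<in>S. hcomp D n x \<in> S)"

text \<open>A morphism of graded algebras defined on \<open>S\<close> alone. The differential is
  left to \<open>dmap\<close>, because a map is first extended over a new variable as an algebra map
  and only afterwards compared with the differentials.\<close>

definition shom :: "('k, 'a, 'm) dga_scheme \<Rightarrow> 'a set \<Rightarrow> ('k, 'b, 'n) dga_scheme \<Rightarrow> ('a \<Rightarrow> 'b) \<Rightarrow> bool" where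
  "shom A S B f \<longleftrightarrow> add_map A B S f \<and> f \<one>\<^bsub>A\<^esub> = \<one>\<^bsub>B\<^esub> \<and> (\<forall>x\<in>S. \<forall>y\<in>S. f (x \<otimes>\<^bsub>A\<^esub> y) = f x \<otimes>\<^bsub>B\<^esub> f y) \<and>
     (\<forall>c. \<forall>x\<in>S. f (c \<odot>\<^bsub>A\<^esub> x) = c \<odot>\<^bsub>B\<^esub> f x) \<and> (\<forall>n. \<forall>x\<in>S \<inter> homog A n. f x \<in> homog B n)"

definition dclosed :: "('k, 'a, 'm) dga_scheme \<Rightarrow> 'a set \<Rightarrow> bool" where
  "dclosed A S \<longleftrightarrow> (\<forall>x\<in>S. differential A x \<in> S)"

definition dmap :: "('k, 'a, 'm) dga_scheme \<Rightarrow> 'a set \<Rightarrow> ('k, 'b, 'n) dga_scheme \<Rightarrow> ('a \<Rightarrow> 'b) \<Rightarrow> bool" where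
  "dmap A S B f \<longleftrightarrow> (\<forall>x\<in>S. f (differential A x) = differential B (f x))"

locale dg_algebra =
  fixes D :: "('k::field_char_0, 'a, 'm) dga_scheme" (structure)
  assumes dga: "is_dga D"
begin

sublocale ring D
  by (rule is_dgaD(1)[OF dga])

abbreviation \<delta> where "\<delta> \<equiv> differential D"

lemmas smult_closed [simp, intro] = is_dgaD(2)[OF dga]
  and smult_l_distr = is_dgaD(3)[OF dga]
  and smult_r_distr = is_dgaD(4)[OF dga]
  and smult_assoc1 = is_dgaD(5)[OF dga]
  and smult_one [simp] = is_dgaD(6)[OF dga]
  and smult_mult_l = is_dgaD(7)[OF dga]
  and smult_mult_r = is_dgaD(8)[OF dga]
  and homog_subset = is_dgaD(9)[OF dga]
  and homog_zero [simp, intro] = is_dgaD(10)[OF dga]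
  and homog_add [intro] = is_dgaD(11)[OF dga]
  and homog_smult [intro] = is_dgaD(12)[OF dga]
  and homog_decomp = is_dgaD(13)[OF dga]
  and homog_one [simp, intro] = is_dgaD(14)[OF dga]
  and homog_mult [intro] = is_dgaD(15)[OF dga]
  and gcomm = is_dgaD(16)[OF dga]
  and d_add = is_dgaD(17)[OF dga]
  and d_smult = is_dgaD(18)[OF dga]
  and d_homog [intro] = is_dgaD(19)[OF dga]
  and d_d = is_dgaD(20)[OF dga]
  and leibniz = is_dgaD(21)[OF dga]

lemma homog_carrier [simp, intro]: "x \<in> homog D n \<Longrightarrow> x \<in> carrier D"
  using homog_subset by blast

lemma smult_0_left [simp]: "x \<in> carrier D \<Longrightarrow> 0 \<odot> x = \<zero>"
  using smult_l_distr[of x 0 0] by (simp add: add.l_cancel_one')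

lemma smult_0_right [simp]: "c \<odot> \<zero> = \<zero>"
  using smult_r_distr[of \<zero> \<zero> c] by (simp add: add.l_cancel_one')

lemma smult_m1: "x \<in> carrier D \<Longrightarrow> (-1) \<odot> x = \<ominus> x"
  using smult_l_distr[of x "-1" 1] by (simp add: minus_equality)

lemma smult_minus: "x \<in> carrier D \<Longrightarrow> c \<odot> (\<ominus> x) = \<ominus> (c \<odot> x)"
  using smult_assoc1[of x c "-1"] smult_assoc1[of x "-1" c] by (simp add: smult_m1)

lemma half_double: "x \<in> carrier D \<Longrightarrow> x \<oplus> x = \<zero> \<Longrightarrow> x = \<zero>"
  using smult_r_distr[of x x "1/2"] smult_l_distr[of x "1/2" "1/2"] by simp

lemma homog_minus [intro]: "x \<in> homog D n \<Longrightarrow> \<ominus> x \<in> homog D n"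
  using homog_smult[of x n "-1"] by (simp add: smult_m1)

lemma asub_homog: "asub D (homog D n)"
  by (auto simp: asub_def)

lemma sgn_mul_closed [simp, intro]: "x \<in> carrier D \<Longrightarrow> sgn_mul D n x \<in> carrier D"
  by (simp add: sgn_mul_def)

lemma sgn_mul_homog [intro]: "x \<in> homog D m \<Longrightarrow> sgn_mul D n x \<in> homog D m"
  by (auto simp: sgn_mul_def)

lemma sgn_mul_0 [simp]: "sgn_mul D n \<zero> = \<zero>"
  by (simp add: sgn_mul_def)

lemma sgn_mul_even: "even n \<Longrightarrow> sgn_mul D n x = x"
  by (simp add: sgn_mul_def)

lemma sgn_mul_odd: "odd n \<Longrightarrow> sgn_mul D n x = \<ominus> x"
  by (simp add: sgn_mul_def)

lemma sgn_mul_add: "x \<in> carrier D \<Longrightarrow> y \<in> carrier D \<Longrightarrow> sgn_mul D n (x \<oplus> y) = sgn_mul D n x \<oplus> sgn_mul D n y"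
  by (simp add: sgn_mul_def minus_add)

lemma sgn_mul_mult_l: "x \<in> carrier D \<Longrightarrow> y \<in> carrier D \<Longrightarrow> sgn_mul D n x \<otimes> y = sgn_mul D n (x \<otimes> y)"
  by (simp add: sgn_mul_def l_minus)

lemma sgn_mul_mult_r: "x \<in> carrier D \<Longrightarrow> y \<in> carrier D \<Longrightarrow> x \<otimes> sgn_mul D n y = sgn_mul D n (x \<otimes> y)"
  by (simp add: sgn_mul_def r_minus)

lemma sgn_mul_smult: "x \<in> carrier D \<Longrightarrow> c \<odot> sgn_mul D n x = sgn_mul D n (c \<odot> x)"
  by (simp add: sgn_mul_def smult_minus)

lemma sgn_mul_sgn_mul: "x \<in> carrier D \<Longrightarrow> sgn_mul D m (sgn_mul D n x) = sgn_mul D (m + n) x"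
  by (simp add: sgn_mul_def)

lemma homog_gen: "dgen UNIV (homog D) (\<lambda>_ x. x) = (\<Union>n. homog D n)"
  by (simp add: dgen_def)

lemma homog_asubs: "\<forall>i\<in>UNIV. asub D (homog D i) \<and> add_map D D (homog D i) (\<lambda>x. x)"
  using asub_homog by (auto simp: add_map_def)

lemma carrier_aspan: "aspan D (dgen UNIV (homog D) (\<lambda>_ x. x)) = carrier D"
proof
  show "aspan D (dgen UNIV (homog D) (\<lambda>_ x. x)) \<subseteq> carrier D"
    by (rule aspan_closed) (auto simp: homog_gen)
  show "carrier D \<subseteq> aspan D (dgen UNIV (homog D) (\<lambda>_ x. x))"
  proof
    fix x assume "x \<in> carrier D"
    then obtain h where h: "\<forall>n. h n \<in> homog D n" "x = finsum D h {n. h n \<noteq> \<zero>}"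
      using homog_decomp by blast
    show "x \<in> aspan D (dgen UNIV (homog D) (\<lambda>_ x. x))"
      unfolding h(2)
      by (rule asub_finsum[OF dgen_props(3)]) 
        (use h homog_asubs abelian_group_axioms in \<open>auto intro!: aspan_base simp: homog_gen\<close>)
  qed
qed

text \<open>A vanishing finite sum of homogeneous elements, extended by zero, and the zero family
  are two decompositions of zero. Uniqueness in \<open>homog_decomp\<close> identifies them, which
  is independence of the components.\<close>

lemma hcomp_coords: "coords D D UNIV (homog D) (\<lambda>_ x. x) (hcomp D)"
proof -
  have "dsum D D UNIV (homog D) (\<lambda>_ x. x)"
  proof (rule dsum_of_independent[OF abelian_group_axioms abelian_group_axioms homog_asubs])
    fix g J assume J: "finite J" "\<And>i::int. i \<in> UNIV \<Longrightarrow> g i \<in> homog D i" "finsum D g J = \<zero>"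
    let ?h = "\<lambda>n. if n \<in> J then g n else \<zero>"
    define P where "P h \<longleftrightarrow> (\<forall>n. h n \<in> homog D n) \<and> finite {n. h n \<noteq> \<zero>} \<and> \<zero> = finsum D h {n. h n \<noteq> \<zero>}" for h
    have g: "g i \<in> carrier D" for i using J(2)[of i] by simp
    have "finsum D ?h {n. ?h n \<noteq> \<zero>} = finsum D ?h J"
      using J g by (intro finsum_enlarge) auto
    also have "\<dots> = finsum D g J" using g by (intro finsum_cong') auto
    finally have 1: "finsum D ?h {n. ?h n \<noteq> \<zero>} = \<zero>" using J by simp
    have "{n. ?h n \<noteq> \<zero>} \<subseteq> J" by auto
    then have 2: "finite {n. ?h n \<noteq> \<zero>}" using J(1) finite_subset by blast
    have 3: "\<forall>n. ?h n \<in> homog D n" using J(2) by simp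
    have Ph: "P ?h" unfolding P_def using 1 2 3 by (intro conjI) (assumption | rule sym)+
    have P0: "P (\<lambda>_. \<zero>)" by (simp add: P_def)
    have "\<exists>!h. P h" unfolding P_def by (rule homog_decomp) simp
    then obtain k where "\<forall>h. P h \<longrightarrow> h = k" unfolding Ex1_def by blast
    then have "?h = k" "(\<lambda>_. \<zero>) = k" using Ph P0 by blast+
    then have "?h = (\<lambda>_. \<zero>)" by simp
    then show "\<forall>i\<in>J. g i = \<zero>" by metis
  qed
  then have "\<exists>\<kappa>. coords D D UNIV (homog D) (\<lambda>_ x. x) \<kappa>" by (simp add: dsum_def)
  then show ?thesis unfolding hcomp_def by (rule someI_ex)
qed

lemma hcomp_add_map: "add_map D D (carrier D) (hcomp D n)"
  using hcomp_coords carrier_aspan by (simp add: coords_def)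

lemma hcomp_add: "x \<in> carrier D \<Longrightarrow> y \<in> carrier D \<Longrightarrow> hcomp D n (x \<oplus> y) = hcomp D n x \<oplus> hcomp D n y"
  using add_mapD(2)[OF hcomp_add_map] .

lemma hcomp_homog: "x \<in> homog D m \<Longrightarrow> hcomp D n x = (if n = m then x else \<zero>)"
  using hcomp_coords by (simp add: coords_def)

lemma hcomp_in: "x \<in> carrier D \<Longrightarrow> hcomp D n x \<in> homog D n"
  using coords_props(1)[OF abelian_group_axioms abelian_group_axioms homog_asubs hcomp_coords]
    carrier_aspan by simp

lemma hcomp_closed [simp]: "x \<in> carrier D \<Longrightarrow> hcomp D n x \<in> carrier D"
  using hcomp_in homog_carrier by blast

lemma hcomp_finite: "x \<in> carrier D \<Longrightarrow> finite {n. hcomp D n x \<noteq> \<zero>}"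
  using coords_props(2)[OF abelian_group_axioms abelian_group_axioms homog_asubs hcomp_coords]
    carrier_aspan by simp

lemma hcomp_finsum: "x \<in> carrier D \<Longrightarrow> x = finsum D (\<lambda>n. hcomp D n x) {n. hcomp D n x \<noteq> \<zero>}"
  using coords_finsum[OF abelian_group_axioms abelian_group_axioms homog_asubs hcomp_coords]
    carrier_aspan by simp

lemma gsub_carrier: "gsub D (carrier D)"
  by (auto simp: gsub_def asub_carrier)

text \<open>An element of \<open>S\<close> is the finite sum of its homogeneous components, and
  these stay in \<open>S\<close>.\<close>

lemma gsub_induct [consumes 2, case_names homog add]:
  assumes "gsub D S" "x \<in> S" "\<And>n y. y \<in> S \<Longrightarrow> y \<in> homog D n \<Longrightarrow> P y"
    "\<And>y z. y \<in> S \<Longrightarrow> z \<in> S \<Longrightarrow> P y \<Longrightarrow> P z \<Longrightarrow> P (y \<oplus> z)"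
  shows "P x"
proof -
  have S: "S \<subseteq> carrier D" "asub D S" "\<And>n x. x \<in> S \<Longrightarrow> hcomp D n x \<in> S" "\<zero> \<in> S"
    using assms(1) by (auto simp: gsub_def asub_def)
  have x: "x \<in> carrier D" using S assms by auto
  have "finsum D (\<lambda>n. hcomp D n x) J \<in> S \<and> P (finsum D (\<lambda>n. hcomp D n x) J)" if "finite J" for J
    using that
  proof induction
    case empty
    then show ?case using assms(3)[OF S(4) homog_zero] S(4) by simp
  next
    case (insert n J)
    have 1: "hcomp D n x \<in> S" using S(3) assms(2) by simp
    moreover have "P (hcomp D n x)" using assms(3)[OF 1 hcomp_in[OF x]] .
    moreover have "finsum D (\<lambda>n. hcomp D n x) (insert n J) = hcomp D n x \<oplus> finsum D (\<lambda>n. hcomp D n x) J"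
      using insert x by (subst finsum_insert) auto
    ultimately show ?case using insert asubD(3)[OF S(2)] assms(4) by simp
  qed
  from this[OF hcomp_finite[OF x]] show ?thesis using hcomp_finsum[OF x] by simp
qed

lemmas homog_induct [consumes 1, case_names homog add] = gsub_induct[OF gsub_carrier]

lemma par_exists: "\<exists>H. add_map D D (carrier D) H \<and> (\<forall>n. \<forall>x\<in>homog D n. H x = sgn_mul D n x)"
proof -
  have "dsum D D UNIV (homog D) (\<lambda>_ x. x)"
    using hcomp_coords homog_asubs by (auto simp: dsum_def)
  from dsum_ext[OF abelian_group_axioms abelian_group_axioms abelian_group_axioms this, of "sgn_mul D"]
  show ?thesis
    by (metis UNIV_I add_mapI carrier_aspan homog_carrier sgn_mul_add sgn_mul_closed)
qed

lemma par_add_map: "add_map D D (carrier D) (par D)"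
  and par_homog: "x \<in> homog D n \<Longrightarrow> par D x = sgn_mul D n x"
  using someI_ex[OF par_exists] unfolding par_def[symmetric] by auto

lemma par_add: "x \<in> carrier D \<Longrightarrow> y \<in> carrier D \<Longrightarrow> par D (x \<oplus> y) = par D x \<oplus> par D y"
  using add_mapD(2)[OF par_add_map] .

lemma par_closed [simp]: "x \<in> carrier D \<Longrightarrow> par D x \<in> carrier D"
  using add_mapD(1)[OF par_add_map] .

lemma par_zero [simp]: "par D \<zero> = \<zero>"
  using par_homog[OF homog_zero, of 0] by simp

lemma par_in_homog [intro]: "x \<in> homog D n \<Longrightarrow> par D x \<in> homog D n"
  by (auto simp: par_homog)

lemma par_smult: "x \<in> carrier D \<Longrightarrow> par D (c \<odot> x) = c \<odot> par D x"
proof (induction rule: homog_induct)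
  case (homog n y)
  then show ?case using par_homog[OF homog_smult[OF homog(2)]] by (simp add: par_homog sgn_mul_smult)
qed (simp add: smult_r_distr par_add)

text \<open>The axioms locate the differential of homogeneous elements only; decomposition and
  additivity give the rest.\<close>

lemma d_closed [simp, intro]: "x \<in> carrier D \<Longrightarrow> \<delta> x \<in> carrier D"
proof (induction rule: homog_induct)
  case (homog n y)
  then show ?case using d_homog by blast
qed (simp add: d_add)

lemma d_add_map: "add_map D D (carrier D) \<delta>"
  by (auto simp: add_map_def d_add)

lemma d_minus: "x \<in> carrier D \<Longrightarrow> \<delta> (\<ominus> x) = \<ominus> \<delta> x"
  using add_map_minus[OF abelian_group_axioms abelian_group_axioms asub_carrier d_add_map] .

lemma d_zero [simp]: "\<delta> \<zero> = \<zero>"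
  using add_map_zero[OF abelian_group_axioms abelian_group_axioms asub_carrier d_add_map] .

lemma d_sgn_mul: "x \<in> carrier D \<Longrightarrow> \<delta> (sgn_mul D n x) = sgn_mul D n (\<delta> x)"
  by (simp add: sgn_mul_def d_minus)

lemma d_one [simp]: "\<delta> \<one> = \<zero>"
proof -
  have "\<delta> \<one> = \<delta> \<one> \<oplus> \<delta> \<one>"
    using leibniz[OF homog_one, of \<one>] by (simp add: sgn_mul_even)
  then show ?thesis by (metis add.l_cancel_one d_closed one_closed)
qed

lemma homog_pow: "x \<in> homog D d \<Longrightarrow> x [^] (i::nat) \<in> homog D (int i * d)"
proof (induction i)
  case (Suc i)
  then show ?case using homog_mult[of "x [^] i" "int i * d" x d] by (simp add: algebra_simps)
qed simp

text \<open>Graded commutativity yields only that the square equals its negative;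
  \<open>half_double\<close> then divides by 2.\<close>

lemma odd_square_zero: "x \<in> homog D d \<Longrightarrow> odd d \<Longrightarrow> x \<otimes> x = \<zero>"
proof -
  assume x: "x \<in> homog D d" "odd d"
  have "x \<otimes> x = \<ominus> (x \<otimes> x)" using gcomm[OF x(1) x(1)] x(2) by (simp add: sgn_mul_odd)
  then have "x \<otimes> x \<oplus> x \<otimes> x = \<zero>" using x(1) by (metis homog_carrier m_closed r_neg)
  then show ?thesis using x(1) half_double[of "x \<otimes> x"] by simp
qed

lemma gsubD:
  assumes "gsub D S"
  shows "asub D S" "\<one> \<in> S" "x \<in> S \<Longrightarrow> y \<in> S \<Longrightarrow> x \<otimes> y \<in> S" "x \<in> S \<Longrightarrow> c \<odot> x \<in> S"
    "x \<in> S \<Longrightarrow> hcomp D n x \<in> S" "x \<in> S \<Longrightarrow> x \<in> carrier D" "x \<in> S \<Longrightarrow> y \<in> S \<Longrightarrow> x \<oplus> y \<in> S"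
    "x \<in> S \<Longrightarrow> \<ominus> x \<in> S" "\<zero> \<in> S"
  using assms by (auto simp: gsub_def asub_def)

lemma gsub_sgn_mul: "gsub D S \<Longrightarrow> x \<in> S \<Longrightarrow> sgn_mul D n x \<in> S"
  by (simp add: sgn_mul_def gsubD(8))

lemma gsub_pow: "gsub D S \<Longrightarrow> x \<in> S \<Longrightarrow> x [^] (i::nat) \<in> S"
  by (induction i) (auto simp: gsubD)

end

text \<open>Converse to \<open>hcomp_coords\<close>: additive projections give existence of the
  decomposition by \<open>coords_finsum\<close> and uniqueness by \<open>coords_unique\<close>. The
  grading axiom of every constructed algebra is checked in this way.\<close>

lemma dga_gradingI:
  assumes "abelian_group E" "coords E E UNIV (homog E) (\<lambda>_ x. x) \<kappa>" "\<And>n. asub E (homog E n)"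
    "x \<in> aspan E (\<Union>n. homog E n)"
  shows "\<exists>!h. (\<forall>n. h n \<in> homog E n) \<and> finite {n. h n \<noteq> \<zero>\<^bsub>E\<^esub>} \<and> x = finsum E h {n::int. h n \<noteq> \<zero>\<^bsub>E\<^esub>}"
proof -
  have S: "\<forall>i\<in>UNIV. asub E (homog E i) \<and> add_map E E (homog E i) (\<lambda>x. x)"
    using assms(3) asubD(5)[OF assms(3)] by (auto simp: add_map_def)
  have x: "x \<in> aspan E (dgen UNIV (homog E) (\<lambda>_ x. x))" using assms(4) by (simp add: dgen_def)
  note 1 = coords_props[OF assms(1,1) S assms(2) x] coords_finsum[OF assms(1,1) S assms(2) x]
  show ?thesis
  proof (rule ex1I[of _ "\<lambda>n. \<kappa> n x"])
    show "(\<forall>n. \<kappa> n x \<in> homog E n) \<and> finite {n. \<kappa> n x \<noteq> \<zero>\<^bsub>E\<^esub>} \<and>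
        x = finsum E (\<lambda>n. \<kappa> n x) {n. \<kappa> n x \<noteq> \<zero>\<^bsub>E\<^esub>}" using 1 by simp
    fix h assume h: "(\<forall>n. h n \<in> homog E n) \<and> finite {n. h n \<noteq> \<zero>\<^bsub>E\<^esub>} \<and> x = finsum E h {n. h n \<noteq> \<zero>\<^bsub>E\<^esub>}"
    show "h = (\<lambda>n. \<kappa> n x)"
    proof
      fix n
      have "\<kappa> n (finsum E h {n. h n \<noteq> \<zero>\<^bsub>E\<^esub>}) = (if n \<in> {n. h n \<noteq> \<zero>\<^bsub>E\<^esub>} then h n else \<zero>\<^bsub>E\<^esub>)"
        by (rule coords_unique[OF assms(1,1) S assms(2)]) (use h in auto)
      then show "h n = \<kappa> n x" using h by auto
    qed
  qed
qed

lemma shomD: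
  assumes "shom A S B f"
  shows "add_map A B S f" "f \<one>\<^bsub>A\<^esub> = \<one>\<^bsub>B\<^esub>" "x \<in> S \<Longrightarrow> y \<in> S \<Longrightarrow> f (x \<otimes>\<^bsub>A\<^esub> y) = f x \<otimes>\<^bsub>B\<^esub> f y"
    "x \<in> S \<Longrightarrow> f (c \<odot>\<^bsub>A\<^esub> x) = c \<odot>\<^bsub>B\<^esub> f x" "x \<in> S \<Longrightarrow> x \<in> homog A n \<Longrightarrow> f x \<in> homog B n"
    "x \<in> S \<Longrightarrow> f x \<in> carrier B" "x \<in> S \<Longrightarrow> y \<in> S \<Longrightarrow> f (x \<oplus>\<^bsub>A\<^esub> y) = f x \<oplus>\<^bsub>B\<^esub> f y"
  using assms by (auto simp: shom_def add_map_def)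

lemma shom_zero:
  assumes "is_dga A" "is_dga B" "gsub A S" "shom A S B f"
  shows "f \<zero>\<^bsub>A\<^esub> = \<zero>\<^bsub>B\<^esub>" "x \<in> S \<Longrightarrow> f (\<ominus>\<^bsub>A\<^esub> x) = \<ominus>\<^bsub>B\<^esub> f x"
    "x \<in> S \<Longrightarrow> f (sgn_mul A n x) = sgn_mul B n (f x)"
    "x \<in> S \<Longrightarrow> f (hcomp A n x) = hcomp B n (f x)"
    "x \<in> S \<Longrightarrow> f (x [^]\<^bsub>A\<^esub> (i::nat)) = f x [^]\<^bsub>B\<^esub> i"
proof -
  interpret A: dg_algebra A by unfold_locales fact
  interpret B: dg_algebra B by unfold_locales fact
  note S = A.gsubD[OF assms(3)] and f = shomD[OF assms(4)]
  show z: "f \<zero>\<^bsub>A\<^esub> = \<zero>\<^bsub>B\<^esub>"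
    by (rule add_map_zero[OF A.abelian_group_axioms B.abelian_group_axioms S(1) f(1)])
  show m: "x \<in> S \<Longrightarrow> f (\<ominus>\<^bsub>A\<^esub> x) = \<ominus>\<^bsub>B\<^esub> f x" for x
    by (rule add_map_minus[OF A.abelian_group_axioms B.abelian_group_axioms S(1) f(1)])
  then show "x \<in> S \<Longrightarrow> f (sgn_mul A n x) = sgn_mul B n (f x)"
    by (simp add: sgn_mul_def)
  show "x \<in> S \<Longrightarrow> f (x [^]\<^bsub>A\<^esub> (i::nat)) = f x [^]\<^bsub>B\<^esub> i"
    by (induction i) (auto simp: f A.gsub_pow[OF assms(3)])
  assume "x \<in> S"
  with assms(3) show "f (hcomp A n x) = hcomp B n (f x)"
  proof (induction rule: A.gsub_induct)
    case (homog m y)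
    then show ?case using z f(5)[OF homog] by (simp add: A.hcomp_homog B.hcomp_homog)
  next
    case (add y z)
    then show ?case using S f by (simp add: A.hcomp_add B.hcomp_add)
  qed
qed

lemma dga_hom_iff_shom:
  assumes "is_dga A" "is_dga B"
  shows "dga_hom A B f \<longleftrightarrow> shom A (carrier A) B f \<and> dmap A (carrier A) B f"
proof -
  interpret A: dg_algebra A by unfold_locales fact
  show ?thesis unfolding dga_hom_def shom_def dmap_def add_map_def by auto
qed

lemma shom_comp:
  assumes "shom A S B f" "shom B S' C g" "\<And>x. x \<in> S \<Longrightarrow> f x \<in> S'" "\<one>\<^bsub>A\<^esub> \<in> S"
  shows "shom A S C (\<lambda>x. g (f x))"
  using assms unfolding shom_def add_map_def by auto

lemma dga_hom_comp: "dga_hom A B f \<Longrightarrow> dga_hom B C g \<Longrightarrow> dga_hom A C (\<lambda>x. g (f x))"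
  by (auto simp: dga_hom_def Pi_iff)

section \<open>Bases over subrings\<close>

text \<open>Left freeness of the \<open>v i\<close> over the image of \<open>S\<close> under
  \<open>g\<close>; that they generate is a separate equation for \<open>fspan\<close>. Coefficients
  come from an additive subgroup, so that one notion covers scalars from the ground field, from a
  subalgebra and from a whole algebra.\<close>

definition fbasis :: "('s, 'n) ring_scheme \<Rightarrow> 's set \<Rightarrow> ('a, 'm) ring_scheme \<Rightarrow> ('s \<Rightarrow> 'a) \<Rightarrow> 'i set \<Rightarrow> ('i \<Rightarrow> 'a) \<Rightarrow> bool" where
  "fbasis N S D g I v \<longleftrightarrow> (\<forall>i\<in>I. v i \<in> carrier D) \<and> asub N S \<and> add_map N D S g \<and>
     (\<exists>\<kappa>. coords N D I (\<lambda>_. S) (\<lambda>i s. g s \<otimes>\<^bsub>D\<^esub> v i) \<kappa>)"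

definition fspan :: "'s set \<Rightarrow> ('a, 'm) ring_scheme \<Rightarrow> ('s \<Rightarrow> 'a) \<Rightarrow> 'i set \<Rightarrow> ('i \<Rightarrow> 'a) \<Rightarrow> 'a set" where
  "fspan S D g I v = aspan D (dgen I (\<lambda>_. S) (\<lambda>i s. g s \<otimes>\<^bsub>D\<^esub> v i))"

lemma fbasis_asubs:
  assumes "ring D" "asub N S" "add_map N D S g" "v \<in> I \<rightarrow> carrier D"
  shows "\<forall>i\<in>I. asub N S \<and> add_map N D S (\<lambda>s. g s \<otimes>\<^bsub>D\<^esub> v i)"
proof -
  interpret D: ring D by fact
  show ?thesis using assms(2-4) by (auto simp: add_map_def D.l_distr Pi_iff)
qed

lemma fspan_props:
  assumes "abelian_group N" "ring D" "asub N S" "add_map N D S g" "v \<in> I \<rightarrow> carrier D"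
  shows "asub D (fspan S D g I v)" "i \<in> I \<Longrightarrow> s \<in> S \<Longrightarrow> g s \<otimes>\<^bsub>D\<^esub> v i \<in> fspan S D g I v"
    "fspan S D g I v \<subseteq> carrier D"
    "dgen I (\<lambda>_. S) (\<lambda>i s. g s \<otimes>\<^bsub>D\<^esub> v i) \<subseteq> carrier D"
    "x \<in> dgen I (\<lambda>_. S) (\<lambda>i s. g s \<otimes>\<^bsub>D\<^esub> v i) \<Longrightarrow> \<ominus>\<^bsub>D\<^esub> x \<in> dgen I (\<lambda>_. S) (\<lambda>i s. g s \<otimes>\<^bsub>D\<^esub> v i)"
proof -
  interpret D: ring D by fact
  note P = dgen_props[OF assms(1) D.abelian_group_axioms fbasis_asubs[OF assms(2-5)]]
  show "asub D (fspan S D g I v)" "i \<in> I \<Longrightarrow> s \<in> S \<Longrightarrow> g s \<otimes>\<^bsub>D\<^esub> v i \<in> fspan S D g I v"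
    "fspan S D g I v \<subseteq> carrier D"
    "dgen I (\<lambda>_. S) (\<lambda>i s. g s \<otimes>\<^bsub>D\<^esub> v i) \<subseteq> carrier D"
    "x \<in> dgen I (\<lambda>_. S) (\<lambda>i s. g s \<otimes>\<^bsub>D\<^esub> v i) \<Longrightarrow> \<ominus>\<^bsub>D\<^esub> x \<in> dgen I (\<lambda>_. S) (\<lambda>i s. g s \<otimes>\<^bsub>D\<^esub> v i)"
    using P unfolding fspan_def by blast+
qed

lemma fspan_least:
  assumes "asub D T" "\<And>i s. i \<in> I \<Longrightarrow> s \<in> S \<Longrightarrow> g s \<otimes>\<^bsub>D\<^esub> v i \<in> T"
  shows "fspan S D g I v \<subseteq> T"
  unfolding fspan_def by (rule aspan_least[OF assms(1)]) (use assms(2) in \<open>auto simp: dgen_def\<close>)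

lemma fbasis_ext:
  assumes "abelian_group N" "ring D" "abelian_group L" "fbasis N S D g I v"
    "\<And>i. i \<in> I \<Longrightarrow> add_map N L S (F i)"
  obtains H where "add_map D L (fspan S D g I v) H" "\<And>i s. i \<in> I \<Longrightarrow> s \<in> S \<Longrightarrow> H (g s \<otimes>\<^bsub>D\<^esub> v i) = F i s"
proof -
  interpret D: ring D by fact
  have a: "v \<in> I \<rightarrow> carrier D" "asub N S" "add_map N D S g"
    using assms(4) unfolding fbasis_def by auto
  obtain \<kappa> where "coords N D I (\<lambda>_. S) (\<lambda>i s. g s \<otimes>\<^bsub>D\<^esub> v i) \<kappa>" using assms(4) unfolding fbasis_def by blast
  then have "dsum N D I (\<lambda>_. S) (\<lambda>i s. g s \<otimes>\<^bsub>D\<^esub> v i)"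
    unfolding dsum_def using fbasis_asubs[OF assms(2) a(2,3) a(1)] by blast
  then show thesis
  proof (rule dsum_ext[OF assms(1) D.abelian_group_axioms assms(3)])
    show "\<And>i. i \<in> I \<Longrightarrow> add_map N L S (F i)" by (rule assms(5))
    fix H assume "add_map D L (aspan D (dgen I (\<lambda>_. S) (\<lambda>i s. g s \<otimes>\<^bsub>D\<^esub> v i))) H"
      "\<And>i s. i \<in> I \<Longrightarrow> s \<in> S \<Longrightarrow> H (g s \<otimes>\<^bsub>D\<^esub> v i) = F i s"
    then show thesis by (intro that) (simp_all add: fspan_def)
  qed
qed

lemma fbasisE:
  assumes "fbasis N S D g I v"
  obtains \<kappa> where "\<And>i. i \<in> I \<Longrightarrow> add_map D N (fspan S D g I v) (\<kappa> i)"
    "\<And>i l s. i \<in> I \<Longrightarrow> l \<in> I \<Longrightarrow> s \<in> S \<Longrightarrow> \<kappa> i (g s \<otimes>\<^bsub>D\<^esub> v l) = (if i = l then s else \<zero>\<^bsub>N\<^esub>)"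
proof -
  obtain \<kappa> where "coords N D I (\<lambda>_. S) (\<lambda>i s. g s \<otimes>\<^bsub>D\<^esub> v i) \<kappa>" using assms unfolding fbasis_def by blast
  then show thesis by (intro that[of \<kappa>]) (auto simp: coords_def fspan_def)
qed

lemma fbasisI:
  assumes "asub N S" "add_map N D S g" "\<And>i. i \<in> I \<Longrightarrow> v i \<in> carrier D"
    "\<And>i. i \<in> I \<Longrightarrow> add_map D N (fspan S D g I v) (\<kappa> i)"
    "\<And>i l s. i \<in> I \<Longrightarrow> l \<in> I \<Longrightarrow> s \<in> S \<Longrightarrow> \<kappa> i (g s \<otimes>\<^bsub>D\<^esub> v l) = (if i = l then s else \<zero>\<^bsub>N\<^esub>)"
  shows "fbasis N S D g I v"
proof -
  have "coords N D I (\<lambda>_. S) (\<lambda>i s. g s \<otimes>\<^bsub>D\<^esub> v i) \<kappa>"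
    using assms(4,5) by (simp add: coords_def fspan_def)
  then show ?thesis using assms(1-3) unfolding fbasis_def by blast
qed

lemma fbasis_basic:
  assumes "fbasis N S D g I v"
  shows "asub N S" "add_map N D S g" "v \<in> I \<rightarrow> carrier D" "i \<in> I \<Longrightarrow> v i \<in> carrier D"
  using assms unfolding fbasis_def by blast+

text \<open>The map \<open>t \<mapsto> \<psi> t \<otimes> w\<close> is additive, so membership in a
  subgroup need only be checked on generators of the coefficients. This compares spans over
  different coefficient sets.\<close>

lemma fspan_absorb:
  assumes "ring D" "asub A S'" "S' = aspan A G" "add_map A D S' \<psi>" "w \<in> carrier D" "asub D T" "ring A" "G \<subseteq> carrier A"
    "\<And>x. x \<in> G \<Longrightarrow> \<ominus>\<^bsub>A\<^esub> x \<in> G" "\<And>x. x \<in> G \<Longrightarrow> \<psi> x \<otimes>\<^bsub>D\<^esub> w \<in> T" "t \<in> S'"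
  shows "\<psi> t \<otimes>\<^bsub>D\<^esub> w \<in> T"
proof -
  interpret D: ring D by fact
  interpret A: ring A by fact
  have "t \<in> aspan A G" using assms by simp
  then show ?thesis
  proof induction
    case aspan_zero
    have "\<psi> \<zero>\<^bsub>A\<^esub> = \<zero>\<^bsub>D\<^esub>"
      by (rule add_map_zero[OF A.abelian_group_axioms D.abelian_group_axioms assms(2,4)])
    then show ?case using asubD(2)[OF assms(6)] assms(5) by simp
  next
    case (aspan_step g x)
    have m: "g \<in> S'" "x \<in> S'" using aspan_step A.aspan_base assms(3,8) by auto
    have "\<psi> (g \<oplus>\<^bsub>A\<^esub> x) \<otimes>\<^bsub>D\<^esub> w = \<psi> g \<otimes>\<^bsub>D\<^esub> w \<oplus>\<^bsub>D\<^esub> \<psi> x \<otimes>\<^bsub>D\<^esub> w"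
      using add_mapD[OF assms(4)] m assms(5) by (simp add: D.l_distr)
    then show ?case using asubD(3)[OF assms(6)] assms(10) aspan_step by simp
  qed
qed

text \<open>Enlarges the coefficients: part of a basis over \<open>S\<close> is absorbed into
  \<open>S'\<close>. The pieces \<open>e i s\<close> of \<open>S'\<close> go to the multiples of
  \<open>W i\<close>, so grouping the products \<open>W i v k\<close> by \<open>k\<close> leaves the
  \<open>v k\<close> as a basis over \<open>S'\<close>.\<close>

lemma fbasis_factor:
  assumes "abelian_group N" "ring A" "ring D"
    and B: "fbasis N S D g (I \<times> K) (\<lambda>(i, k). W i \<otimes>\<^bsub>D\<^esub> v k)"
    and S': "S' = aspan A (dgen I (\<lambda>_. S) e)" and e: "\<And>i. i \<in> I \<Longrightarrow> add_map N A S (e i)"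
    and \<psi>: "add_map A D S' \<psi>" "\<And>i s. i \<in> I \<Longrightarrow> s \<in> S \<Longrightarrow> \<psi> (e i s) = g s \<otimes>\<^bsub>D\<^esub> W i"
    and c: "\<And>i. i \<in> I \<Longrightarrow> W i \<in> carrier D" "\<And>k. k \<in> K \<Longrightarrow> v k \<in> carrier D"
  shows "fbasis A S' D \<psi> K v" "fspan S' D \<psi> K v = fspan S D g (I \<times> K) (\<lambda>(i, k). W i \<otimes>\<^bsub>D\<^esub> v k)"
proof -
  interpret N: abelian_group N by fact
  interpret A: ring A by fact
  interpret D: ring D by fact
  note b = fbasis_basic[OF B]
  have es: "\<forall>i\<in>I. asub N S \<and> add_map N A S (e i)" using b(1) e by blast
  note P = dgen_props[OF assms(1) A.abelian_group_axioms es, folded S']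
  have gc: "g s \<in> carrier D" if "s \<in> S" for s using add_mapD(1)[OF b(2) that] .
  let ?X = "fspan S D g (I \<times> K) (\<lambda>(i, k). W i \<otimes>\<^bsub>D\<^esub> v k)"
  have vc: "v \<in> K \<rightarrow> carrier D" using c by simp
  note Q = fspan_props[OF assms(1,3) b(1-3)]
  note R = fspan_props[OF A.abelian_group_axioms assms(3) P(3) \<psi>(1) vc]
  have gen: "\<psi> (e i s) \<otimes>\<^bsub>D\<^esub> v k = g s \<otimes>\<^bsub>D\<^esub> (W i \<otimes>\<^bsub>D\<^esub> v k)" if "i \<in> I" "s \<in> S" "k \<in> K" for i s k
    using that c gc by (simp add: \<psi>(2) D.m_assoc)
  show X: "fspan S' D \<psi> K v = ?X"
  proof
    show "fspan S' D \<psi> K v \<subseteq> ?X"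
    proof (rule fspan_least[OF Q(1)])
      fix k t assume k: "k \<in> K" and t: "t \<in> S'"
      show "\<psi> t \<otimes>\<^bsub>D\<^esub> v k \<in> ?X"
      proof (rule fspan_absorb[OF assms(3) P(3) S' \<psi>(1) c(2)[OF k] Q(1) assms(2) P(1) P(2) _ t])
        fix x assume "x \<in> dgen I (\<lambda>_. S) e"
        then obtain i s where "i \<in> I" "s \<in> S" "x = e i s" by (auto simp: dgen_def)
        then show "\<psi> x \<otimes>\<^bsub>D\<^esub> v k \<in> ?X" using gen k Q(2)[of "(i, k)" s] by simp
      qed
    qed
    show "?X \<subseteq> fspan S' D \<psi> K v"
    proof (rule fspan_least[OF R(1)], clarify)
      fix i k s assume "i \<in> I" "k \<in> K" "s \<in> S"
      then show "g s \<otimes>\<^bsub>D\<^esub> (W i \<otimes>\<^bsub>D\<^esub> v k) \<in> fspan S' D \<psi> K v"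
        using R(2)[of k "e i s"] P(4)[of i s] gen by simp
    qed
  qed
  have "\<exists>\<kappa>. add_map D A ?X \<kappa> \<and> (\<forall>l\<in>K. \<forall>t\<in>S'. \<kappa> (\<psi> t \<otimes>\<^bsub>D\<^esub> v l) = (if k = l then t else \<zero>\<^bsub>A\<^esub>))" if "k \<in> K" for k
  proof -
    \<comment> \<open>The new coordinate \<open>k\<close> gathers the coefficients of all products
      with second index \<open>k\<close> and reassembles them in \<open>A\<close> through the maps
      \<open>e i\<close>.\<close>
    let ?F = "\<lambda>(i, l) s. if l = k then e i s else \<zero>\<^bsub>A\<^esub>"
    have "add_map N A S (?F p)" if "p \<in> I \<times> K" for p
      using that e by (auto simp: add_map_def Pi_iff)
    then show ?thesis
    proof (rule fbasis_ext[OF assms(1,3) A.abelian_group_axioms B])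
    fix H assume H: "add_map D A ?X H"
      "\<And>p s. p \<in> I \<times> K \<Longrightarrow> s \<in> S \<Longrightarrow> H (g s \<otimes>\<^bsub>D\<^esub> (\<lambda>(i, k). W i \<otimes>\<^bsub>D\<^esub> v k) p) = ?F p s"
    have "H (\<psi> t \<otimes>\<^bsub>D\<^esub> v l) = (if k = l then t else \<zero>\<^bsub>A\<^esub>)" if l: "l \<in> K" and t: "t \<in> S'" for l t
    proof (rule add_map_eq_aspan[OF A.abelian_group_axioms A.abelian_group_axioms P(1,2), folded S', OF _ _ _ _ t])
      have m: "\<psi> t \<otimes>\<^bsub>D\<^esub> v l \<in> ?X" if "t \<in> S'" for t using R(2)[OF l that] X by simp
      have "add_map A D S' (\<lambda>t. \<psi> t \<otimes>\<^bsub>D\<^esub> v l)"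
        using add_mapD[OF \<psi>(1)] c l by (intro add_mapI) (auto simp: D.l_distr)
      from add_map_comp[OF this H(1) m] show "add_map A A S' (\<lambda>t. H (\<psi> t \<otimes>\<^bsub>D\<^esub> v l))" .
      show "add_map A A S' (\<lambda>t. if k = l then t else \<zero>\<^bsub>A\<^esub>)"
        using P(5) by (intro add_mapI) auto
      fix x assume "x \<in> dgen I (\<lambda>_. S) e"
      then obtain i s where x: "i \<in> I" "s \<in> S" "x = e i s" by (auto simp: dgen_def)
      then show "H (\<psi> x \<otimes>\<^bsub>D\<^esub> v l) = (if k = l then x else \<zero>\<^bsub>A\<^esub>)"
        using gen[OF x(1,2) l] H(2)[of "(i, l)" s] l by auto
    qed
    then show ?thesis using H(1) by blast
    qed
  qed
  then obtain \<kappa> where \<kappa>: "\<And>k. k \<in> K \<Longrightarrow> add_map D A ?X (\<kappa> k) \<and>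
      (\<forall>l\<in>K. \<forall>t\<in>S'. \<kappa> k (\<psi> t \<otimes>\<^bsub>D\<^esub> v l) = (if k = l then t else \<zero>\<^bsub>A\<^esub>))" by metis
  show "fbasis A S' D \<psi> K v"
    by (rule fbasisI[OF P(3) \<psi>(1), where \<kappa> = \<kappa>]) (use c(2) \<kappa> X in auto)
qed

text \<open>Towers of free extensions: the coordinate at \<open>(i, k)\<close> is the coordinate
  \<open>i\<close> of the coordinate \<open>k\<close>. The \<open>v i\<close> must span
  \<open>D\<close>, since the coefficients of the \<open>w k\<close> range over all of
  \<open>D\<close>.\<close>

lemma fbasis_trans:
  assumes "abelian_group N" "ring D" "ring D'"
    and B: "fbasis N S D g I v" "fspan S D g I v = carrier D"
    and B': "fbasis D (carrier D) D' \<iota> K w"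
    and \<iota>: "\<And>x y. x \<in> carrier D \<Longrightarrow> y \<in> carrier D \<Longrightarrow> \<iota> (x \<otimes>\<^bsub>D\<^esub> y) = \<iota> x \<otimes>\<^bsub>D'\<^esub> \<iota> y"
  shows "fbasis N S D' (\<lambda>s. \<iota> (g s)) (I \<times> K) (\<lambda>(i, k). \<iota> (v i) \<otimes>\<^bsub>D'\<^esub> w k)"
    "fspan S D' (\<lambda>s. \<iota> (g s)) (I \<times> K) (\<lambda>(i, k). \<iota> (v i) \<otimes>\<^bsub>D'\<^esub> w k) = fspan (carrier D) D' \<iota> K w"
proof -
  interpret N: abelian_group N by fact
  interpret D: ring D by fact
  interpret D': ring D' by fact
  note b = fbasis_basic[OF B(1)] and b' = fbasis_basic[OF B']
  have gc: "g s \<in> carrier D" if "s \<in> S" for s using add_mapD(1)[OF b(2) that] .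
  have \<iota>c: "\<iota> x \<in> carrier D'" if "x \<in> carrier D" for x using add_mapD(1)[OF b'(2) that] .
  let ?vw = "\<lambda>(i, k). \<iota> (v i) \<otimes>\<^bsub>D'\<^esub> w k"
  have c: "?vw \<in> I \<times> K \<rightarrow> carrier D'" using b(4) b'(4) \<iota>c by auto
  have ga: "add_map N D' S (\<lambda>s. \<iota> (g s))" by (rule add_map_comp[OF b(2) b'(2) gc])
  note P = fspan_props[OF assms(1,3) b(1) ga c]
  note Q = fspan_props[OF D.abelian_group_axioms assms(3) b'(1-3)]
  note R = fspan_props[OF assms(1,2) b(1-3)]
  have gen: "\<iota> (g s) \<otimes>\<^bsub>D'\<^esub> (\<iota> (v i) \<otimes>\<^bsub>D'\<^esub> w k) = \<iota> (g s \<otimes>\<^bsub>D\<^esub> v i) \<otimes>\<^bsub>D'\<^esub> w k"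
    if "i \<in> I" "s \<in> S" "k \<in> K" for i s k
    using that b(4) b'(4) gc \<iota>c by (simp add: \<iota> D'.m_assoc)
  let ?X = "fspan S D' (\<lambda>s. \<iota> (g s)) (I \<times> K) ?vw"
  show X: "?X = fspan (carrier D) D' \<iota> K w"
  proof
    show "?X \<subseteq> fspan (carrier D) D' \<iota> K w"
      by (rule fspan_least[OF Q(1)]) (use gen Q(2) gc b(4) in auto)
    show "fspan (carrier D) D' \<iota> K w \<subseteq> ?X"
    proof (rule fspan_least[OF P(1)])
      fix k t assume k: "k \<in> K" and t: "t \<in> carrier D"
      show "\<iota> t \<otimes>\<^bsub>D'\<^esub> w k \<in> ?X"
      proof (rule fspan_absorb[OF assms(3) b'(1) B(2)[unfolded fspan_def, symmetric] b'(2) b'(4)[OF k] P(1) assms(2) R(4,5) _ t])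
        fix x assume "x \<in> dgen I (\<lambda>_. S) (\<lambda>i s. g s \<otimes>\<^bsub>D\<^esub> v i)"
        then obtain i s where "i \<in> I" "s \<in> S" "x = g s \<otimes>\<^bsub>D\<^esub> v i" by (auto simp: dgen_def)
        then show "\<iota> x \<otimes>\<^bsub>D'\<^esub> w k \<in> ?X" using gen[of i s k] k P(2)[of "(i, k)" s] by simp
      qed
    qed
  qed
  obtain \<kappa> where \<kappa>: "\<And>i. i \<in> I \<Longrightarrow> add_map D N (carrier D) (\<kappa> i)"
    "\<And>i l s. i \<in> I \<Longrightarrow> l \<in> I \<Longrightarrow> s \<in> S \<Longrightarrow> \<kappa> i (g s \<otimes>\<^bsub>D\<^esub> v l) = (if i = l then s else \<zero>\<^bsub>N\<^esub>)"
    using fbasisE[OF B(1), unfolded B(2)] by metis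
  obtain \<kappa>' where \<kappa>': "\<And>i. i \<in> K \<Longrightarrow> add_map D' D (fspan (carrier D) D' \<iota> K w) (\<kappa>' i)"
    "\<And>i l s. i \<in> K \<Longrightarrow> l \<in> K \<Longrightarrow> s \<in> carrier D \<Longrightarrow> \<kappa>' i (\<iota> s \<otimes>\<^bsub>D'\<^esub> w l) = (if i = l then s else \<zero>\<^bsub>D\<^esub>)"
    using fbasisE[OF B'] by metis
  have z: "\<kappa> i \<zero>\<^bsub>D\<^esub> = \<zero>\<^bsub>N\<^esub>" if "i \<in> I" for i
    by (rule add_map_zero[OF D.abelian_group_axioms N.abelian_group_axioms D.asub_carrier \<kappa>(1)[OF that]])
  show "fbasis N S D' (\<lambda>s. \<iota> (g s)) (I \<times> K) ?vw"
  proof (rule fbasisI[OF b(1) ga funcset_mem[OF c], where \<kappa> = "\<lambda>(i, k) x. \<kappa> i (\<kappa>' k x)"])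
    fix p assume p: "p \<in> I \<times> K"
    obtain i k where ik: "p = (i, k)" "i \<in> I" "k \<in> K" using p by blast
    show "add_map D' N ?X ((\<lambda>(i, k) x. \<kappa> i (\<kappa>' k x)) p)"
      unfolding ik(1) prod.case X
      by (rule add_map_comp[OF \<kappa>'(1) \<kappa>(1)]) (use ik add_mapD(1)[OF \<kappa>'(1)] in auto)
    fix q s assume q: "q \<in> I \<times> K" and s: "s \<in> S"
    obtain j l where jl: "q = (j, l)" "j \<in> I" "l \<in> K" using q by blast
    show "(\<lambda>(i, k) x. \<kappa> i (\<kappa>' k x)) p (\<iota> (g s) \<otimes>\<^bsub>D'\<^esub> ?vw q) = (if p = q then s else \<zero>\<^bsub>N\<^esub>)"
      using ik jl s gen[OF jl(2) s jl(3)] \<kappa>'(2)[of k l "g s \<otimes>\<^bsub>D\<^esub> v j"] gc[OF s] b(4)[OF jl(2)] \<kappa>(2) z by auto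
  qed auto
qed

text \<open>The signs are those produced by moving homogeneous factors past one another; the lemma
  lets them be ignored when the factors of a basis are reordered.\<close>

lemma fbasis_reindex:
  assumes "abelian_group N" "ring D" and B: "fbasis N S D g I v"
    and \<beta>: "bij_betw \<beta> I' I" and v': "\<And>i. i \<in> I' \<Longrightarrow> v' i = v (\<beta> i) \<or> v' i = \<ominus>\<^bsub>D\<^esub> v (\<beta> i)"
  shows "fbasis N S D g I' v'" "fspan S D g I' v' = fspan S D g I v"
proof -
  interpret N: abelian_group N by fact
  interpret D: ring D by fact
  note b = fbasis_basic[OF B]
  have \<beta>I: "\<beta> i \<in> I" if "i \<in> I'" for i using \<beta> that by (auto simp: bij_betw_def)
  have "v' i \<in> carrier D" if "i \<in> I'" for i
    using v'[OF that] b(4)[OF \<beta>I[OF that]] by auto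
  then have c: "v' \<in> I' \<rightarrow> carrier D" by simp
  note P = fspan_props[OF assms(1,2) b(1-3)]
  note Q = fspan_props[OF assms(1,2) b(1,2) c]
  have gc: "g s \<in> carrier D" "g (\<ominus>\<^bsub>N\<^esub> s) = \<ominus>\<^bsub>D\<^esub> g s" "\<ominus>\<^bsub>N\<^esub> s \<in> S" if "s \<in> S" for s
    using add_mapD(1)[OF b(2) that] add_map_minus[OF assms(1) D.abelian_group_axioms b(1,2) that] asubD(4)[OF b(1) that] .
  \<comment> \<open>Moves the sign of \<open>v' i\<close> into the coefficient. It is an involution,
    so the same map also corrects the coordinates.\<close>
  define \<epsilon> where "\<epsilon> i s = (if v' i = v (\<beta> i) then s else \<ominus>\<^bsub>N\<^esub> s)" for i s
  have gen: "g s \<otimes>\<^bsub>D\<^esub> v' i = g (\<epsilon> i s) \<otimes>\<^bsub>D\<^esub> v (\<beta> i)" "\<epsilon> i s \<in> S" "\<epsilon> i (\<epsilon> i s) = s" "\<epsilon> i \<zero>\<^bsub>N\<^esub> = \<zero>\<^bsub>N\<^esub>"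
    if "i \<in> I'" "s \<in> S" for i s
  proof -
    have "s \<in> carrier N" using that b(1) asubD(5) by metis
    moreover have "\<ominus>\<^bsub>N\<^esub> \<zero>\<^bsub>N\<^esub> = \<zero>\<^bsub>N\<^esub>" by (rule N.minus_equality) auto
    ultimately show "g s \<otimes>\<^bsub>D\<^esub> v' i = g (\<epsilon> i s) \<otimes>\<^bsub>D\<^esub> v (\<beta> i)" "\<epsilon> i s \<in> S" "\<epsilon> i (\<epsilon> i s) = s" "\<epsilon> i \<zero>\<^bsub>N\<^esub> = \<zero>\<^bsub>N\<^esub>"
      using v'[OF that(1)] gc[OF that(2)] that b(4)[OF \<beta>I[OF that(1)]] unfolding \<epsilon>_def
      by (auto simp: D.l_minus D.r_minus)
  qed
  show X: "fspan S D g I' v' = fspan S D g I v"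
  proof
    show "fspan S D g I' v' \<subseteq> fspan S D g I v"
      by (rule fspan_least[OF P(1)]) (use gen P(2) \<beta>I in auto)
    show "fspan S D g I v \<subseteq> fspan S D g I' v'"
    proof (rule fspan_least[OF Q(1)])
      fix i s assume i: "i \<in> I" and s: "s \<in> S"
      obtain i' where "i' \<in> I'" "i = \<beta> i'" using \<beta> i by (auto simp: bij_betw_def)
      then show "g s \<otimes>\<^bsub>D\<^esub> v i \<in> fspan S D g I' v'"
        using Q(2)[of i' "\<epsilon> i' s"] gen[of i' s] gen(1)[of i' "\<epsilon> i' s"] s by simp
    qed
  qed
  obtain \<kappa> where \<kappa>: "\<And>i. i \<in> I \<Longrightarrow> add_map D N (fspan S D g I v) (\<kappa> i)"
    "\<And>i l s. i \<in> I \<Longrightarrow> l \<in> I \<Longrightarrow> s \<in> S \<Longrightarrow> \<kappa> i (g s \<otimes>\<^bsub>D\<^esub> v l) = (if i = l then s else \<zero>\<^bsub>N\<^esub>)"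
    using fbasisE[OF B] by metis
  show "fbasis N S D g I' v'"
  proof (rule fbasisI[OF b(1,2) funcset_mem[OF c], where \<kappa> = "\<lambda>i x. \<epsilon> i (\<kappa> (\<beta> i) x)"])
    fix i assume i: "i \<in> I'"
    show "add_map D N (fspan S D g I' v') (\<lambda>x. \<epsilon> i (\<kappa> (\<beta> i) x))"
      unfolding X using add_mapD[OF \<kappa>(1)[OF \<beta>I[OF i]]] by (intro add_mapI) (auto simp: \<epsilon>_def N.minus_add)
    fix l s assume l: "l \<in> I'" and s: "s \<in> S"
    have "\<beta> i = \<beta> l \<longleftrightarrow> i = l" using \<beta> i l by (auto simp: bij_betw_def inj_on_def)
    then show "\<epsilon> i (\<kappa> (\<beta> i) (g s \<otimes>\<^bsub>D\<^esub> v' l)) = (if i = l then s else \<zero>\<^bsub>N\<^esub>)"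
      using gen[OF l s] gen[OF i s] \<kappa>(2)[of "\<beta> i" "\<beta> l" "\<epsilon> l s"] \<beta>I i l by auto
  qed auto
qed

lemma fbasis_subset:
  assumes "abelian_group N" "ring D" and B: "fbasis N S D g I v" and I: "I' \<subseteq> I"
  shows "fbasis N S D g I' v"
proof -
  interpret D: ring D by fact
  note b = fbasis_basic[OF B]
  have sub: "fspan S D g I' v \<subseteq> fspan S D g I v"
    by (rule fspan_least) (use fspan_props(1,2)[OF assms(1,2) b(1-3)] I in auto)
  obtain \<kappa> where \<kappa>: "\<And>i. i \<in> I \<Longrightarrow> add_map D N (fspan S D g I v) (\<kappa> i)"
    "\<And>i l s. i \<in> I \<Longrightarrow> l \<in> I \<Longrightarrow> s \<in> S \<Longrightarrow> \<kappa> i (g s \<otimes>\<^bsub>D\<^esub> v l) = (if i = l then s else \<zero>\<^bsub>N\<^esub>)"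
    using fbasisE[OF B] by metis
  show ?thesis
  proof (rule fbasisI[where \<kappa> = \<kappa>])
    show "\<kappa> i (g s \<otimes>\<^bsub>D\<^esub> v l) = (if i = l then s else \<zero>\<^bsub>N\<^esub>)" if "i \<in> I'" "l \<in> I'" "s \<in> S" for i l s
      using \<kappa>(2)[OF subsetD[OF I that(1)] subsetD[OF I that(2)] that(3)] .
  qed (use b I add_map_subset[OF \<kappa>(1) sub] in auto)
qed

text \<open>Coordinates on \<open>D'\<close> are those on \<open>D\<close> precomposed with the
  inverse bijection, which is again additive.\<close>

lemma fbasis_iso:
  assumes "abelian_group N" "ring D" "ring D'" and B: "fbasis N S D g I v" "fspan S D g I v = carrier D"
    and \<phi>: "add_map D D' (carrier D) \<phi>" "bij_betw \<phi> (carrier D) (carrier D')"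
      "\<And>x y. x \<in> carrier D \<Longrightarrow> y \<in> carrier D \<Longrightarrow> \<phi> (x \<otimes>\<^bsub>D\<^esub> y) = \<phi> x \<otimes>\<^bsub>D'\<^esub> \<phi> y"
  shows "fbasis N S D' (\<lambda>s. \<phi> (g s)) I (\<lambda>i. \<phi> (v i))" "fspan S D' (\<lambda>s. \<phi> (g s)) I (\<lambda>i. \<phi> (v i)) = carrier D'"
proof -
  interpret N: abelian_group N by fact
  interpret D: ring D by fact
  interpret D': ring D' by fact
  note b = fbasis_basic[OF B(1)]
  have gc: "g s \<in> carrier D" if "s \<in> S" for s using add_mapD(1)[OF b(2) that] .
  have \<phi>c: "\<phi> x \<in> carrier D'" if "x \<in> carrier D" for x using add_mapD(1)[OF \<phi>(1) that] .
  define \<psi> where "\<psi> = inv_into (carrier D) \<phi>"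
  have \<psi>: "\<psi> (\<phi> x) = x" if "x \<in> carrier D" for x
    using \<phi>(2) that by (simp add: \<psi>_def bij_betw_def inv_into_f_f)
  have surj: "\<exists>y\<in>carrier D. x = \<phi> y" if "x \<in> carrier D'" for x
    using \<phi>(2) that by (auto simp: bij_betw_def)
  have \<psi>a: "add_map D' D (carrier D') \<psi>"
  proof (rule add_mapI)
    show "\<psi> x \<in> carrier D" if "x \<in> carrier D'" for x using surj[OF that] \<psi> by auto
    fix x y assume "x \<in> carrier D'" "y \<in> carrier D'"
    then obtain x' y' where "x' \<in> carrier D" "y' \<in> carrier D" "x = \<phi> x'" "y = \<phi> y'" using surj by metis
    then show "\<psi> (x \<oplus>\<^bsub>D'\<^esub> y) = \<psi> x \<oplus>\<^bsub>D\<^esub> \<psi> y"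
      using \<psi> add_mapD(2)[OF \<phi>(1), symmetric] by simp
  qed
  have ga: "add_map N D' S (\<lambda>s. \<phi> (g s))" by (rule add_map_comp[OF b(2) \<phi>(1) gc])
  have c: "(\<lambda>i. \<phi> (v i)) \<in> I \<rightarrow> carrier D'" using b(4) \<phi>c by blast
  note P = fspan_props[OF assms(1,3) b(1) ga c]
  note R = fspan_props[OF assms(1,2) b(1-3)]
  show X: "fspan S D' (\<lambda>s. \<phi> (g s)) I (\<lambda>i. \<phi> (v i)) = carrier D'"
  proof
    show "carrier D' \<subseteq> fspan S D' (\<lambda>s. \<phi> (g s)) I (\<lambda>i. \<phi> (v i))"
    proof
      fix x assume "x \<in> carrier D'"
      then obtain y where y: "y \<in> carrier D" "x = \<phi> y" using surj by blast
      \<comment> \<open>The factor one only brings the claim into the shape treated by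
        \<open>fspan_absorb\<close>.\<close>
      have "\<phi> y \<otimes>\<^bsub>D'\<^esub> \<one>\<^bsub>D'\<^esub> \<in> fspan S D' (\<lambda>s. \<phi> (g s)) I (\<lambda>i. \<phi> (v i))"
      proof (rule fspan_absorb[OF assms(3) D.asub_carrier B(2)[unfolded fspan_def, symmetric] \<phi>(1) D'.one_closed P(1) assms(2) R(4,5) _ y(1)])
        fix x assume "x \<in> dgen I (\<lambda>_. S) (\<lambda>i s. g s \<otimes>\<^bsub>D\<^esub> v i)"
        then obtain i s where "i \<in> I" "s \<in> S" "x = g s \<otimes>\<^bsub>D\<^esub> v i" by (auto simp: dgen_def)
        then show "\<phi> x \<otimes>\<^bsub>D'\<^esub> \<one>\<^bsub>D'\<^esub> \<in> fspan S D' (\<lambda>s. \<phi> (g s)) I (\<lambda>i. \<phi> (v i))"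
          using P(2)[of i s] \<phi>(3)[of "g s" "v i"] gc b(4) \<phi>c by simp
      qed
      then show "x \<in> fspan S D' (\<lambda>s. \<phi> (g s)) I (\<lambda>i. \<phi> (v i))" using y \<phi>c by simp
    qed
  qed (rule P(3))
  obtain \<kappa> where \<kappa>: "\<And>i. i \<in> I \<Longrightarrow> add_map D N (carrier D) (\<kappa> i)"
    "\<And>i l s. i \<in> I \<Longrightarrow> l \<in> I \<Longrightarrow> s \<in> S \<Longrightarrow> \<kappa> i (g s \<otimes>\<^bsub>D\<^esub> v l) = (if i = l then s else \<zero>\<^bsub>N\<^esub>)"
    using fbasisE[OF B(1), unfolded B(2)] by metis
  show "fbasis N S D' (\<lambda>s. \<phi> (g s)) I (\<lambda>i. \<phi> (v i))"
  proof (rule fbasisI[OF b(1) ga funcset_mem[OF c], where \<kappa> = "\<lambda>i x. \<kappa> i (\<psi> x)"], unfold X)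
    show "add_map D' N (carrier D') (\<lambda>x. \<kappa> i (\<psi> x))" if "i \<in> I" for i
      by (rule add_map_comp[OF \<psi>a \<kappa>(1)[OF that]]) (rule add_mapD(1)[OF \<psi>a])
    fix i l s assume "i \<in> I" "l \<in> I" "s \<in> S"
    then show "\<kappa> i (\<psi> (\<phi> (g s) \<otimes>\<^bsub>D'\<^esub> \<phi> (v l))) = (if i = l then s else \<zero>\<^bsub>N\<^esub>)"
      using \<phi>(3)[of "g s" "v l", symmetric] gc b(4) \<psi> \<kappa>(2) by simp
  qed auto
qed

section \<open>Construction of dg algebras\<close>

text \<open>The existence and uniqueness of homogeneous decompositions is replaced by what can be
  verified on a construction: additive projections \<open>\<kappa> n\<close> and generation by
  homogeneous elements.\<close>

lemma is_dgaI:
  fixes E :: "('k::field_char_0, 'a) dga"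
  assumes R: "ring E"
    and s1: "\<And>c x. x \<in> carrier E \<Longrightarrow> c \<odot>\<^bsub>E\<^esub> x \<in> carrier E"
    and s2: "\<And>c d x. x \<in> carrier E \<Longrightarrow> (c + d) \<odot>\<^bsub>E\<^esub> x = (c \<odot>\<^bsub>E\<^esub> x) \<oplus>\<^bsub>E\<^esub> (d \<odot>\<^bsub>E\<^esub> x)"
    and s3: "\<And>c x y. x \<in> carrier E \<Longrightarrow> y \<in> carrier E \<Longrightarrow> c \<odot>\<^bsub>E\<^esub> (x \<oplus>\<^bsub>E\<^esub> y) = (c \<odot>\<^bsub>E\<^esub> x) \<oplus>\<^bsub>E\<^esub> (c \<odot>\<^bsub>E\<^esub> y)"
    and s4: "\<And>c d x. x \<in> carrier E \<Longrightarrow> (c * d) \<odot>\<^bsub>E\<^esub> x = c \<odot>\<^bsub>E\<^esub> (d \<odot>\<^bsub>E\<^esub> x)"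
    and s5: "\<And>x. x \<in> carrier E \<Longrightarrow> 1 \<odot>\<^bsub>E\<^esub> x = x"
    and s6: "\<And>c x y. x \<in> carrier E \<Longrightarrow> y \<in> carrier E \<Longrightarrow> (c \<odot>\<^bsub>E\<^esub> x) \<otimes>\<^bsub>E\<^esub> y = c \<odot>\<^bsub>E\<^esub> (x \<otimes>\<^bsub>E\<^esub> y)"
    and s7: "\<And>c x y. x \<in> carrier E \<Longrightarrow> y \<in> carrier E \<Longrightarrow> x \<otimes>\<^bsub>E\<^esub> (c \<odot>\<^bsub>E\<^esub> y) = c \<odot>\<^bsub>E\<^esub> (x \<otimes>\<^bsub>E\<^esub> y)"
    and h1: "\<And>n. homog E n \<subseteq> carrier E" and h2: "\<And>n. \<zero>\<^bsub>E\<^esub> \<in> homog E n"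
    and h3: "\<And>n x y. x \<in> homog E n \<Longrightarrow> y \<in> homog E n \<Longrightarrow> x \<oplus>\<^bsub>E\<^esub> y \<in> homog E n"
    and h4: "\<And>n c x. x \<in> homog E n \<Longrightarrow> c \<odot>\<^bsub>E\<^esub> x \<in> homog E n"
    and k: "\<And>n. add_map E E (carrier E) (\<kappa> n)" "\<And>n m x. x \<in> homog E m \<Longrightarrow> \<kappa> n x = (if n = m then x else \<zero>\<^bsub>E\<^esub>)"
    and g: "carrier E \<subseteq> aspan E (\<Union>n. homog E n)"
    and h5: "\<one>\<^bsub>E\<^esub> \<in> homog E 0"
    and h6: "\<And>m n x y. x \<in> homog E m \<Longrightarrow> y \<in> homog E n \<Longrightarrow> x \<otimes>\<^bsub>E\<^esub> y \<in> homog E (m + n)"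
    and h7: "\<And>m n x y. x \<in> homog E m \<Longrightarrow> y \<in> homog E n \<Longrightarrow> x \<otimes>\<^bsub>E\<^esub> y = sgn_mul E (m * n) (y \<otimes>\<^bsub>E\<^esub> x)"
    and d1: "\<And>x y. x \<in> carrier E \<Longrightarrow> y \<in> carrier E \<Longrightarrow> differential E (x \<oplus>\<^bsub>E\<^esub> y) = differential E x \<oplus>\<^bsub>E\<^esub> differential E y"
    and d2: "\<And>c x. x \<in> carrier E \<Longrightarrow> differential E (c \<odot>\<^bsub>E\<^esub> x) = c \<odot>\<^bsub>E\<^esub> differential E x"
    and d3: "\<And>n x. x \<in> homog E n \<Longrightarrow> differential E x \<in> homog E (n + 1)"
    and d4: "\<And>x. x \<in> carrier E \<Longrightarrow> differential E (differential E x) = \<zero>\<^bsub>E\<^esub>"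
    and d5: "\<And>m x y. x \<in> homog E m \<Longrightarrow> y \<in> carrier E \<Longrightarrow> differential E (x \<otimes>\<^bsub>E\<^esub> y) =
          (differential E x \<otimes>\<^bsub>E\<^esub> y) \<oplus>\<^bsub>E\<^esub> sgn_mul E m (x \<otimes>\<^bsub>E\<^esub> differential E y)"
  shows "is_dga E"
proof -
  interpret ring E by (rule R)
  \<comment> \<open>Homogeneous parts are given closed under sums and scalar multiples; negation
    reaches them as multiplication by -1.\<close>
  have sm: "(-1) \<odot>\<^bsub>E\<^esub> x = \<ominus>\<^bsub>E\<^esub> x" if x: "x \<in> carrier E" for x
  proof -
    have "0 \<odot>\<^bsub>E\<^esub> x = \<zero>\<^bsub>E\<^esub>"
      using s2[OF x, of 0 0] s1[OF x, of 0] by (metis add.l_cancel_one' add_0)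
    then show ?thesis using s2[OF x, of "-1" 1] s1[OF x, of "-1"] s5[OF x] x by (simp add: minus_equality)
  qed
  have sub: "asub E (homog E n)" for n
    using h1[of n] h2[of n] h3[of _ n] h4[of _ n "-1"] sm unfolding asub_def
    by (metis subsetD)
  have carr: "aspan E (\<Union>n. homog E n) = carrier E"
    using g aspan_closed[of "\<Union>n. homog E n"] h1 by blast
  have co: "coords E E UNIV (homog E) (\<lambda>_ x. x) \<kappa>"
    using k carr by (simp add: coords_def dgen_def)
  have dec: "\<And>x. x \<in> carrier E \<Longrightarrow> \<exists>!h. (\<forall>n. h n \<in> homog E n) \<and> finite {n. h n \<noteq> \<zero>\<^bsub>E\<^esub>} \<and> x = finsum E h {n. h n \<noteq> \<zero>\<^bsub>E\<^esub>}"
    by (rule dga_gradingI[OF abelian_group_axioms co sub]) (simp add: carr)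
  show ?thesis unfolding is_dga_def
    by (intro conjI allI impI ballI)
       (rule R s1 s2 s3 s4 s5 s6 s7 h1 h2 h3 h4 dec h5 h6 h7 d1 d2 d3 d4 d5; assumption)+
qed

text \<open>Copies an algebra along an injection in order to change its carrier type. It serves for
  \<open>B\<close> at the start and for each polynomial algebra afterwards.\<close>

definition transport :: "('e \<Rightarrow> 't) \<Rightarrow> ('k, 'e) dga \<Rightarrow> ('k, 't) dga" where
  "transport \<phi> E = (let \<psi> = inv_into (carrier E) \<phi> in
    \<lparr>carrier = \<phi> ` carrier E, mult = (\<lambda>x y. \<phi> (\<psi> x \<otimes>\<^bsub>E\<^esub> \<psi> y)), one = \<phi> \<one>\<^bsub>E\<^esub>, zero = \<phi> \<zero>\<^bsub>E\<^esub>,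
     add = (\<lambda>x y. \<phi> (\<psi> x \<oplus>\<^bsub>E\<^esub> \<psi> y)), smult = (\<lambda>c x. \<phi> (c \<odot>\<^bsub>E\<^esub> \<psi> x)),
     differential = (\<lambda>x. \<phi> (differential E (\<psi> x))), homog = (\<lambda>n. \<phi> ` homog E n)\<rparr>)"

lemma transport_dga:
  fixes E :: "('k::field_char_0, 'e) dga"
  assumes "is_dga E" and inj: "inj_on \<phi> (carrier E)"
  shows "is_dga (transport \<phi> E)" "dga_hom E (transport \<phi> E) \<phi>"
    "bij_betw \<phi> (carrier E) (carrier (transport \<phi> E))"
    "homog (transport \<phi> E) n = \<phi> ` homog E n"
proof -
  interpret E: dg_algebra E by unfold_locales fact
  define T where "T = transport \<phi> E"
  define \<psi> where "\<psi> = inv_into (carrier E) \<phi>"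
  have \<psi> [simp]: "\<psi> (\<phi> x) = x" if "x \<in> carrier E" for x
    using inj that by (simp add: \<psi>_def inv_into_f_f)
  have T_sel: "carrier T = \<phi> ` carrier E" "\<one>\<^bsub>T\<^esub> = \<phi> \<one>\<^bsub>E\<^esub>" "\<zero>\<^bsub>T\<^esub> = \<phi> \<zero>\<^bsub>E\<^esub>" "homog T n = \<phi> ` homog E n" for n
    by (simp_all add: T_def transport_def Let_def)
  have T_op: "\<phi> x \<otimes>\<^bsub>T\<^esub> \<phi> y = \<phi> (x \<otimes>\<^bsub>E\<^esub> y)" "\<phi> x \<oplus>\<^bsub>T\<^esub> \<phi> y = \<phi> (x \<oplus>\<^bsub>E\<^esub> y)"
    if "x \<in> carrier E" "y \<in> carrier E" for x y
    using that \<psi> by (simp_all add: T_def transport_def Let_def \<psi>_def[symmetric])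
  have T_op1: "c \<odot>\<^bsub>T\<^esub> \<phi> x = \<phi> (c \<odot>\<^bsub>E\<^esub> x)" "differential T (\<phi> x) = \<phi> (differential E x)"
    if "x \<in> carrier E" for x c
    using that \<psi> by (simp_all add: T_def transport_def Let_def \<psi>_def[symmetric])
  note T_op = T_op T_op1
  note hc = E.homog_carrier
  have R: "ring T"
  proof (rule ringI)
    show "abelian_group T"
    proof (rule abelian_groupI)
      fix x assume "x \<in> carrier T"
      then obtain x' where "x' \<in> carrier E" "x = \<phi> x'" by (auto simp: T_sel)
      then show "\<exists>y\<in>carrier T. y \<oplus>\<^bsub>T\<^esub> x = \<zero>\<^bsub>T\<^esub>"
        by (intro bexI[of _ "\<phi> (\<ominus>\<^bsub>E\<^esub> x')"]) (auto simp: T_sel T_op E.l_neg)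
    qed (auto simp: T_sel T_op E.a_ac)
    show "monoid T"
      by (rule monoidI) (auto simp: T_sel T_op E.m_assoc)
  qed (auto simp: T_sel T_op E.l_distr E.r_distr)
  interpret T: ring T by (rule R)
  have T_neg: "\<ominus>\<^bsub>T\<^esub> \<phi> x = \<phi> (\<ominus>\<^bsub>E\<^esub> x)" if "x \<in> carrier E" for x
    using that by (intro T.minus_equality) (auto simp: T_sel T_op E.l_neg)
  have T_sgn: "sgn_mul T n (\<phi> x) = \<phi> (sgn_mul E n x)" if "x \<in> carrier E" for x n
    using that by (simp add: sgn_mul_def T_neg)
  have span: "\<phi> x \<in> aspan T (\<Union>n. homog T n)" if "x \<in> aspan E (\<Union>n. homog E n)" for x
    using that
  proof induction
    case aspan_zero
    then show ?case using aspan.aspan_zero[of T] by (simp add: T_sel)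
  next
    case (aspan_step g x)
    have "x \<in> carrier E" using aspan_step(2) E.carrier_aspan by (simp add: E.homog_gen)
    then have "\<phi> (g \<oplus>\<^bsub>E\<^esub> x) = \<phi> g \<oplus>\<^bsub>T\<^esub> \<phi> x" using aspan_step(1) by (auto simp: T_op)
    moreover have "\<phi> g \<in> (\<Union>n. homog T n)" using aspan_step(1) by (auto simp: T_sel)
    ultimately show ?case using aspan_step(3) by (simp add: aspan.aspan_step)
  qed
  have "is_dga T"
  proof (rule is_dgaI[OF R, where \<kappa> = "\<lambda>n x. \<phi> (hcomp E n (\<psi> x))"])
    show "add_map T T (carrier T) (\<lambda>x. \<phi> (hcomp E n (\<psi> x)))" for n
      by (intro add_mapI) (auto simp: T_sel T_op E.hcomp_add)
    show "\<phi> (hcomp E n (\<psi> x)) = (if n = m then x else \<zero>\<^bsub>T\<^esub>)" if "x \<in> homog T m" for n m x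
      using that by (auto simp: T_sel E.hcomp_homog)
    show "carrier T \<subseteq> aspan T (\<Union>n. homog T n)"
      using span E.carrier_aspan by (auto simp: T_sel E.homog_gen)
    show "\<And>m n x y. x \<in> homog T m \<Longrightarrow> y \<in> homog T n \<Longrightarrow> x \<otimes>\<^bsub>T\<^esub> y = sgn_mul T (m * n) (y \<otimes>\<^bsub>T\<^esub> x)"
      by (auto simp: T_sel T_op T_sgn E.homog_carrier intro!: arg_cong[of _ _ \<phi>] E.gcomm)
    show "\<And>m x y. x \<in> homog T m \<Longrightarrow> y \<in> carrier T \<Longrightarrow> differential T (x \<otimes>\<^bsub>T\<^esub> y) =
          (differential T x \<otimes>\<^bsub>T\<^esub> y) \<oplus>\<^bsub>T\<^esub> sgn_mul T m (x \<otimes>\<^bsub>T\<^esub> differential T y)"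
      by (auto simp: T_sel T_op T_sgn E.homog_carrier intro!: arg_cong[of _ _ \<phi>] E.leibniz)
    show "\<And>n x. x \<in> homog T n \<Longrightarrow> differential T x \<in> homog T (n + 1)"
      by (auto simp: T_sel T_op E.homog_carrier)
    show "\<And>m n x y. x \<in> homog T m \<Longrightarrow> y \<in> homog T n \<Longrightarrow> x \<otimes>\<^bsub>T\<^esub> y \<in> homog T (m + n)"
      by (auto simp: T_sel T_op E.homog_carrier)
    show "\<And>n x y. x \<in> homog T n \<Longrightarrow> y \<in> homog T n \<Longrightarrow> x \<oplus>\<^bsub>T\<^esub> y \<in> homog T n"
      by (auto simp: T_sel T_op E.homog_carrier)
    show "\<And>n c x. x \<in> homog T n \<Longrightarrow> c \<odot>\<^bsub>T\<^esub> x \<in> homog T n"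
      by (auto simp: T_sel T_op E.homog_carrier)
  qed (auto simp: T_sel T_op E.homog_carrier E.smult_l_distr E.smult_r_distr E.smult_assoc1
        E.smult_mult_l E.smult_mult_r E.d_add E.d_smult E.d_d)
  then show "is_dga (transport \<phi> E)" by (simp add: T_def)
  show "dga_hom E (transport \<phi> E) \<phi>"
    unfolding dga_hom_def T_def[symmetric] by (auto simp: T_sel T_op)
  show "bij_betw \<phi> (carrier E) (carrier (transport \<phi> E))"
    unfolding T_def[symmetric] using inj by (simp add: bij_betw_def T_sel)
  show "homog (transport \<phi> E) n = \<phi> ` homog E n"
    unfolding T_def[symmetric] by (rule T_sel)
qed

section \<open>Adjoining a variable\<close>

text \<open>Admissible exponents of one variable of degree \<open>d\<close>: an odd variable squares
  to zero. This is the condition that \<open>exps\<close> imposes on each entry.\<close>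

definition pw :: "int \<Rightarrow> nat set" where
  "pw d = {i. odd d \<longrightarrow> i \<le> 1}"

text \<open>The sign for moving an element of degree \<open>m\<close> to the right past
  \<open>x\<close>; in the product, \<open>m\<close> is the degree of a power of the new
  variable.\<close>

definition tw :: "('k, 'a, 'm) dga_scheme \<Rightarrow> int \<Rightarrow> 'a \<Rightarrow> 'a" where
  "tw C m x = (if odd m then par C x else x)"

text \<open>The algebra \<open>C[x]\<close> with \<open>x\<close> of degree \<open>d\<close> and \<open>\<partial>x = P\<close>; a function \<open>p\<close> stands for the sum of the
  \<open>p i \<otimes> x^i\<close>.\<close>
definition adjoin :: "('k::field_char_0, 'a) dga \<Rightarrow> int \<Rightarrow> 'a \<Rightarrow> ('k, nat \<Rightarrow> 'a) dga" where
  "adjoin C d P = 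
    \<lparr>carrier = {p. (\<forall>i. p i \<in> carrier C) \<and> (\<exists>N. \<forall>i>N. p i = \<zero>\<^bsub>C\<^esub>) \<and> (\<forall>i. i \<notin> pw d \<longrightarrow> p i = \<zero>\<^bsub>C\<^esub>)},
     mult = (\<lambda>p q n. if n \<in> pw d then finsum C (\<lambda>k. p k \<otimes>\<^bsub>C\<^esub> tw C (int k * d) (q (n - k))) {..n} else \<zero>\<^bsub>C\<^esub>),
     one = (\<lambda>i. if i = 0 then \<one>\<^bsub>C\<^esub> else \<zero>\<^bsub>C\<^esub>), zero = (\<lambda>_. \<zero>\<^bsub>C\<^esub>), add = (\<lambda>p q i. p i \<oplus>\<^bsub>C\<^esub> q i),
     smult = (\<lambda>c p i. c \<odot>\<^bsub>C\<^esub> p i),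
     differential = (\<lambda>p i. differential C (p i) \<oplus>\<^bsub>C\<^esub> of_nat (Suc i) \<odot>\<^bsub>C\<^esub> (par C (p (Suc i)) \<otimes>\<^bsub>C\<^esub> P)),
     homog = (\<lambda>m. {p. (\<forall>i. p i \<in> homog C (m - int i * d)) \<and> (\<exists>N. \<forall>i>N. p i = \<zero>\<^bsub>C\<^esub>) \<and>
        (\<forall>i. i \<notin> pw d \<longrightarrow> p i = \<zero>\<^bsub>C\<^esub>)})\<rparr>"

definition single :: "('k, 'a, 'm) dga_scheme \<Rightarrow> nat \<Rightarrow> 'a \<Rightarrow> nat \<Rightarrow> 'a" where
  "single C i c = (\<lambda>n. if n = i then c else \<zero>\<^bsub>C\<^esub>)"

lemma pw_0 [simp]: "0 \<in> pw d" and pw_1 [simp]: "Suc 0 \<in> pw d" "1 \<in> pw d"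
  and pw_down: "i \<in> pw d \<Longrightarrow> j \<le> i \<Longrightarrow> j \<in> pw d" 
  by (auto simp: pw_def)

locale adjoin_dga = dg_algebra D for D :: "('k::field_char_0, 'a) dga" (structure) +
  fixes d :: int and P :: 'a
  assumes P: "P \<in> homog D (d + 1)" and dP: "\<delta> P = \<zero>"
begin

abbreviation E where "E \<equiv> adjoin D d P"

lemma E_carrier: "p \<in> carrier E \<longleftrightarrow> (\<forall>i. p i \<in> carrier D) \<and> (\<exists>N. \<forall>i>N. p i = \<zero>) \<and> (\<forall>i. i \<notin> pw d \<longrightarrow> p i = \<zero>)"
  and E_homog: "p \<in> homog E m \<longleftrightarrow> (\<forall>i. p i \<in> homog D (m - int i * d)) \<and> p \<in> carrier E"
  and E_zero: "\<zero>\<^bsub>E\<^esub> = (\<lambda>_. \<zero>)" and E_one: "\<one>\<^bsub>E\<^esub> = single D 0 \<one>"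
  and E_add: "p \<oplus>\<^bsub>E\<^esub> q = (\<lambda>i. p i \<oplus> q i)" and E_smult: "c \<odot>\<^bsub>E\<^esub> p = (\<lambda>i. c \<odot> p i)"
  and E_mult: "p \<otimes>\<^bsub>E\<^esub> q = (\<lambda>n. if n \<in> pw d then (\<Oplus>k\<in>{..n}. p k \<otimes> tw D (int k * d) (q (n - k))) else \<zero>)"
  and E_diff: "differential E p = (\<lambda>i. \<delta> (p i) \<oplus> of_nat (Suc i) \<odot> (par D (p (Suc i)) \<otimes> P))"
  by (auto simp: adjoin_def single_def homog_carrier)

lemma Pc [simp]: "P \<in> carrier D" using P by blast

lemma E_coeff [simp]: "p \<in> carrier E \<Longrightarrow> p i \<in> carrier D"
  by (simp add: E_carrier)

lemma tw_closed [simp]: "x \<in> carrier D \<Longrightarrow> tw D m x \<in> carrier D"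
  and tw_zero [simp]: "tw D m \<zero> = \<zero>"
  and tw_add: "x \<in> carrier D \<Longrightarrow> y \<in> carrier D \<Longrightarrow> tw D m (x \<oplus> y) = tw D m x \<oplus> tw D m y"
  and tw_smult: "x \<in> carrier D \<Longrightarrow> tw D m (c \<odot> x) = c \<odot> tw D m x"
  by (simp_all add: tw_def par_add par_smult)

lemma tw_homog: "x \<in> homog D n \<Longrightarrow> tw D m x = sgn_mul D (m * n) x"
  by (auto simp: tw_def par_homog sgn_mul_def)

lemma single_simps [simp]: "single D i c i = c" "n \<noteq> i \<Longrightarrow> single D i c n = \<zero>"
  by (simp_all add: single_def)

lemma single_zero: "single D i \<zero> = \<zero>\<^bsub>E\<^esub>"
  by (auto simp: single_def E_zero)

lemma single_closed [simp]: "i \<in> pw d \<Longrightarrow> c \<in> carrier D \<Longrightarrow> single D i c \<in> carrier E"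
  by (auto simp: E_carrier single_def intro!: exI[of _ i])

lemma single_homog: "i \<in> pw d \<Longrightarrow> c \<in> homog D k \<Longrightarrow> single D i c \<in> homog E (k + int i * d)"
  using single_closed[of i c] unfolding E_homog by (auto simp: single_def)

lemma single_add: "a \<in> carrier D \<Longrightarrow> b \<in> carrier D \<Longrightarrow> single D i (a \<oplus> b) = single D i a \<oplus>\<^bsub>E\<^esub> single D i b"
  by (auto simp: single_def E_add)

lemma single_smult: "single D i (c \<odot> a) = c \<odot>\<^bsub>E\<^esub> single D i a"
  by (auto simp: single_def E_smult)

lemma E_add_closed: "p \<in> carrier E \<Longrightarrow> q \<in> carrier E \<Longrightarrow> p \<oplus>\<^bsub>E\<^esub> q \<in> carrier E"
proof -
  assume p: "p \<in> carrier E" and q: "q \<in> carrier E"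
  obtain N M where "\<forall>i>N. p i = \<zero>" "\<forall>i>M. q i = \<zero>" using p q by (auto simp: E_carrier)
  then have "\<exists>N. \<forall>i>N. p i \<oplus> q i = \<zero>" by (intro exI[of _ "max N M"]) auto
  then show ?thesis using p q by (auto simp: E_carrier E_add)
qed

lemma E_abelian: "abelian_group E"
proof (rule abelian_groupI)
  fix p q r assume pqr: "p \<in> carrier E" "q \<in> carrier E" "r \<in> carrier E"
  show "p \<oplus>\<^bsub>E\<^esub> q \<oplus>\<^bsub>E\<^esub> r = p \<oplus>\<^bsub>E\<^esub> (q \<oplus>\<^bsub>E\<^esub> r)" using pqr by (simp add: E_add a_assoc)
next
  fix p q assume pq: "p \<in> carrier E" "q \<in> carrier E"
  then show "p \<oplus>\<^bsub>E\<^esub> q = q \<oplus>\<^bsub>E\<^esub> p" by (simp add: E_add a_comm)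
  show "p \<oplus>\<^bsub>E\<^esub> q \<in> carrier E" using pq by (rule E_add_closed)
next
  show "\<zero>\<^bsub>E\<^esub> \<in> carrier E" by (simp add: E_zero E_carrier)
  fix p assume p: "p \<in> carrier E"
  then show "\<zero>\<^bsub>E\<^esub> \<oplus>\<^bsub>E\<^esub> p = p" by (simp add: E_zero E_add)
  have "(\<lambda>i. \<ominus> p i) \<in> carrier E" using p by (fastforce simp: E_carrier)
  moreover have "(\<lambda>i. \<ominus> p i) \<oplus>\<^bsub>E\<^esub> p = \<zero>\<^bsub>E\<^esub>" using p by (auto simp: E_zero E_add l_neg)
  ultimately show "\<exists>q\<in>carrier E. q \<oplus>\<^bsub>E\<^esub> p = \<zero>\<^bsub>E\<^esub>" by blast
qed

sublocale EA: abelian_group E by (rule E_abelian)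

lemma E_minus: "p \<in> carrier E \<Longrightarrow> \<ominus>\<^bsub>E\<^esub> p = (\<lambda>i. \<ominus> p i)"
proof (rule EA.minus_equality)
  assume p: "p \<in> carrier E"
  show "(\<lambda>i. \<ominus> p i) \<in> carrier E" using p by (fastforce simp: E_carrier)
  show "(\<lambda>i. \<ominus> p i) \<oplus>\<^bsub>E\<^esub> p = \<zero>\<^bsub>E\<^esub>" using p by (auto simp: E_zero E_add l_neg)
qed

lemma E_sgn_mul: "p \<in> carrier E \<Longrightarrow> sgn_mul E n p = (\<lambda>i. sgn_mul D n (p i))"
  by (auto simp: sgn_mul_def E_minus)

lemma E_sgn_single: "i \<in> pw d \<Longrightarrow> c \<in> carrier D \<Longrightarrow> sgn_mul E n (single D i c) = single D i (sgn_mul D n c)"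
  using single_closed[of i c] by (auto simp: E_sgn_mul) (auto simp: single_def)

lemma E_sgn_add: "p \<in> carrier E \<Longrightarrow> q \<in> carrier E \<Longrightarrow> sgn_mul E n (p \<oplus>\<^bsub>E\<^esub> q) = sgn_mul E n p \<oplus>\<^bsub>E\<^esub> sgn_mul E n q"
  by (auto simp: sgn_mul_def EA.minus_add)

lemma E_sgn_closed [simp]: "p \<in> carrier E \<Longrightarrow> sgn_mul E n p \<in> carrier E"
  by (simp add: sgn_mul_def)

text \<open>Truncations of \<open>p\<close> are built up coefficient by coefficient. The base case
  concerns only the coefficients of \<open>p\<close> itself, whose degrees are known when
  \<open>p\<close> is homogeneous; \<open>E_induct\<close> loses this information.\<close>

lemma E_coeff_induct [consumes 1, case_names single add]:
  assumes p: "p \<in> carrier E" and s: "\<And>i. i \<in> pw d \<Longrightarrow> Q (single D i (p i))"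
    and a: "\<And>x y. x \<in> carrier E \<Longrightarrow> y \<in> carrier E \<Longrightarrow> Q x \<Longrightarrow> Q y \<Longrightarrow> Q (x \<oplus>\<^bsub>E\<^esub> y)"
  shows "Q p"
proof -
  define t where "t N = (\<lambda>i. if i \<le> N then p i else \<zero>)" for N :: nat
  have t: "t N \<in> carrier E" for N using p by (auto simp: E_carrier t_def)
  have "Q (t N)" for N
  proof (induction N)
    case 0
    have "t 0 = single D 0 (p 0)" by (auto simp: t_def single_def)
    then show ?case using s[of 0] by simp
  next
    case (Suc N)
    show ?case
    proof (cases "Suc N \<in> pw d")
      case True
      have "t (Suc N) = t N \<oplus>\<^bsub>E\<^esub> single D (Suc N) (p (Suc N))"
        using p by (auto simp: t_def single_def E_add le_Suc_eq)
      then show ?thesis using a[OF t _ Suc s[OF True]] p True by simp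
    next
      case False
      then have "p (Suc N) = \<zero>" using p by (simp add: E_carrier)
      then have "t (Suc N) = t N" by (auto simp: t_def le_Suc_eq)
      then show ?thesis using Suc by simp
    qed
  qed
  moreover obtain N where "\<forall>i>N. p i = \<zero>" using p by (auto simp: E_carrier)
  then have "t N = p" by (auto simp: t_def)
  ultimately show ?thesis by metis
qed

lemma E_induct [consumes 1, case_names single add]:
  assumes p: "p \<in> carrier E" and s: "\<And>i k c. i \<in> pw d \<Longrightarrow> c \<in> homog D k \<Longrightarrow> Q (single D i c)"
    and a: "\<And>x y. x \<in> carrier E \<Longrightarrow> y \<in> carrier E \<Longrightarrow> Q x \<Longrightarrow> Q y \<Longrightarrow> Q (x \<oplus>\<^bsub>E\<^esub> y)"
  shows "Q p"
  using p
proof (induction rule: E_coeff_induct)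
  case (single i)
  have "p i \<in> carrier D" using p by simp
  then show ?case
  proof (induction rule: homog_induct)
    case (homog n y)
    then show ?case using s single by blast
  next
    case (add y z)
    then show ?case using a[of "single D i y" "single D i z"] single by (simp add: single_add)
  qed
qed (rule a)

lemma E_mult_closed [simp]:
  assumes p: "p \<in> carrier E" and q: "q \<in> carrier E"
  shows "p \<otimes>\<^bsub>E\<^esub> q \<in> carrier E"
proof -
  obtain N M where N: "\<forall>i>N. p i = \<zero>" "\<forall>i>M. q i = \<zero>" using p q by (auto simp: E_carrier)
  have "(\<Oplus>k\<in>{..n}. p k \<otimes> tw D (int k * d) (q (n - k))) = \<zero>" if n: "n > N + M" for n
  proof -
    have "p k \<otimes> tw D (int k * d) (q (n - k)) = \<zero>" if "k \<le> n" for k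
    proof (cases "k > N")
      case True
      then show ?thesis using N q by simp
    next
      case False
      then have "n - k > M" using n by simp
      then show ?thesis using N p by simp
    qed
    then have "(\<Oplus>k\<in>{..n}. p k \<otimes> tw D (int k * d) (q (n - k))) = (\<Oplus>k\<in>{..n}. \<zero>)"
      by (intro finsum_cong') auto
    then show ?thesis by simp
  qed
  then have "\<exists>N. \<forall>n>N. (p \<otimes>\<^bsub>E\<^esub> q) n = \<zero>" by (intro exI[of _ "N + M"]) (auto simp: E_mult)
  moreover have "\<forall>n. (p \<otimes>\<^bsub>E\<^esub> q) n \<in> carrier D" using p q by (auto simp: E_mult intro!: finsum_closed)
  moreover have "\<forall>n. n \<notin> pw d \<longrightarrow> (p \<otimes>\<^bsub>E\<^esub> q) n = \<zero>" by (simp add: E_mult)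
  ultimately show ?thesis unfolding E_carrier by blast
qed

lemma E_l_distr:
  assumes "p \<in> carrier E" "q \<in> carrier E" "r \<in> carrier E"
  shows "(p \<oplus>\<^bsub>E\<^esub> q) \<otimes>\<^bsub>E\<^esub> r = p \<otimes>\<^bsub>E\<^esub> r \<oplus>\<^bsub>E\<^esub> q \<otimes>\<^bsub>E\<^esub> r"
proof -
  have "(\<Oplus>k\<in>{..n}. (p k \<oplus> q k) \<otimes> tw D (int k * d) (r (n - k))) =
      (\<Oplus>k\<in>{..n}. p k \<otimes> tw D (int k * d) (r (n - k))) \<oplus> (\<Oplus>k\<in>{..n}. q k \<otimes> tw D (int k * d) (r (n - k)))" for n
    using assms by (subst finsum_addf[symmetric]) (auto simp: l_distr intro!: finsum_cong')
  then show ?thesis by (auto simp: E_mult E_add)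
qed

lemma E_r_distr:
  assumes "p \<in> carrier E" "q \<in> carrier E" "r \<in> carrier E"
  shows "r \<otimes>\<^bsub>E\<^esub> (p \<oplus>\<^bsub>E\<^esub> q) = r \<otimes>\<^bsub>E\<^esub> p \<oplus>\<^bsub>E\<^esub> r \<otimes>\<^bsub>E\<^esub> q"
proof -
  have "(\<Oplus>k\<in>{..n}. r k \<otimes> tw D (int k * d) (p (n - k) \<oplus> q (n - k))) =
      (\<Oplus>k\<in>{..n}. r k \<otimes> tw D (int k * d) (p (n - k))) \<oplus> (\<Oplus>k\<in>{..n}. r k \<otimes> tw D (int k * d) (q (n - k)))" for n
    using assms by (subst finsum_addf[symmetric]) (auto simp: r_distr tw_add intro!: finsum_cong')
  then show ?thesis by (auto simp: E_mult E_add)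
qed

lemma E_mult_zero [simp]: "p \<in> carrier E \<Longrightarrow> p \<otimes>\<^bsub>E\<^esub> \<zero>\<^bsub>E\<^esub> = \<zero>\<^bsub>E\<^esub>" "p \<in> carrier E \<Longrightarrow> \<zero>\<^bsub>E\<^esub> \<otimes>\<^bsub>E\<^esub> p = \<zero>\<^bsub>E\<^esub>"
  using E_r_distr[of "\<zero>\<^bsub>E\<^esub>" "\<zero>\<^bsub>E\<^esub>" p] E_l_distr[of "\<zero>\<^bsub>E\<^esub>" "\<zero>\<^bsub>E\<^esub>" p]
  by (auto simp: EA.add.l_cancel_one')

text \<open>The sign comes from moving \<open>x^i\<close> past \<open>b\<close>. The zero case
  occurs only as the square of an odd variable.\<close>

lemma single_mult:
  assumes "i \<in> pw d" "j \<in> pw d" "a \<in> carrier D" "b \<in> homog D n"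
  shows "single D i a \<otimes>\<^bsub>E\<^esub> single D j b =
    (if i + j \<in> pw d then single D (i + j) (sgn_mul D (int i * d * n) (a \<otimes> b)) else \<zero>\<^bsub>E\<^esub>)"
proof -
  have b: "b \<in> carrier D" using assms by blast
  have "(\<Oplus>k\<in>{..m}. single D i a k \<otimes> tw D (int k * d) (single D j b (m - k))) =
     (if m = i + j then sgn_mul D (int i * d * n) (a \<otimes> b) else \<zero>)" for m
  proof -
    have "(\<Oplus>k\<in>{..m}. single D i a k \<otimes> tw D (int k * d) (single D j b (m - k))) =
        (\<Oplus>k\<in>{..m}. if i = k then (if m = i + j then sgn_mul D (int i * d * n) (a \<otimes> b) else \<zero>) else \<zero>)"
      using assms b by (intro finsum_cong') (auto simp: single_def tw_homog sgn_mul_mult_r)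
    also have "\<dots> = (if m = i + j then sgn_mul D (int i * d * n) (a \<otimes> b) else \<zero>)"
    proof (cases "i \<le> m")
      case True
      then show ?thesis
        using finsum_singleton[of i "{..m}" "\<lambda>_. if m = i + j then sgn_mul D (int i * d * n) (a \<otimes> b) else \<zero>"] assms b
        by simp
    next
      case False
      then have "(\<Oplus>k\<in>{..m}. if i = k then (if m = i + j then sgn_mul D (int i * d * n) (a \<otimes> b) else \<zero>) else \<zero>) = (\<Oplus>k\<in>{..m}. \<zero>)"
        by (intro finsum_cong') auto
      then show ?thesis using False by simp
    qed
    finally show ?thesis .
  qed
  then show ?thesis by (auto simp: E_mult E_zero single_def)
qed

text \<open>Distributivity reduces to three monomials with homogeneous coefficients of degrees
  \<open>k\<close>, \<open>l\<close>, \<open>n\<close>. Both bracketings then collect the sign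
  exponent \<open>i d l + i d n + j d n\<close>.\<close>

lemma E_mult_assoc:
  assumes "x \<in> carrier E" "y \<in> carrier E" "z \<in> carrier E"
  shows "x \<otimes>\<^bsub>E\<^esub> y \<otimes>\<^bsub>E\<^esub> z = x \<otimes>\<^bsub>E\<^esub> (y \<otimes>\<^bsub>E\<^esub> z)"
  using assms(1)
proof (induction rule: E_induct)
  case (single i k a)
  note i = single
  have ac: "a \<in> carrier D" using i by blast
  from assms(2) show ?case
  proof (induction rule: E_induct)
    case (single j l b)
    note j = single
    have bc: "b \<in> carrier D" using j by blast
    from assms(3) show ?case
    proof (induction rule: E_induct)
      case (single m n c)
      have cc: "c \<in> carrier D" using single by blast
      have bcm: "sgn_mul D (int j * d * n) (b \<otimes> c) \<in> homog D (l + n)"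
        using j single by blast
      show ?case
      proof (cases "i + j + m \<in> pw d")
        case True
        have "i + j \<in> pw d" "j + m \<in> pw d" by (rule pw_down[OF True]; simp)+
        moreover have "sgn_mul D (int (i + j) * d * n + int i * d * l) (a \<otimes> b \<otimes> c) =
            sgn_mul D (int i * d * (l + n) + int j * d * n) (a \<otimes> b \<otimes> c)"
          by (simp add: algebra_simps)
        ultimately show ?thesis using i j single True ac bc cc
          by (simp add: single_mult[OF _ _ _ j(2)] single_mult[OF _ _ _ single(2)] single_mult[OF _ _ _ bcm]
              sgn_mul_mult_l sgn_mul_mult_r sgn_mul_sgn_mul m_assoc add.assoc del: of_nat_add)
      next
        \<comment> \<open>On each side either a partial product already vanishes or the last
          multiplication leaves the admissible exponents.\<close>
        case False
        have 1: "single D i a \<otimes>\<^bsub>E\<^esub> single D j b \<otimes>\<^bsub>E\<^esub> single D m c = \<zero>\<^bsub>E\<^esub>"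
          using i j single ac bc cc False
          by (simp add: single_mult[OF _ _ _ j(2)] single_mult[OF _ _ _ single(2)])
        have 2: "single D i a \<otimes>\<^bsub>E\<^esub> (single D j b \<otimes>\<^bsub>E\<^esub> single D m c) = \<zero>\<^bsub>E\<^esub>"
          using i j single ac bc cc False
          by (simp add: single_mult[OF _ _ _ bcm] single_mult[OF _ _ _ single(2)] add.assoc)
        from 1 2 show ?thesis by simp
      qed
    next
      case (add x y)
      then show ?case using i j ac bc by (simp add: E_r_distr)
    qed
  next
    case (add x y)
    then show ?case using i ac assms(3) by (simp add: E_r_distr E_l_distr)
  qed
next
  case (add x y)
  then show ?case using assms(2,3) by (simp add: E_l_distr)
qed

lemma E_ring: "ring E"
proof (rule ringI[OF E_abelian])
  show "monoid E"
  proof (rule monoidI)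
    fix p assume "p \<in> carrier E"
    then show "\<one>\<^bsub>E\<^esub> \<otimes>\<^bsub>E\<^esub> p = p"
    proof (induction rule: E_induct)
      case (single i k c)
      then show ?case by (simp add: E_one single_mult sgn_mul_even)
    qed (simp add: E_r_distr E_one)
    from \<open>p \<in> carrier E\<close> show "p \<otimes>\<^bsub>E\<^esub> \<one>\<^bsub>E\<^esub> = p"
    proof (induction rule: E_induct)
      case (single i k c)
      then show ?case by (simp add: E_one single_mult[OF _ _ _ homog_one] sgn_mul_even)
    qed (simp add: E_l_distr E_one)
  qed (auto simp: E_one E_mult_assoc)
qed (auto simp: E_l_distr E_r_distr)

end

section \<open>Graded commutativity and the differential of the polynomial algebra\<close>

context adjoin_dga begin

lemma E_gcomm:
  assumes x: "x \<in> homog E m" and y: "y \<in> homog E n"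
  shows "x \<otimes>\<^bsub>E\<^esub> y = sgn_mul E (m * n) (y \<otimes>\<^bsub>E\<^esub> x)"
proof -
  have xc: "x \<in> carrier E" and yc: "y \<in> carrier E" using x y by (auto simp: E_homog)
  from xc show ?thesis
  proof (induction rule: E_coeff_induct)
    case (single i)
    note i = single
    define a where "a = x i"
    have a: "a \<in> homog D (m - int i * d)" "a \<in> carrier D" using x by (auto simp: E_homog a_def)
    from yc show ?case unfolding a_def[symmetric]
    proof (induction rule: E_coeff_induct)
      case (single j)
      define b where "b = y j"
      have b: "b \<in> homog D (n - int j * d)" "b \<in> carrier D" using y by (auto simp: E_homog b_def)
      show ?case unfolding b_def[symmetric]
      proof (cases "i + j \<in> pw d")
        case True
        \<comment> \<open>The signs on the two sides differ by the parity of \<open>i j d\<close>.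
          If it were odd, \<open>x\<close> would be an odd variable with \<open>i\<close> and
          \<open>j\<close> at least 1, and \<open>i + j\<close> would not be admissible.\<close>
        have ev: "even (int i * int j * d)"
        proof (rule ccontr)
          assume "odd (int i * int j * d)"
          then have "odd i" "odd j" "odd d" by auto
          then have "i \<ge> 1" "j \<ge> 1" by (auto elim: oddE)
          then show False using True \<open>odd d\<close> by (auto simp: pw_def)
        qed
        have 1: "single D i a \<otimes>\<^bsub>E\<^esub> single D j b = single D (i + j) (sgn_mul D (int i * d * (n - int j * d)) (a \<otimes> b))"
          using True i single a b by (simp add: single_mult[OF _ _ _ b(1)])
        have 2: "single D j b \<otimes>\<^bsub>E\<^esub> single D i a = single D (i + j) (sgn_mul D (int j * d * (m - int i * d)) (b \<otimes> a))"
          using True i single a b by (simp add: single_mult[OF _ _ _ a(1)] add.commute)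
        have 3: "a \<otimes> b = sgn_mul D ((m - int i * d) * (n - int j * d)) (b \<otimes> a)"
          by (rule gcomm[OF a(1) b(1)])
        have "sgn_mul D (int i * d * (n - int j * d) + (m - int i * d) * (n - int j * d)) (b \<otimes> a)
            = sgn_mul D (m * n + int j * d * (m - int i * d)) (b \<otimes> a)"
          using ev unfolding sgn_mul_def by (intro if_cong) (auto simp: algebra_simps)
        then show "single D i a \<otimes>\<^bsub>E\<^esub> single D j b = sgn_mul E (m * n) (single D j b \<otimes>\<^bsub>E\<^esub> single D i a)"
          unfolding 1 2 using True a b
          by (subst E_sgn_single) (simp_all add: 3 sgn_mul_sgn_mul)
      next
        case False
        then show "single D i a \<otimes>\<^bsub>E\<^esub> single D j b = sgn_mul E (m * n) (single D j b \<otimes>\<^bsub>E\<^esub> single D i a)"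
          using i single a b by (simp add: single_mult[OF _ _ _ b(1)] single_mult[OF _ _ _ a(1)] add.commute E_sgn_single flip: single_zero[of 0])
      qed
    next
      case (add u v)
      then show ?case using i a by (simp add: E_r_distr E_l_distr E_sgn_add)
    qed
  next
    case (add u v)
    then show ?case using yc by (simp add: E_r_distr E_l_distr E_sgn_add)
  qed
qed

abbreviation dE where "dE \<equiv> differential E"

lemma dE_closed [simp]: "p \<in> carrier E \<Longrightarrow> dE p \<in> carrier E"
proof -
  assume p: "p \<in> carrier E"
  obtain N where "\<forall>i>N. p i = \<zero>" using p by (auto simp: E_carrier)
  then have "\<forall>i>N. dE p i = \<zero>" by (auto simp: E_diff)
  moreover have "dE p i \<in> carrier D" for i using p by (auto simp: E_diff)
  moreover have "dE p i = \<zero>" if "i \<notin> pw d" for i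
  proof -
    have "Suc i \<notin> pw d" using that pw_down[of "Suc i" d i] by auto
    then show ?thesis using that p by (auto simp: E_diff E_carrier)
  qed
  ultimately show ?thesis unfolding E_carrier by blast
qed

lemma dE_add: "p \<in> carrier E \<Longrightarrow> q \<in> carrier E \<Longrightarrow> dE (p \<oplus>\<^bsub>E\<^esub> q) = dE p \<oplus>\<^bsub>E\<^esub> dE q"
  by (auto simp: E_diff E_add d_add par_add l_distr smult_r_distr a_ac intro!: ext)

lemma dE_smult: "p \<in> carrier E \<Longrightarrow> dE (c \<odot>\<^bsub>E\<^esub> p) = c \<odot>\<^bsub>E\<^esub> dE p"
  by (auto simp: E_diff E_smult d_smult par_smult smult_mult_l smult_r_distr mult.commute simp flip: smult_assoc1 intro!: ext)

lemma dE_zero [simp]: "dE \<zero>\<^bsub>E\<^esub> = \<zero>\<^bsub>E\<^esub>"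
  by (auto simp: E_diff E_zero)

lemma dE_homog: "p \<in> homog E n \<Longrightarrow> dE p \<in> homog E (n + 1)"
proof -
  assume p: "p \<in> homog E n"
  have "dE p i \<in> homog D (n + 1 - int i * d)" for i
  proof -
    have "p i \<in> homog D (n - int i * d)" "p (Suc i) \<in> homog D (n - int (Suc i) * d)"
      using p unfolding E_homog by blast+
    then have "\<delta> (p i) \<in> homog D (n - int i * d + 1)" "par D (p (Suc i)) \<otimes> P \<in> homog D (n - int (Suc i) * d + (d + 1))"
      using P by blast+
    then have "\<delta> (p i) \<in> homog D (n + 1 - int i * d)" "par D (p (Suc i)) \<otimes> P \<in> homog D (n + 1 - int i * d)"
      by (simp_all add: algebra_simps)
    then show ?thesis unfolding E_diff by blast
  qed
  then show ?thesis using p by (simp add: E_homog)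
qed

lemma dE_single_0: "c \<in> carrier D \<Longrightarrow> dE (single D 0 c) = single D 0 (\<delta> c)"
  by (auto simp: E_diff single_def intro!: ext)

text \<open>The Leibniz rule for \<open>c x^(i+1)\<close> with \<open>P\<close> written to the left
  of \<open>x^i\<close>. For even \<open>d\<close> the variable commutes with everything, which
  gives the factor \<open>i+1\<close>; for odd \<open>d\<close> only \<open>i = 0\<close> is an
  admissible case.\<close>

lemma dE_single_Suc: "c \<in> homog D k \<Longrightarrow> dE (single D (Suc i) c) =
    single D (Suc i) (\<delta> c) \<oplus>\<^bsub>E\<^esub> single D i (of_nat (Suc i) \<odot> (sgn_mul D k (c \<otimes> P)))"
  by (auto simp: E_diff single_def E_add par_homog sgn_mul_mult_l homog_carrier intro!: ext)

lemma Pcomm: "c \<in> homog D k \<Longrightarrow> P \<otimes> c = sgn_mul D ((d + 1) * k) (c \<otimes> P)"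
  using gcomm[OF P] by blast

text \<open>As \<open>P\<close> is a cocycle, the two terms containing
  \<open>\<delta> c \<otimes> P\<close> carry the opposite signs \<open>k + 1\<close> and
  \<open>k\<close>. A term with \<open>P \<otimes> P\<close> needs an exponent at least 2, hence
  even \<open>d\<close>, and then \<open>P\<close> is odd with square zero.\<close>

lemma dE_dE: "p \<in> carrier E \<Longrightarrow> dE (dE p) = \<zero>\<^bsub>E\<^esub>"
proof (induction rule: E_induct)
  case (single i k c)
  have c: "c \<in> carrier D" "\<delta> c \<in> homog D (k + 1)" "\<delta> c \<in> carrier D" "c \<otimes> P \<in> homog D (k + (d + 1))"
    using single P by blast+
  have dcP: "\<delta> (c \<otimes> P) = \<delta> c \<otimes> P"
    using leibniz[OF single(2) Pc] c by (simp add: dP)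
  show ?case
  proof (cases i)
    case 0
    then show ?thesis using c by (simp add: dE_single_0 d_d single_zero)
  next
    case (Suc j)
    let ?n = "of_nat (Suc j) :: 'k"
    define w where "w = ?n \<odot> sgn_mul D k (c \<otimes> P)"
    have jw: "j \<in> pw d" using pw_down[OF single(1), of j] Suc by simp
    have w: "w \<in> homog D (k + (d + 1))" "w \<in> carrier D" unfolding w_def using c by blast+
    have dw: "\<delta> w = ?n \<odot> sgn_mul D k (\<delta> c \<otimes> P)"
      unfolding w_def using c by (simp add: d_smult d_sgn_mul dcP)
    have "dE (dE (single D i c)) = dE (single D i (\<delta> c)) \<oplus>\<^bsub>E\<^esub> dE (single D j w)"
      unfolding Suc dE_single_Suc[OF single(2)] w_def[symmetric] using single jw w c Suc by (intro dE_add) auto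
    also have "dE (single D i (\<delta> c)) = single D j (?n \<odot> sgn_mul D (k + 1) (\<delta> c \<otimes> P))"
      using c jw single by (simp only: Suc dE_single_Suc[OF c(2)]) (simp add: d_d single_zero)
    also have "dE (single D j w) = single D j (?n \<odot> sgn_mul D k (\<delta> c \<otimes> P))"
    proof (cases j)
      case 0
      then show ?thesis using w dw by (simp add: dE_single_0)
    next
      case (Suc l)
      have "even d" using single(1) \<open>i = Suc j\<close> Suc by (auto simp: pw_def)
      then have "P \<otimes> P = \<zero>" using odd_square_zero[OF P] by simp
      then have "w \<otimes> P = \<zero>" unfolding w_def using c by (simp add: smult_mult_l sgn_mul_mult_l m_assoc)
      moreover have "l \<in> pw d" using pw_down[OF jw, of l] Suc by simp
      ultimately show ?thesis
        using w dw jw c by (simp only: Suc dE_single_Suc[OF w(1)]) (simp add: single_zero)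
    qed
    also have "single D j (?n \<odot> sgn_mul D (k + 1) (\<delta> c \<otimes> P)) \<oplus>\<^bsub>E\<^esub> single D j (?n \<odot> sgn_mul D k (\<delta> c \<otimes> P)) = \<zero>\<^bsub>E\<^esub>"
      using c jw by (simp add: single_zero sgn_mul_def smult_minus l_neg r_neg flip: single_add)
    finally show ?thesis .
  qed
next
  case (add x y)
  then show ?case by (simp add: dE_add)
qed

lemma single_mult_any:
  assumes "i \<in> pw d" "j \<in> pw d" "a \<in> carrier D" "b \<in> homog D n" "i + j = l"
  shows "single D i a \<otimes>\<^bsub>E\<^esub> single D j b =
    (if l \<in> pw d then single D l (sgn_mul D (int i * d * n) (a \<otimes> b)) else \<zero>\<^bsub>E\<^esub>)"
  using single_mult[OF assms(1-4)] assms(5) by simp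

text \<open>Apart from one exceptional product, the rule on monomials amounts to counting: the
  \<open>i + j\<close> terms with \<open>P\<close> on the left are \<open>i\<close> from the first
  factor and \<open>j\<close> from the second.\<close>

lemma E_leibniz_single:
  assumes i: "i \<in> pw d" and j: "j \<in> pw d" and a: "a \<in> homog D k" and b: "b \<in> homog D k'"
  shows "dE (single D i a \<otimes>\<^bsub>E\<^esub> single D j b) =
     (dE (single D i a) \<otimes>\<^bsub>E\<^esub> single D j b) \<oplus>\<^bsub>E\<^esub> sgn_mul E (k + int i * d) (single D i a \<otimes>\<^bsub>E\<^esub> dE (single D j b))"
proof -
  let ?s = "sgn_mul D" and ?e = "int i * d * k'"
  have ac: "a \<in> carrier D" "b \<in> carrier D" "\<delta> a \<in> homog D (k + 1)" "\<delta> b \<in> homog D (k' + 1)" "a \<otimes> b \<in> homog D (k + k')"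
    using a b by blast+
  have aPb: "a \<otimes> P \<otimes> b = ?s ((d + 1) * k') (a \<otimes> b \<otimes> P)"
    using ac by (simp add: m_assoc Pcomm[OF b] sgn_mul_mult_r)
  have w: "?s ?e (a \<otimes> b) \<in> homog D (k + k')" using ac by blast
  have dab: "\<delta> (a \<otimes> b) = \<delta> a \<otimes> b \<oplus> ?s k (a \<otimes> \<delta> b)" by (rule leibniz[OF a ac(2)])
  have bP: "b \<otimes> P \<in> homog D (k' + (d + 1))" using b P by blast
  have aP: "a \<otimes> P \<in> homog D (k + (d + 1))" using a P by blast
  show ?thesis
  proof (cases "i + j \<in> pw d")
    case True
    \<comment> \<open>\<open>L\<close>, \<open>R\<close> and \<open>V\<close> hold the terms with
      the differential of \<open>a\<close>, with that of \<open>b\<close>, and with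
      \<open>P\<close>, each in its common normal form.\<close>
    define L where "L = single D (i + j) (?s ?e (\<delta> a \<otimes> b))"
    define R where "R = single D (i + j) (?s (?e + k) (a \<otimes> \<delta> b))"
    \<comment> \<open>For \<open>i + j = 0\<close> the exponent \<open>i + j - 1\<close> is cut off
      at 0; \<open>V\<close> then appears only with coefficient 0.\<close>
    define V where "V = single D (i + j - 1) (?s (?e + k + k') (a \<otimes> b \<otimes> P))"
    have c: "L \<in> carrier E" "R \<in> carrier E" "V \<in> carrier E"
      unfolding L_def R_def V_def using True pw_down[OF True, of "i + j - 1"] ac by (auto intro!: single_closed)
    have V: "dE (single D (i + j) (?s ?e (a \<otimes> b))) = L \<oplus>\<^bsub>E\<^esub> R \<oplus>\<^bsub>E\<^esub> (of_nat (i + j) \<odot>\<^bsub>E\<^esub> V)"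
    proof -
      have 1: "single D (i + j) (\<delta> (?s ?e (a \<otimes> b))) = L \<oplus>\<^bsub>E\<^esub> R"
        using ac unfolding L_def R_def by (simp add: d_sgn_mul dab sgn_mul_add sgn_mul_sgn_mul flip: single_add)
      show ?thesis
      proof (cases "i + j")
        case 0
        then show ?thesis using 1 ac c by (simp add: dE_single_0 E_smult E_zero[symmetric])
      next
        case (Suc l)
        have "dE (single D (i + j) (?s ?e (a \<otimes> b))) = single D (i + j) (\<delta> (?s ?e (a \<otimes> b))) \<oplus>\<^bsub>E\<^esub>
             single D l (of_nat (Suc l) \<odot> (?s (k + k') (?s ?e (a \<otimes> b) \<otimes> P)))"
          unfolding Suc by (rule dE_single_Suc[OF w])
        also have "?s (k + k') (?s ?e (a \<otimes> b) \<otimes> P) = ?s (?e + k + k') (a \<otimes> b \<otimes> P)"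
          using ac by (simp add: sgn_mul_mult_l sgn_mul_sgn_mul algebra_simps)
        finally show ?thesis using 1[unfolded Suc] by (simp only: V_def Suc single_smult diff_Suc_1)
      qed
    qed
    have A: "dE (single D i a) \<otimes>\<^bsub>E\<^esub> single D j b = L \<oplus>\<^bsub>E\<^esub> (of_nat i \<odot>\<^bsub>E\<^esub> V)"
    proof (cases i)
      case 0
      then show ?thesis using ac b j c True
        by (simp add: dE_single_0 single_mult_any[OF _ _ _ b] L_def E_smult E_zero[symmetric])
    next
      case (Suc l)
      have lw: "l \<in> pw d" "l + j \<in> pw d" using pw_down[OF True, of "l + j"] pw_down[OF i, of l] Suc by auto
      have "dE (single D i a) \<otimes>\<^bsub>E\<^esub> single D j b =
         single D i (\<delta> a) \<otimes>\<^bsub>E\<^esub> single D j b \<oplus>\<^bsub>E\<^esub> single D l (of_nat i \<odot> ?s k (a \<otimes> P)) \<otimes>\<^bsub>E\<^esub> single D j b"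
        unfolding Suc dE_single_Suc[OF a] using ac lw i j Suc by (intro E_l_distr) auto
      also have "single D i (\<delta> a) \<otimes>\<^bsub>E\<^esub> single D j b = L"
        using i j ac True by (simp add: single_mult[OF _ _ _ b] L_def)
      also have "single D l (of_nat i \<odot> ?s k (a \<otimes> P)) \<otimes>\<^bsub>E\<^esub> single D j b =
          single D (l + j) (?s (int l * d * k') ((of_nat i \<odot> ?s k (a \<otimes> P)) \<otimes> b))"
        using lw j ac by (simp add: single_mult[OF _ _ _ b])
      also have "?s (int l * d * k') ((of_nat i \<odot> ?s k (a \<otimes> P)) \<otimes> b) = 
          of_nat i \<odot> ?s (int l * d * k' + k + (d + 1) * k') (a \<otimes> b \<otimes> P)"
        using ac by (simp add: smult_mult_l sgn_mul_mult_l aPb sgn_mul_sgn_mul add.assoc flip: sgn_mul_smult)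
      also have "int l * d * k' + k + (d + 1) * k' = ?e + k + k'"
        using Suc by (simp add: algebra_simps)
      finally show ?thesis unfolding V_def using Suc by (simp only: single_smult diff_Suc_1 add_Suc)
    qed
    have B: "sgn_mul E (k + int i * d) (single D i a \<otimes>\<^bsub>E\<^esub> dE (single D j b)) = R \<oplus>\<^bsub>E\<^esub> (of_nat j \<odot>\<^bsub>E\<^esub> V)"
    proof -
      have R: "sgn_mul E (k + int i * d) (single D i a \<otimes>\<^bsub>E\<^esub> single D j (\<delta> b)) = R"
      proof -
        have "sgn_mul E (k + int i * d) (single D i a \<otimes>\<^bsub>E\<^esub> single D j (\<delta> b)) = 
            single D (i + j) (?s (k + int i * d + int i * d * (k' + 1)) (a \<otimes> \<delta> b))"
          using i j ac True by (simp add: single_mult[OF _ _ _ ac(4)] E_sgn_single sgn_mul_sgn_mul)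
        also have "?s (k + int i * d + int i * d * (k' + 1)) (a \<otimes> \<delta> b) = ?s (?e + k) (a \<otimes> \<delta> b)"
          unfolding sgn_mul_def by (intro if_cong) (auto simp: algebra_simps)
        finally show ?thesis by (simp add: R_def)
      qed
      show ?thesis
      proof (cases j)
        case 0
        then show ?thesis using R c ac by (simp add: dE_single_0 E_smult E_zero[symmetric])
      next
        case (Suc l)
        have lw: "l \<in> pw d" "i + l \<in> pw d" using pw_down[OF True, of "i + l"] pw_down[OF j, of l] Suc by auto
        \<comment> \<open>Here \<open>j\<close> is positive and \<open>i + j\<close> admissible, so
          an odd \<open>d\<close> forces \<open>i = 0\<close>. Hence moving \<open>x^i\<close> past
          anything costs no sign.\<close>
        have ev: "even (int i * d)" using True Suc by (auto simp: pw_def)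
        have wb: "of_nat j \<odot> ?s k' (b \<otimes> P) \<in> homog D (k' + (d + 1))" using bP by blast
        have "single D i a \<otimes>\<^bsub>E\<^esub> dE (single D j b) =
           single D i a \<otimes>\<^bsub>E\<^esub> single D j (\<delta> b) \<oplus>\<^bsub>E\<^esub> single D i a \<otimes>\<^bsub>E\<^esub> single D l (of_nat j \<odot> ?s k' (b \<otimes> P))"
          unfolding Suc dE_single_Suc[OF b] using ac lw i j Suc by (intro E_r_distr) auto
        then have "sgn_mul E (k + int i * d) (single D i a \<otimes>\<^bsub>E\<^esub> dE (single D j b)) =
           R \<oplus>\<^bsub>E\<^esub> sgn_mul E (k + int i * d) (single D i a \<otimes>\<^bsub>E\<^esub> single D l (of_nat j \<odot> ?s k' (b \<otimes> P)))"
          using ac lw i j by (simp add: E_sgn_add R)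
        also have "single D i a \<otimes>\<^bsub>E\<^esub> single D l (of_nat j \<odot> ?s k' (b \<otimes> P)) =
            single D (i + l) (?s (int i * d * (k' + (d + 1))) (a \<otimes> (of_nat j \<odot> ?s k' (b \<otimes> P))))"
          using lw i ac by (simp add: single_mult[OF _ _ _ wb])
        also have "sgn_mul E (k + int i * d) \<dots> = single D (i + l) (of_nat j \<odot> ?s (k + int i * d + int i * d * (k' + (d + 1)) + k') (a \<otimes> b \<otimes> P))"
          using lw ac by (subst E_sgn_single) (simp_all add: smult_mult_r sgn_mul_mult_r m_assoc sgn_mul_sgn_mul add.assoc flip: sgn_mul_smult)
        also have "?s (k + int i * d + int i * d * (k' + (d + 1)) + k') (a \<otimes> b \<otimes> P) = ?s (?e + k + k') (a \<otimes> b \<otimes> P)"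
          using ev unfolding sgn_mul_def by (intro if_cong) (auto simp: algebra_simps)
        finally show ?thesis unfolding V_def using Suc by (simp only: single_smult diff_Suc_1 add_Suc_right)
      qed
    qed
    have S: "of_nat n \<odot>\<^bsub>E\<^esub> V \<in> carrier E" for n
    proof -
      obtain N where "\<forall>i>N. V i = \<zero>" using c(3) by (auto simp: E_carrier)
      then have "\<forall>i>N. (of_nat n \<odot>\<^bsub>E\<^esub> V) i = \<zero>" by (simp add: E_smult)
      then show ?thesis using c(3) unfolding E_carrier by (auto simp: E_smult)
    qed
    have "of_nat (i + j) \<odot>\<^bsub>E\<^esub> V = of_nat i \<odot>\<^bsub>E\<^esub> V \<oplus>\<^bsub>E\<^esub> (of_nat j \<odot>\<^bsub>E\<^esub> V)"
      using c(3) by (simp add: E_smult E_add smult_l_distr)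
    then show ?thesis using True i j ac A B V c S
      by (simp add: single_mult[OF _ _ _ b] EA.a_ac)
  next
    case False
    \<comment> \<open>The exceptional product \<open>x x\<close> of an odd variable: the left side
      is zero, and the two terms with \<open>P\<close> on the right have opposite signs.\<close>
    have od: "odd d" "i = Suc 0" "j = Suc 0"
      using False i j by (auto simp: pw_def split: if_splits)
    have w0: "Suc (Suc 0) \<notin> pw d" using od by (simp add: pw_def)
    have z: "single D i a \<otimes>\<^bsub>E\<^esub> single D j b = \<zero>\<^bsub>E\<^esub>"
      using False i j ac by (simp add: single_mult[OF _ _ _ b])
    have A: "dE (single D i a) \<otimes>\<^bsub>E\<^esub> single D j b = single D 1 (?s k (a \<otimes> P \<otimes> b))"
    proof -
      have "dE (single D i a) \<otimes>\<^bsub>E\<^esub> single D j b = single D i (\<delta> a) \<otimes>\<^bsub>E\<^esub> single D j b \<oplus>\<^bsub>E\<^esub> single D 0 (of_nat (Suc 0) \<odot> ?s k (a \<otimes> P)) \<otimes>\<^bsub>E\<^esub> single D j b"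
        unfolding od(2) dE_single_Suc[OF a] using ac i j od by (intro E_l_distr) auto
      then show ?thesis using ac od w0
        by (simp add: single_mult[OF _ _ _ b] sgn_mul_mult_l sgn_mul_even)
    qed
    have B: "single D i a \<otimes>\<^bsub>E\<^esub> dE (single D j b) = single D 1 (?s (d * (k' + (d + 1)) + k') (a \<otimes> b \<otimes> P))"
    proof -
      have wb: "?s k' (b \<otimes> P) \<in> homog D (k' + (d + 1))" using bP by blast
      have "single D i a \<otimes>\<^bsub>E\<^esub> dE (single D j b) = single D i a \<otimes>\<^bsub>E\<^esub> single D j (\<delta> b) \<oplus>\<^bsub>E\<^esub> single D i a \<otimes>\<^bsub>E\<^esub> single D 0 (of_nat (Suc 0) \<odot> ?s k' (b \<otimes> P))"
        unfolding od(3) dE_single_Suc[OF b] using ac i j od by (intro E_r_distr) auto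
      then show ?thesis using ac od w0
        by (simp add: single_mult[OF _ _ _ wb] single_mult[OF _ _ _ ac(4)] sgn_mul_mult_r sgn_mul_sgn_mul m_assoc)
    qed
    have "?s (k + (d + 1) * k') (a \<otimes> b \<otimes> P) \<oplus> ?s (k + d + (d * (k' + (d + 1)) + k')) (a \<otimes> b \<otimes> P) = \<zero>"
      using od(1) ac unfolding sgn_mul_def by (auto simp: l_neg r_neg)
    then have "single D 1 (?s k (a \<otimes> P \<otimes> b)) \<oplus>\<^bsub>E\<^esub> sgn_mul E (k + int i * d) (single D 1 (?s (d * (k' + (d + 1)) + k') (a \<otimes> b \<otimes> P))) = \<zero>\<^bsub>E\<^esub>"
      using ac od(2) by (simp add: E_sgn_single aPb sgn_mul_sgn_mul single_zero flip: single_add)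
    then show ?thesis unfolding z A B by simp
  qed
qed

lemma E_leibniz:
  assumes x: "x \<in> homog E m" and y: "y \<in> carrier E"
  shows "dE (x \<otimes>\<^bsub>E\<^esub> y) = (dE x \<otimes>\<^bsub>E\<^esub> y) \<oplus>\<^bsub>E\<^esub> sgn_mul E m (x \<otimes>\<^bsub>E\<^esub> dE y)"
proof -
  have xc: "x \<in> carrier E" using x by (simp add: E_homog)
  then show ?thesis
  proof (induction rule: E_coeff_induct)
    case (single i)
    note i = single
    have a: "x i \<in> homog D (m - int i * d)" "x i \<in> carrier D" using x by (auto simp: E_homog)
    from y show ?case
    proof (induction rule: E_induct)
      case (single j k b)
      then show ?case using E_leibniz_single[OF i single(1) a(1) single(2)] by simp
    next
      case (add u v)
      then show ?case using i a by (simp add: E_r_distr dE_add E_sgn_add EA.a_ac)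
    qed
  next
    case (add u v)
    then show ?case using y by (simp add: E_l_distr dE_add E_sgn_add EA.a_ac)
  qed
qed

lemma E_dga: "is_dga E"
\<comment> \<open>The component of degree \<open>n\<close> takes from the coefficient of
  \<open>x^i\<close> its part of degree \<open>n - i d\<close>.\<close>
proof (rule is_dgaI[OF E_ring, where \<kappa> = "\<lambda>n p i. hcomp D (n - int i * d) (p i)"])
  have E_smult_closed: "c \<odot>\<^bsub>E\<^esub> p \<in> carrier E" if "p \<in> carrier E" for c p
    using that by (fastforce simp: E_carrier E_smult)
  fix c :: 'k and p q assume p: "p \<in> carrier E"
  show "c \<odot>\<^bsub>E\<^esub> p \<in> carrier E" using p by (rule E_smult_closed)
  show "1 \<odot>\<^bsub>E\<^esub> p = p" using p by (simp add: E_smult)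
  show "(c + e) \<odot>\<^bsub>E\<^esub> p = c \<odot>\<^bsub>E\<^esub> p \<oplus>\<^bsub>E\<^esub> e \<odot>\<^bsub>E\<^esub> p" for e using p by (simp add: E_smult E_add smult_l_distr)
  show "(c * e) \<odot>\<^bsub>E\<^esub> p = c \<odot>\<^bsub>E\<^esub> (e \<odot>\<^bsub>E\<^esub> p)" for e using p by (simp add: E_smult smult_assoc1)
  show "dE (c \<odot>\<^bsub>E\<^esub> p) = c \<odot>\<^bsub>E\<^esub> dE p" by (rule dE_smult[OF p])
  show "dE (dE p) = \<zero>\<^bsub>E\<^esub>" by (rule dE_dE[OF p])
  assume q: "q \<in> carrier E"
  show "c \<odot>\<^bsub>E\<^esub> (p \<oplus>\<^bsub>E\<^esub> q) = c \<odot>\<^bsub>E\<^esub> p \<oplus>\<^bsub>E\<^esub> c \<odot>\<^bsub>E\<^esub> q" using p q by (simp add: E_smult E_add smult_r_distr)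
  show "dE (p \<oplus>\<^bsub>E\<^esub> q) = dE p \<oplus>\<^bsub>E\<^esub> dE q" by (rule dE_add[OF p q])
  have sf: "c \<odot> finsum D f J = finsum D (\<lambda>i. c \<odot> f i) J" if "f \<in> J \<rightarrow> carrier D" for f and J :: "nat set"
    by (rule add_map_finsum[OF abelian_group_axioms abelian_group_axioms asub_carrier])
      (use that in \<open>auto simp: add_map_def smult_r_distr\<close>)
  have f: "(\<lambda>k. p k \<otimes> tw D (int k * d) (q (n - k))) \<in> {..n} \<rightarrow> carrier D" for n using p q by auto
  show "c \<odot>\<^bsub>E\<^esub> p \<otimes>\<^bsub>E\<^esub> q = c \<odot>\<^bsub>E\<^esub> (p \<otimes>\<^bsub>E\<^esub> q)"
    using p q by (auto simp: E_mult E_smult sf[OF f] smult_mult_l intro!: ext finsum_cong')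
  show "p \<otimes>\<^bsub>E\<^esub> (c \<odot>\<^bsub>E\<^esub> q) = c \<odot>\<^bsub>E\<^esub> (p \<otimes>\<^bsub>E\<^esub> q)"
    using p q by (auto simp: E_mult E_smult sf[OF f] tw_smult smult_mult_r intro!: ext finsum_cong')
next
  show "homog E n \<subseteq> carrier E" for n by (auto simp: E_homog)
  show "\<zero>\<^bsub>E\<^esub> \<in> homog E n" for n by (auto simp: E_homog E_zero E_carrier)
  show "\<one>\<^bsub>E\<^esub> \<in> homog E 0" using single_homog[OF pw_0 homog_one] by (simp add: E_one)
  show "p \<oplus>\<^bsub>E\<^esub> q \<in> homog E n" if "p \<in> homog E n" "q \<in> homog E n" for n p q
    using that E_add_closed by (auto simp: E_homog E_add)
  show "c \<odot>\<^bsub>E\<^esub> p \<in> homog E n" if "p \<in> homog E n" for n c p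
    using that by (fastforce simp: E_homog E_smult E_carrier)
  show "add_map E E (carrier E) (\<lambda>p i. hcomp D (n - int i * d) (p i))" for n
  proof (rule add_mapI)
    fix p assume p: "p \<in> carrier E"
    then have "\<forall>i. i \<notin> pw d \<longrightarrow> hcomp D (n - int i * d) (p i) = \<zero>"
      using hcomp_homog[OF homog_zero] by (auto simp: E_carrier)
    moreover obtain N where "\<forall>i>N. p i = \<zero>" using p by (auto simp: E_carrier)
    then have "\<forall>i>N. hcomp D (n - int i * d) (p i) = \<zero>" using hcomp_homog[OF homog_zero] by auto
    ultimately show "(\<lambda>i. hcomp D (n - int i * d) (p i)) \<in> carrier E"
      using p unfolding E_carrier by auto
    fix q assume "q \<in> carrier E"
    with p show "(\<lambda>i. hcomp D (n - int i * d) ((p \<oplus>\<^bsub>E\<^esub> q) i)) = (\<lambda>i. hcomp D (n - int i * d) (p i)) \<oplus>\<^bsub>E\<^esub> (\<lambda>i. hcomp D (n - int i * d) (q i))"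
      by (auto simp: E_add hcomp_add intro!: ext)
  qed
  show "(\<lambda>i. hcomp D (n - int i * d) (p i)) = (if n = m then p else \<zero>\<^bsub>E\<^esub>)" if "p \<in> homog E m" for n m p
  proof -
    have "p i \<in> homog D (m - int i * d)" for i using that by (simp add: E_homog)
    note h = hcomp_homog[OF this]
    show ?thesis by (auto simp: h E_zero intro!: ext)
  qed
  show "carrier E \<subseteq> aspan E (\<Union>n. homog E n)"
  proof
    have sub: "(\<Union>n. homog E n) \<subseteq> carrier E" by (auto simp: E_homog)
    fix p assume "p \<in> carrier E"
    then show "p \<in> aspan E (\<Union>n. homog E n)"
    proof (induction rule: E_induct)
      case (single i k c)
      then show ?case using EA.aspan_base[OF _ sub] single_homog by blast
    next
      case (add x y)
      then show ?case using EA.aspan_add[OF sub] by blast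
    qed
  qed
  show "dE p \<in> homog E (n + 1)" if "p \<in> homog E n" for n p by (rule dE_homog[OF that])
  show "p \<otimes>\<^bsub>E\<^esub> q \<in> homog E (m + n)" if "p \<in> homog E m" "q \<in> homog E n" for m n p q
  proof -
    have pq: "p \<in> carrier E" "q \<in> carrier E" using that by (simp_all add: E_homog)
    have "(p \<otimes>\<^bsub>E\<^esub> q) l \<in> homog D (m + n - int l * d)" for l
    proof (cases "l \<in> pw d")
      case True
      have "p k \<otimes> tw D (int k * d) (q (l - k)) \<in> homog D (m + n - int l * d)" if "k \<le> l" for k
      proof -
        have "p k \<in> homog D (m - int k * d)" "q (l - k) \<in> homog D (n - int (l - k) * d)"
          using \<open>p \<in> homog E m\<close> \<open>q \<in> homog E n\<close> unfolding E_homog by blast+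
        then have "p k \<otimes> tw D (int k * d) (q (l - k)) \<in> homog D ((m - int k * d) + (n - int (l - k) * d))"
          by (auto simp: tw_def)
        moreover have "(m - int k * d) + (n - int (l - k) * d) = m + n - int l * d"
          using that by (simp add: of_nat_diff algebra_simps)
        ultimately show ?thesis by simp
      qed
      then have "(\<Oplus>k\<in>{..l}. p k \<otimes> tw D (int k * d) (q (l - k))) \<in> homog D (m + n - int l * d)"
        by (intro asub_finsum[OF asub_homog]) simp
      then show ?thesis using True by (simp add: E_mult)
    qed (simp add: E_mult)
    then show ?thesis using pq by (simp add: E_homog)
  qed
  show "p \<otimes>\<^bsub>E\<^esub> q = sgn_mul E (m * n) (q \<otimes>\<^bsub>E\<^esub> p)" if "p \<in> homog E m" "q \<in> homog E n" for m n p q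
    by (rule E_gcomm[OF that])
  show "dE (p \<otimes>\<^bsub>E\<^esub> q) = dE p \<otimes>\<^bsub>E\<^esub> q \<oplus>\<^bsub>E\<^esub> sgn_mul E m (p \<otimes>\<^bsub>E\<^esub> dE q)" if "p \<in> homog E m" "q \<in> carrier E" for m p q
    by (rule E_leibniz[OF that])
qed

section \<open>The new variable and the basis of its powers\<close>

definition X where "X = single D 1 \<one>"

lemma X_homog: "X \<in> homog E d"
  using single_homog[OF pw_1(2) homog_one] by (simp add: X_def)

lemma dX: "dE X = single D 0 P"
  unfolding X_def One_nat_def dE_single_Suc[OF homog_one] by (simp add: single_zero sgn_mul_even)

lemma X_pow: "i \<in> pw d \<Longrightarrow> X [^]\<^bsub>E\<^esub> i = single D i \<one>"
proof (induction i)
  case 0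
  then show ?case by (simp add: E_one)
next
  case (Suc i)
  have "i \<in> pw d" by (rule pw_down[OF Suc(2)]) simp
  then show ?case using Suc by (simp add: X_def single_mult[OF _ _ _ homog_one] sgn_mul_even)
qed

lemma E_embed: "dga_hom D E (single D 0)"
  unfolding dga_hom_def
proof (intro conjI ballI allI funcsetI)
  fix x y assume x: "x \<in> carrier D" and "y \<in> carrier D"
  from this(2) show "single D 0 (x \<otimes> y) = single D 0 x \<otimes>\<^bsub>E\<^esub> single D 0 y"
  proof (induction rule: homog_induct)
    case (homog n y)
    then show ?case using single_mult[OF _ _ x homog(2), of 0 0] by (simp add: sgn_mul_even)
  next
    case (add y z)
    then show ?case using x by (simp add: r_distr single_add E_r_distr)
  qed
next
  fix n x assume "x \<in> homog D n"
  then show "single D 0 x \<in> homog E n" using single_homog[OF pw_0, of x n] by simp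
qed (auto simp: single_add single_smult E_one dE_single_0)

lemma E_basis:
  "fbasis D (carrier D) E (single D 0) (pw d) (\<lambda>i. X [^]\<^bsub>E\<^esub> i)"
  "fspan (carrier D) E (single D 0) (pw d) (\<lambda>i. X [^]\<^bsub>E\<^esub> i) = carrier E"
proof -
  have s: "single D 0 c \<otimes>\<^bsub>E\<^esub> X [^]\<^bsub>E\<^esub> i = single D i c" if "c \<in> carrier D" "i \<in> pw d" for c i
    using that by (simp add: X_pow single_mult[OF _ _ _ homog_one] sgn_mul_even)
  have e: "add_map D E (carrier D) (single D 0)" by (auto simp: add_map_def single_add)
  have Xc: "(\<lambda>i. X [^]\<^bsub>E\<^esub> i) \<in> pw d \<rightarrow> carrier E" by (simp add: X_pow)
  note F = fspan_props[OF abelian_group_axioms E_ring asub_carrier e Xc]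
  show sp: "fspan (carrier D) E (single D 0) (pw d) (\<lambda>i. X [^]\<^bsub>E\<^esub> i) = carrier E"
  proof
    show "carrier E \<subseteq> fspan (carrier D) E (single D 0) (pw d) (\<lambda>i. X [^]\<^bsub>E\<^esub> i)"
    proof
      fix p assume "p \<in> carrier E"
      then show "p \<in> fspan (carrier D) E (single D 0) (pw d) (\<lambda>i. X [^]\<^bsub>E\<^esub> i)"
      proof (induction rule: E_induct)
        case (single i k c)
        then show ?case using F(2)[of i c] s[of c i] by auto
      qed (rule asubD(3)[OF F(1)])
    qed
  qed (rule F(3))
  show "fbasis D (carrier D) E (single D 0) (pw d) (\<lambda>i. X [^]\<^bsub>E\<^esub> i)"
    by (rule fbasisI[OF asub_carrier e, where \<kappa> = "\<lambda>i p. p i"])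
      (use Xc s in \<open>auto simp: sp add_map_def E_add single_def\<close>)
qed

end

text \<open>\<open>enc\<close> moves the new algebra back to the type of \<open>C\<close>, so that variables can be adjoined repeatedly
  in an induction over one fixed type.\<close>
lemma adjoin_variable:
  fixes C :: "('k::field_char_0, 't) dga" and enc :: "(nat \<Rightarrow> 't) \<Rightarrow> 't"
  assumes C: "is_dga C" and P: "P \<in> homog C (d + 1)" "differential C P = \<zero>\<^bsub>C\<^esub>" and enc: "inj enc"
  shows "\<exists>(E :: ('k, 't) dga) \<iota> x. is_dga E \<and> dga_hom C E \<iota> \<and> x \<in> homog E d \<and> differential E x = \<iota> P \<and>
     fbasis C (carrier C) E \<iota> (pw d) (\<lambda>i. x [^]\<^bsub>E\<^esub> i) \<and> fspan (carrier C) E \<iota> (pw d) (\<lambda>i. x [^]\<^bsub>E\<^esub> i) = carrier E"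
proof -
  interpret adjoin_dga C d P by unfold_locales fact+
  have i: "inj_on enc (carrier E)" using enc by (rule inj_on_subset) simp
  define T where "T = transport enc E"
  note t = transport_dga[OF E_dga i, folded T_def]
  interpret E: dg_algebra E by unfold_locales (rule E_dga)
  interpret T: dg_algebra T by unfold_locales (rule t(1))
  note s = dga_hom_iff_shom[OF E_dga t(1), THEN iffD1, OF t(2)]
  note s1 = s[THEN conjunct1]
  have pow: "enc (X [^]\<^bsub>E\<^esub> i) = enc X [^]\<^bsub>T\<^esub> i" for i :: nat
    by (rule shom_zero(5)[OF E_dga t(1) E.gsub_carrier s1]) (use X_homog in blast)
  have mult: "\<And>x y. x \<in> carrier E \<Longrightarrow> y \<in> carrier E \<Longrightarrow> enc (x \<otimes>\<^bsub>E\<^esub> y) = enc x \<otimes>\<^bsub>T\<^esub> enc y"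
    by (rule shomD(3)[OF s1])
  have b: "fbasis C (carrier C) T (\<lambda>c. enc (single C 0 c)) (pw d) (\<lambda>i. enc X [^]\<^bsub>T\<^esub> i)"
    "fspan (carrier C) T (\<lambda>c. enc (single C 0 c)) (pw d) (\<lambda>i. enc X [^]\<^bsub>T\<^esub> i) = carrier T"
    unfolding pow[symmetric]
    by (rule fbasis_iso[OF abelian_group_axioms E.ring_axioms T.ring_axioms E_basis shomD(1)[OF s1] t(3)];
        simp only: mult)+
  have "dga_hom C T (\<lambda>c. enc (single C 0 c))"
    by (rule dga_hom_comp[OF E_embed t(2)])
  moreover have "enc X \<in> homog T d" using t(2) X_homog unfolding dga_hom_def by blast
  moreover have "differential T (enc X) = enc (single C 0 P)"
    using t(2) X_homog unfolding dga_hom_def dX[symmetric] by auto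
  ultimately show ?thesis using t(1) b by blast
qed

section \<open>Algebras generated by one element\<close>

context dg_algebra begin

text \<open>Because inadmissible powers vanish, formulas for products of powers can be stated for
  all exponents.\<close>

lemma pow_outside_pw: 
  assumes "x \<in> homog D d" "i \<notin> pw d" shows "x [^] i = \<zero>"
proof -
  have "odd d" "i \<ge> 2" using assms(2) by (auto simp: pw_def)
  then obtain j where "i = Suc (Suc j)" by (metis add_2_eq_Suc le_Suc_ex)
  then show ?thesis
    using odd_square_zero[OF assms(1) \<open>odd d\<close>] assms(1) by (simp add: m_assoc homog_carrier)
qed

lemma pow_comm:
  assumes "x \<in> homog D d" "y \<in> homog D k" shows "x [^] (i::nat) \<otimes> y = sgn_mul D (int i * d * k) (y \<otimes> x [^] i)"
  by (rule gcomm[OF homog_pow[OF assms(1)] assms(2)])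

end

text \<open>\<open>PS\<close> is the subalgebra generated by the image of \<open>S\<close> and
  \<open>x\<close>. Freeness is asked for only where maps are extended or bases shifted, so the
  locale also describes the target of such a map, where the image of \<open>x\<close> may satisfy
  relations.\<close>

locale pow_span = C: dg_algebra C + E: dg_algebra E
  for C :: "('k::field_char_0, 'c) dga" and E :: "('k, 'e) dga" (structure) +
  fixes S :: "'c set" and \<iota> :: "'c \<Rightarrow> 'e" and d :: int and x :: 'e
  assumes S: "gsub C S" and \<iota>: "shom C S E \<iota>" and x: "x \<in> homog E d"
begin

abbreviation PS where "PS \<equiv> fspan S E \<iota> (pw d) (\<lambda>i. x [^] i)"

lemma xc [simp]: "x \<in> carrier E" using x by blast

lemma \<iota>c [simp]: "s \<in> S \<Longrightarrow> \<iota> s \<in> carrier E" by (rule shomD(6)[OF \<iota>])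

lemma pow_c: "(\<lambda>i. x [^] i) \<in> pw d \<rightarrow> carrier E" by simp

lemmas S_simps = C.gsubD[OF S] and \<iota>_simps = shomD[OF \<iota>] shom_zero[OF C.dga E.dga S \<iota>]

lemmas PS_props = fspan_props[OF C.abelian_group_axioms E.ring_axioms S_simps(1) \<iota>_simps(1) pow_c]

lemma PS_carrier: "z \<in> PS \<Longrightarrow> z \<in> carrier E" using PS_props(3) by blast

lemma PS_induct [consumes 1, case_names gen add]:
  assumes z: "z \<in> PS" and g: "\<And>s k i. s \<in> S \<Longrightarrow> s \<in> homog C k \<Longrightarrow> i \<in> pw d \<Longrightarrow> Q (\<iota> s \<otimes> x [^] i)"
    and a: "\<And>u v. u \<in> PS \<Longrightarrow> v \<in> PS \<Longrightarrow> Q u \<Longrightarrow> Q v \<Longrightarrow> Q (u \<oplus> v)"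
  shows "Q z"
proof -
  have g': "Q (\<iota> s \<otimes> x [^] i)" if i: "i \<in> pw d" and s: "s \<in> S" for s i
    using S s
  proof (induction rule: C.gsub_induct)
    case (homog n y)
    then show ?case using g i by blast
  next
    case (add y z)
    then show ?case using a[OF PS_props(2)[OF i add(1)] PS_props(2)[OF i add(2)]] \<iota>_simps
      by (simp add: E.l_distr)
  qed
  have "Q z \<and> z \<in> PS" using z unfolding fspan_def
  proof (induction)
    case aspan_zero
    have "Q (\<iota> \<zero>\<^bsub>C\<^esub> \<otimes> x [^] (0::nat))" using g'[OF pw_0] S_simps by blast
    then show ?case using \<iota>_simps by (simp add: aspan.aspan_zero)
  next
    case (aspan_step h y)
    then obtain i s where h: "i \<in> pw d" "s \<in> S" "h = \<iota> s \<otimes> x [^] i" by (auto simp: dgen_def)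
    have "h \<in> PS" "Q h" using h PS_props(2) g' by auto
    moreover have "y \<in> PS" "Q y" using aspan_step by (simp_all add: fspan_def)
    ultimately have "Q (h \<oplus> y)" "h \<oplus> y \<in> PS" using a asubD(3)[OF PS_props(1)] by auto
    then show ?case by (simp add: fspan_def)
  qed
  then show ?thesis ..
qed

lemma gen_mult:
  assumes "s \<in> S" "t \<in> S" "t \<in> homog C k"
  shows "(\<iota> s \<otimes> x [^] i) \<otimes> (\<iota> t \<otimes> x [^] j) =
     sgn_mul E (int i * d * k) (\<iota> (s \<otimes>\<^bsub>C\<^esub> t) \<otimes> x [^] (i + j))"
proof -
  have t: "\<iota> t \<in> homog E k" using assms \<iota>_simps(5) by blast
  have "(\<iota> s \<otimes> x [^] i) \<otimes> (\<iota> t \<otimes> x [^] j) = \<iota> s \<otimes> (x [^] i \<otimes> \<iota> t) \<otimes> x [^] j"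
    using assms by (simp add: E.m_assoc)
  also have "\<dots> = sgn_mul E (int i * d * k) (\<iota> s \<otimes> \<iota> t \<otimes> (x [^] i \<otimes> x [^] j))"
    unfolding E.pow_comm[OF x t] using assms by (simp add: E.m_assoc E.sgn_mul_mult_l E.sgn_mul_mult_r)
  finally show ?thesis using assms \<iota>_simps(3) by (simp add: E.nat_pow_mult)
qed

lemma gen_homog: "s \<in> S \<Longrightarrow> s \<in> homog C k \<Longrightarrow> \<iota> s \<otimes> x [^] i \<in> homog E (k + int i * d)"
  using E.homog_mult[OF \<iota>_simps(5) E.homog_pow[OF x]] .

lemma gen_in: "s \<in> S \<Longrightarrow> \<iota> s \<otimes> x [^] (i::nat) \<in> PS"
proof (cases "i \<in> pw d")
  case False
  assume "s \<in> S"
  then show ?thesis using E.pow_outside_pw[OF x False] asubD(2)[OF PS_props(1)] by simp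
qed (rule PS_props(2))

lemma \<iota>_in: "s \<in> S \<Longrightarrow> \<iota> s \<in> PS"
  using gen_in[of s 0] by simp

lemma x_in: "x \<in> PS"
  using gen_in[OF S_simps(2), of 1] \<iota>_simps(2) by simp

text \<open>Products of generators return to the span by \<open>gen_mult\<close>; an exponent sum
  outside \<open>pw d\<close> is harmless by \<open>gen_in\<close>.\<close>

lemma PS_gsub: "gsub E PS"
  unfolding gsub_def
proof (intro conjI ballI allI)
  show "asub E PS" by (rule PS_props(1))
  show "\<one> \<in> PS" using \<iota>_in[OF S_simps(2)] \<iota>_simps(2) by simp
  note add = asubD(3)[OF PS_props(1)]
  fix z assume z: "z \<in> PS"
  show "c \<odot> z \<in> PS" for c using z
  proof (induction rule: PS_induct)
    case (gen s k i)
    then have "c \<odot> (\<iota> s \<otimes> x [^] i) = \<iota> (c \<odot>\<^bsub>C\<^esub> s) \<otimes> x [^] i" by (simp add: \<iota>_simps(4) E.smult_mult_l)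
    then show ?case using gen_in S_simps(4) gen by simp
  qed (simp add: E.smult_r_distr PS_carrier add)
  show "hcomp E n z \<in> PS" for n using z
  proof (induction rule: PS_induct)
    case (gen s k i)
    show ?case using E.hcomp_homog[OF gen_homog[OF gen(1,2)]] gen_in[OF gen(1)] asubD(2)[OF PS_props(1)] by simp
  qed (simp add: E.hcomp_add PS_carrier add)
  fix w assume w: "w \<in> PS"
  show "z \<otimes> w \<in> PS" using z
  proof (induction rule: PS_induct)
    case (gen s k i)
    note s = gen
    from w show ?case
    proof (induction rule: PS_induct)
      case (gen t l j)
      have "\<iota> (s \<otimes>\<^bsub>C\<^esub> t) \<otimes> x [^] (i + j) \<in> PS" using gen_in S_simps(3) s gen by blast
      then show ?case unfolding gen_mult[OF s(1) gen(1,2)] using asubD(4)[OF PS_props(1)] by (simp add: sgn_mul_def)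
    next
      case (add u v)
      then show ?case using s by (simp add: E.r_distr PS_carrier asubD(3)[OF PS_props(1)])
    qed
  qed (simp add: E.l_distr PS_carrier w add)
qed

lemmas PS_simps = E.gsubD[OF PS_gsub]

text \<open>Universal property of a free variable. Freeness defines \<open>\<psi>\<close>
  additively; it is multiplicative because \<open>gen_mult\<close> produces the same signs on both
  sides, \<open>x\<close> and \<open>Y\<close> having equal degree.\<close>

lemma pow_ext:
  fixes D :: "('k, 'd) dga"
  assumes D: "is_dga D" and B: "fbasis C S E \<iota> (pw d) (\<lambda>i. x [^] i)" and \<phi>: "shom C S D \<phi>" and Y: "Y \<in> homog D d"
  obtains \<psi> where "shom E PS D \<psi>" "\<And>s. s \<in> S \<Longrightarrow> \<psi> (\<iota> s) = \<phi> s" "\<psi> x = Y"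
    "\<And>s i. s \<in> S \<Longrightarrow> \<psi> (\<iota> s \<otimes> x [^] (i::nat)) = \<phi> s \<otimes>\<^bsub>D\<^esub> Y [^]\<^bsub>D\<^esub> i"
proof -
  interpret D: dg_algebra D by unfold_locales fact
  interpret Y: pow_span C D S \<phi> d Y by unfold_locales (rule S \<phi> Y)+
  have am: "add_map C D S (\<lambda>s. \<phi> s \<otimes>\<^bsub>D\<^esub> Y [^]\<^bsub>D\<^esub> i)" for i :: nat
    by (intro add_mapI) (auto simp: Y.\<iota>_simps D.l_distr)
  show thesis
  proof (rule fbasis_ext[OF C.abelian_group_axioms E.ring_axioms D.abelian_group_axioms B])
    show "\<And>i. i \<in> pw d \<Longrightarrow> add_map C D S (\<lambda>s. \<phi> s \<otimes>\<^bsub>D\<^esub> Y [^]\<^bsub>D\<^esub> i)" by (rule am)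
    fix \<psi> assume \<psi>: "add_map E D PS \<psi>" "\<And>i s. i \<in> pw d \<Longrightarrow> s \<in> S \<Longrightarrow> \<psi> (\<iota> s \<otimes> x [^] i) = \<phi> s \<otimes>\<^bsub>D\<^esub> Y [^]\<^bsub>D\<^esub> i"
    note \<psi>z = add_map_zero[OF E.abelian_group_axioms D.abelian_group_axioms PS_props(1) \<psi>(1)]
    note \<psi>m = add_map_minus[OF E.abelian_group_axioms D.abelian_group_axioms PS_props(1) \<psi>(1)]
    note \<psi>a = add_mapD[OF \<psi>(1)]
    \<comment> \<open>All exponents are needed, since products of basis elements may reach the
      square of an odd variable; there both powers are zero.\<close>
    have gen: "\<psi> (\<iota> s \<otimes> x [^] i) = \<phi> s \<otimes>\<^bsub>D\<^esub> Y [^]\<^bsub>D\<^esub> i" if "s \<in> S" for s and i :: nat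
    proof (cases "i \<in> pw d")
      case False
      then show ?thesis using E.pow_outside_pw[OF x False] D.pow_outside_pw[OF Y False] that \<psi>z by simp
    qed (use \<psi>(2) that in simp)
    have \<phi>s: "\<psi> (\<iota> s) = \<phi> s" if "s \<in> S" for s using gen[OF that, of 0] that by simp
    have Yx: "\<psi> x = Y" using gen[OF S_simps(2), of 1] \<iota>_simps(2) Y.\<iota>_simps(2) by simp
    have "shom E PS D \<psi>" unfolding shom_def
    proof (intro conjI ballI allI)
      show "add_map E D PS \<psi>" by (rule \<psi>(1))
      show "\<psi> \<one> = \<one>\<^bsub>D\<^esub>" using \<phi>s[OF S_simps(2)] \<iota>_simps(2) Y.\<iota>_simps(2) by simp
      show "\<psi> (z \<otimes> w) = \<psi> z \<otimes>\<^bsub>D\<^esub> \<psi> w" if z: "z \<in> PS" and w: "w \<in> PS" for z w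
        using z
      proof (induction rule: PS_induct)
        case (gen s k i)
        note s = gen
        from w show ?case
        proof (induction rule: PS_induct)
          case (gen t l j)
          note st = S_simps(3)[OF s(1) gen(1)]
          have "\<psi> (sgn_mul E n (\<iota> (s \<otimes>\<^bsub>C\<^esub> t) \<otimes> x [^] (i + j))) = sgn_mul D n (\<phi> (s \<otimes>\<^bsub>C\<^esub> t) \<otimes>\<^bsub>D\<^esub> Y [^]\<^bsub>D\<^esub> (i + j))" for n
            using \<psi>m[OF gen_in[OF st]] \<open>\<And>s i. s \<in> S \<Longrightarrow> \<psi> (\<iota> s \<otimes> x [^] i) = \<phi> s \<otimes>\<^bsub>D\<^esub> Y [^]\<^bsub>D\<^esub> i\<close>[OF st]
            by (simp add: sgn_mul_def)
          then show ?case
            unfolding gen_mult[OF s(1) gen(1,2)] using s gen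
            by (simp add: \<psi>(2) Y.gen_mult[OF s(1) gen(1,2)])
        next
          case (add u v)
          have "\<iota> s \<otimes> x [^] i \<in> PS" by (rule gen_in[OF s(1)])
          then show ?case using add s by (simp add: E.r_distr D.r_distr PS_carrier \<psi>a PS_simps)
        qed
      next
        case (add u v)
        then show ?case using w by (simp add: E.l_distr D.l_distr PS_carrier \<psi>a PS_simps)
      qed
      show "\<psi> (c \<odot> z) = c \<odot>\<^bsub>D\<^esub> \<psi> z" if z: "z \<in> PS" for c z
        using z
      proof (induction rule: PS_induct)
        case (gen s k i)
        then have "c \<odot> (\<iota> s \<otimes> x [^] i) = \<iota> (c \<odot>\<^bsub>C\<^esub> s) \<otimes> x [^] i" by (simp add: \<iota>_simps(4) E.smult_mult_l)
        then show ?case using gen S_simps(4) by (simp add: \<psi>(2) Y.\<iota>_simps(4) D.smult_mult_l)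
      next
        case (add u v)
        then show ?case by (simp add: E.smult_r_distr D.smult_r_distr PS_carrier \<psi>a PS_simps)
      qed
      fix n z assume z: "z \<in> PS \<inter> homog E n"
      \<comment> \<open>Preservation of degree is stated through projections, because a homogeneous
        \<open>z\<close> need not be presented by homogeneous summands during the induction.\<close>
      have "\<psi> (hcomp E n z) = hcomp D n (\<psi> z)" if z: "z \<in> PS"
        using z
      proof (induction rule: PS_induct)
        case (gen s k i)
        then show ?case using \<psi>z
          by (simp add: E.hcomp_homog[OF gen_homog[OF gen(1,2)]] D.hcomp_homog[OF Y.gen_homog[OF gen(1,2)]] \<psi>(2))
      next
        case (add u v)
        then show ?case by (simp add: E.hcomp_add D.hcomp_add PS_carrier \<psi>a PS_simps)
      qed
      then show "\<psi> z \<in> homog D n" 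
        using z E.hcomp_homog[of z n n] D.hcomp_in[OF \<psi>a(1), of z n] by auto
    qed
    then show thesis using that \<phi>s Yx gen by blast
  qed
qed

lemma PS_pow: "x [^] (i::nat) \<in> PS"
  by (rule E.gsub_pow[OF PS_gsub x_in])

lemma d_pow: "differential E (x [^] Suc i) = differential E (x [^] i) \<otimes> x \<oplus> sgn_mul E (int i * d) (x [^] i \<otimes> differential E x)"
  using E.leibniz[OF E.homog_pow[OF x] xc] by simp

text \<open>Since \<open>\<partial> x\<close> is the image of an element of \<open>S\<close>, the
  Leibniz rule first keeps the differentials of powers of \<open>x\<close> in the span, and then
  those of all generators.\<close>

lemma PS_dclosed:
  assumes S_d: "dclosed C S" "dmap C S E \<iota>" and p: "p \<in> S" "differential E x = \<iota> p"
  shows "dclosed E PS" "differential E (x [^] (i::nat)) \<in> PS"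
proof -
  have dx: "differential E x \<in> PS" using p \<iota>_in by simp
  show pow: "differential E (x [^] i) \<in> PS" for i :: nat
  proof (induction i)
    case (Suc i)
    then show ?case unfolding d_pow
      using dx PS_pow[of i] x_in by (intro PS_simps E.gsub_sgn_mul[OF PS_gsub])
  qed (simp add: PS_simps)
  show "dclosed E PS" unfolding dclosed_def
  proof
    fix z assume "z \<in> PS"
    then show "differential E z \<in> PS"
    proof (induction rule: PS_induct)
      case (gen s k i)
      have s: "\<iota> s \<in> homog E k" "\<iota> s \<in> PS" "differential E (\<iota> s) \<in> PS"
        using gen \<iota>_simps(5) \<iota>_in S_d unfolding dclosed_def dmap_def by auto metis
      have "differential E (\<iota> s \<otimes> x [^] i) = differential E (\<iota> s) \<otimes> x [^] i \<oplus> sgn_mul E k (\<iota> s \<otimes> differential E (x [^] i))"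
        by (rule E.leibniz[OF s(1)]) simp
      then show ?case using s(2,3) pow PS_pow by (simp add: PS_simps E.gsub_sgn_mul[OF PS_gsub])
    next
      case (add u v)
      then show ?case by (simp add: E.d_add PS_carrier PS_simps)
    qed
  qed
qed

text \<open>Applying \<open>\<psi>\<close> after the differential and the differential after
  \<open>\<psi>\<close> obey the same Leibniz rule, so agreement on \<open>S\<close> and on
  \<open>x\<close> propagates to powers of \<open>x\<close> and then to all of
  \<open>PS\<close>.\<close>

lemma pow_ext_dmap:
  fixes D :: "('k, 'd) dga"
  assumes D: "is_dga D" and S_d: "dclosed C S" "dmap C S E \<iota>" "dmap C S D \<phi>" and p: "p \<in> S" "differential E x = \<iota> p"
    and \<psi>: "shom E PS D \<psi>" "\<And>s. s \<in> S \<Longrightarrow> \<psi> (\<iota> s) = \<phi> s" "differential D (\<psi> x) = \<phi> p"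
  shows "dmap E PS D \<psi>"
  unfolding dmap_def
proof
  interpret D: dg_algebra D by unfold_locales fact
  note cl = PS_dclosed[OF S_d(1,2) p]
  note \<psi>s = shomD[OF \<psi>(1)] shom_zero[OF E.dga D PS_gsub \<psi>(1)]
  have dx: "differential E x \<in> PS" using p \<iota>_in by simp
  have \<psi>x: "\<psi> x \<in> homog D d" using \<psi>s(5)[OF x_in x] .
  have pow: "\<psi> (differential E (x [^] i)) = differential D (\<psi> x [^]\<^bsub>D\<^esub> i)" for i :: nat
  proof (induction i)
    case 0
    then show ?case using \<psi>s(8) by simp
  next
    case (Suc i)
    have "\<psi> (differential E (x [^] Suc i)) = \<psi> (differential E (x [^] i)) \<otimes>\<^bsub>D\<^esub> \<psi> x \<oplus>\<^bsub>D\<^esub> sgn_mul D (int i * d) (\<psi> x [^]\<^bsub>D\<^esub> i \<otimes>\<^bsub>D\<^esub> \<psi> (differential E x))"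
      unfolding d_pow using cl(2) PS_pow x_in dx
      by (simp add: \<psi>s PS_simps E.gsub_sgn_mul[OF PS_gsub])
    also have "\<psi> (differential E x) = differential D (\<psi> x)" using p \<psi> by simp
    finally show ?case using D.leibniz[OF D.homog_pow[OF \<psi>x], of "\<psi> x" i] \<psi>x Suc by (simp add: D.homog_carrier)
  qed
  fix z assume "z \<in> PS"
  then show "\<psi> (differential E z) = differential D (\<psi> z)"
  proof (induction rule: PS_induct)
    case (gen s k i)
    have ds: "differential C s \<in> S" "differential E (\<iota> s) = \<iota> (differential C s)" "\<phi> (differential C s) = differential D (\<phi> s)"
      using gen S_d unfolding dclosed_def dmap_def by auto
    have s: "\<iota> s \<in> homog E k" "\<iota> s \<in> PS" "differential E (\<iota> s) \<in> PS"
      using gen \<iota>_simps(5) \<iota>_in ds by auto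
    have d1: "\<psi> (differential E (\<iota> s)) = differential D (\<psi> (\<iota> s))"
      using ds gen \<psi>(2) by simp
    have "differential E (\<iota> s \<otimes> x [^] i) = differential E (\<iota> s) \<otimes> x [^] i \<oplus> sgn_mul E k (\<iota> s \<otimes> differential E (x [^] i))"
      by (rule E.leibniz[OF s(1)]) simp
    then have "\<psi> (differential E (\<iota> s \<otimes> x [^] i)) = differential D (\<psi> (\<iota> s)) \<otimes>\<^bsub>D\<^esub> \<psi> x [^]\<^bsub>D\<^esub> i \<oplus>\<^bsub>D\<^esub> sgn_mul D k (\<psi> (\<iota> s) \<otimes>\<^bsub>D\<^esub> differential D (\<psi> x [^]\<^bsub>D\<^esub> i))"
      using s(2,3) cl(2) PS_pow x_in by (simp add: \<psi>s PS_simps E.gsub_sgn_mul[OF PS_gsub] d1 pow)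
    also have "\<dots> = differential D (\<psi> (\<iota> s) \<otimes>\<^bsub>D\<^esub> \<psi> x [^]\<^bsub>D\<^esub> i)"
      by (rule D.leibniz[OF \<psi>s(5)[OF s(2,1)], symmetric]) (use \<psi>x in \<open>simp add: D.homog_carrier\<close>)
    also have "\<dots> = differential D (\<psi> (\<iota> s \<otimes> x [^] i))"
      using s(2) PS_pow x_in by (simp add: \<psi>s)
    finally show ?case .
  next
    case (add u v)
    then show ?case using cl(1) \<psi>s(6) by (simp add: E.d_add D.d_add PS_carrier PS_simps \<psi>s(7) dclosed_def)
  qed
qed

text \<open>By freeness the substitution of \<open>x - \<iota> b\<close> for \<open>x\<close> is an
  algebra map \<open>\<psi>\<close> over \<open>S\<close>, and it sends \<open>y\<close> to
  \<open>x\<close>. Coordinates for powers of \<open>x\<close>, composed with \<open>\<psi>\<close>,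
  are coordinates for powers of \<open>y\<close>.\<close>

lemma shift_basis:
  assumes B: "fbasis C S E \<iota> (pw d) (\<lambda>i. x [^] i)" and b: "b \<in> S" "b \<in> homog C d"
  defines "y \<equiv> x \<oplus> \<iota> b"
  shows "fbasis C S E \<iota> (pw d) (\<lambda>i. y [^] i)" "fspan S E \<iota> (pw d) (\<lambda>i. y [^] i) = PS"
proof -
  have bh: "\<iota> b \<in> homog E d" using b \<iota>_simps(5) by blast
  have y: "y \<in> homog E d" unfolding y_def using x bh by blast
  interpret Y: pow_span C E S \<iota> d y by unfold_locales (rule S \<iota> y)+
  have y_in: "y \<in> PS" unfolding y_def using x_in \<iota>_in[OF b(1)] by (rule PS_simps)
  have xy: "x = y \<oplus> \<ominus> \<iota> b" unfolding y_def using b by (simp add: E.a_assoc E.r_neg)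
  have x_in_Y: "x \<in> Y.PS" unfolding xy using Y.x_in Y.\<iota>_in[OF b(1)] by (intro Y.PS_simps)
  show sp: "Y.PS = PS"
  proof
    show "Y.PS \<subseteq> PS"
      by (rule fspan_least[OF PS_props(1)]) (use \<iota>_in E.gsub_pow[OF PS_gsub y_in] PS_simps(3) in blast)
    show "PS \<subseteq> Y.PS"
      by (rule fspan_least[OF Y.PS_props(1)]) (use Y.\<iota>_in E.gsub_pow[OF Y.PS_gsub x_in_Y] Y.PS_simps(3) in blast)
  qed
  define z where "z = x \<oplus> \<ominus> \<iota> b"
  have z: "z \<in> homog E d" unfolding z_def using x bh by blast
  interpret Z: pow_span C E S \<iota> d z by unfold_locales (rule S \<iota> z)+
  obtain \<psi> where \<psi>: "shom E PS E \<psi>" "\<And>s. s \<in> S \<Longrightarrow> \<psi> (\<iota> s) = \<iota> s" "\<psi> x = z" using pow_ext[OF E.dga B \<iota> z] by metis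
  have \<psi>y: "\<psi> y = x"
    unfolding y_def using \<psi> x_in \<iota>_in[OF b(1)] b(1) by (simp add: shomD(7)[OF \<psi>(1)] z_def E.a_assoc E.l_neg)
  have \<psi>g: "\<psi> (\<iota> s \<otimes> y [^] i) = \<iota> s \<otimes> x [^] i" if "s \<in> S" for s and i :: nat
    using shomD(3)[OF \<psi>(1) \<iota>_in[OF that] E.gsub_pow[OF PS_gsub y_in]]
      shom_zero(5)[OF E.dga E.dga PS_gsub \<psi>(1) y_in] \<psi>(2)[OF that] \<psi>y by simp
  \<comment> \<open>The coordinates are additive on \<open>PS\<close> only, so \<open>\<psi>\<close>
    has to land there. Induction uses the generators in powers of \<open>y\<close>, whose images are
    already known.\<close>
  have \<psi>PS: "\<psi> u \<in> PS" if "u \<in> PS" for u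
  proof -
    have "u \<in> Y.PS" using that sp by simp
    then show ?thesis
    proof (induction rule: Y.PS_induct)
      case (gen s k i)
      then show ?case using \<psi>g gen_in by simp
    next
      case (add u v)
      then show ?case using shomD(7)[OF \<psi>(1)] sp PS_simps(7) by simp
    qed
  qed
  obtain \<kappa> where \<kappa>: "\<And>i. i \<in> pw d \<Longrightarrow> add_map E C PS (\<kappa> i)"
    "\<And>i l s. i \<in> pw d \<Longrightarrow> l \<in> pw d \<Longrightarrow> s \<in> S \<Longrightarrow> \<kappa> i (\<iota> s \<otimes> x [^] l) = (if i = l then s else \<zero>\<^bsub>C\<^esub>)"
    using fbasisE[OF B] by metis
  show "fbasis C S E \<iota> (pw d) (\<lambda>i. y [^] i)"
  proof (rule fbasisI[OF S_simps(1) \<iota>_simps(1), where \<kappa> = "\<lambda>i u. \<kappa> i (\<psi> u)"])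
    show "add_map E C Y.PS (\<lambda>u. \<kappa> i (\<psi> u))" if "i \<in> pw d" for i
      unfolding sp by (rule add_map_comp[OF shomD(1)[OF \<psi>(1)] \<kappa>(1)[OF that] \<psi>PS])
  qed (use y in \<open>auto simp: \<psi>g \<kappa>(2)\<close>)
qed

end

section \<open>Contractible extensions\<close>

lemma fspan_induct:
  assumes "abelian_group N" "ring D" "asub N S" "add_map N D S g" "v \<in> I \<rightarrow> carrier D" "x \<in> fspan S D g I v"
    and "Q \<zero>\<^bsub>D\<^esub>" "\<And>i s. i \<in> I \<Longrightarrow> s \<in> S \<Longrightarrow> Q (g s \<otimes>\<^bsub>D\<^esub> v i)"
    "\<And>x y. x \<in> fspan S D g I v \<Longrightarrow> y \<in> fspan S D g I v \<Longrightarrow> Q x \<Longrightarrow> Q y \<Longrightarrow> Q (x \<oplus>\<^bsub>D\<^esub> y)"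
  shows "Q x"
  using assms(6) unfolding fspan_def
proof induction
  case (aspan_step h y)
  note P = fspan_props[OF assms(1-5)]
  obtain i s where h: "i \<in> I" "s \<in> S" "h = g s \<otimes>\<^bsub>D\<^esub> v i" using aspan_step(1) by (auto simp: dgen_def)
  then have "h \<in> fspan S D g I v" "Q h" using P(2) assms(8) by auto
  then show ?case using assms(9) aspan_step(2,3) by (simp add: fspan_def)
qed (rule assms(7))

lemma (in dg_algebra) d_pow_cocycle: "x \<in> homog D d \<Longrightarrow> \<delta> x = \<zero> \<Longrightarrow> \<delta> (x [^] (i::nat)) = \<zero>"
proof (induction i)
  case (Suc i)
  then show ?case using leibniz[OF homog_pow[OF Suc(2)], of x i] by (simp add: homog_carrier)
qed simp

text \<open>The pair \<open>y\<close>, \<open>\<eta>\<close> is a free disc over \<open>D\<close>,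
  described by its basis rather than by the construction; \<open>\<pi>\<close> is the retraction
  that kills both variables.\<close>

locale contraction = D: dg_algebra D + E: dg_algebra E
  for D :: "('k::field_char_0, 'c) dga" and E :: "('k, 'e) dga" (structure) +
  fixes \<iota> :: "'c \<Rightarrow> 'e" and \<pi> :: "'e \<Rightarrow> 'c" and d :: int and y \<eta> :: 'e
  assumes \<iota>: "shom D (carrier D) E \<iota>" and \<iota>d: "dmap D (carrier D) E \<iota>"
    and \<pi>: "shom E (carrier E) D \<pi>" and \<pi>\<iota>: "\<And>s. s \<in> carrier D \<Longrightarrow> \<pi> (\<iota> s) = s"
    and y: "y \<in> homog E d" and \<eta>: "\<eta> \<in> homog E (d - 1)"
    and dy: "differential E y = \<zero>" and d\<eta>: "differential E \<eta> = y"
    and \<pi>y: "\<pi> y = \<zero>\<^bsub>D\<^esub>" and \<pi>\<eta>: "\<pi> \<eta> = \<zero>\<^bsub>D\<^esub>"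
    and B: "fbasis D (carrier D) E \<iota> (pw d \<times> pw (d - 1)) (\<lambda>(m, n). y [^] m \<otimes> \<eta> [^] n)"
    and sp: "fspan (carrier D) E \<iota> (pw d \<times> pw (d - 1)) (\<lambda>(m, n). y [^] m \<otimes> \<eta> [^] n) = carrier E"
begin

abbreviation dE where "dE \<equiv> differential E"

text \<open>The homotopy identity between the identity and \<open>\<iota> \<circ> \<pi>\<close>, at
  a single element. The condition on \<open>\<pi> (H z)\<close> keeps the correcting cochains in the
  kernel of \<open>\<pi>\<close>, as the acyclic kernel in \<open>surj_acyclic\<close> demands; the
  last condition says that \<open>H\<close> lowers degrees by 1.\<close>

definition contracting :: "('e \<Rightarrow> 'e) \<Rightarrow> 'e \<Rightarrow> bool" where
  "contracting H z \<longleftrightarrow> dE (H z) \<oplus> H (dE z) \<oplus> \<iota> (\<pi> z) = z \<and> \<pi> (H z) = \<zero>\<^bsub>D\<^esub> \<and>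
     (\<forall>n. H (hcomp E n z) = hcomp E (n - 1) (H z))"

lemma yc [simp]: "y \<in> carrier E" and \<eta>c [simp]: "\<eta> \<in> carrier E"
  using y \<eta> by blast+

lemmas \<iota>_simps = shomD[OF \<iota>] shom_zero[OF D.dga E.dga D.gsub_carrier \<iota>]
lemmas \<pi>_simps = shomD[OF \<pi>] shom_zero[OF E.dga D.dga E.gsub_carrier \<pi>]

lemma \<iota>_d: "s \<in> carrier D \<Longrightarrow> dE (\<iota> s) = \<iota> (differential D s)"
  using \<iota>d by (simp add: dmap_def)

lemma E_induct:
  assumes z: "z \<in> carrier E"
    and g: "\<And>s k m n. s \<in> homog D k \<Longrightarrow> m \<in> pw d \<Longrightarrow> n \<in> pw (d - 1) \<Longrightarrow> Q (\<iota> s \<otimes> (y [^] m \<otimes> \<eta> [^] n))"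
    and a: "\<And>u v. u \<in> carrier E \<Longrightarrow> v \<in> carrier E \<Longrightarrow> Q u \<Longrightarrow> Q v \<Longrightarrow> Q (u \<oplus> v)"
  shows "Q z"
proof -
  have g': "Q (\<iota> s \<otimes> (y [^] m \<otimes> \<eta> [^] n))"
    if "s \<in> carrier D" "m \<in> pw d" "n \<in> pw (d - 1)" for s m n
    using that(1)
  proof (induction rule: D.homog_induct)
    case (homog k x)
    then show ?case using g that by blast
  next
    case (add x x')
    let ?w = "y [^] m \<otimes> \<eta> [^] n"
    have "\<iota> (x \<oplus>\<^bsub>D\<^esub> x') \<otimes> ?w = \<iota> x \<otimes> ?w \<oplus> \<iota> x' \<otimes> ?w"
      using add \<iota>_simps by (simp add: E.l_distr)
    then show ?case using a[of "\<iota> x \<otimes> ?w" "\<iota> x' \<otimes> ?w"] add \<iota>_simps(6) by simp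
  qed
  have z': "z \<in> fspan (carrier D) E \<iota> (pw d \<times> pw (d - 1)) (\<lambda>(m, n). y [^] m \<otimes> \<eta> [^] n)" using z sp by simp
  show ?thesis
  proof (rule fspan_induct[OF D.abelian_group_axioms E.ring_axioms D.asub_carrier \<iota>_simps(1) _ z'])
    show "Q \<zero>" using g'[of "\<zero>\<^bsub>D\<^esub>" 0 0] \<iota>_simps(8) by simp
  qed (use g' a sp in auto)
qed

lemma contracting_all:
  assumes H: "add_map E E (carrier E) H"
    and g: "\<And>s k m n. s \<in> homog D k \<Longrightarrow> m \<in> pw d \<Longrightarrow> n \<in> pw (d - 1) \<Longrightarrow>
      contracting H (\<iota> s \<otimes> (y [^] m \<otimes> \<eta> [^] n))"
    and z: "z \<in> carrier E"
  shows "contracting H z"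
  using z
proof (rule E_induct)
  note h = add_mapD[OF H]
  fix u v assume uv: "u \<in> carrier E" "v \<in> carrier E" "contracting H u" "contracting H v"
  note C = uv(3,4)[unfolded contracting_def]
  have ic: "\<iota> (\<pi> w) \<in> carrier E" if "w \<in> carrier E" for w using \<iota>_simps(6) \<pi>_simps(6) that by blast
  have "dE (H (u \<oplus> v)) \<oplus> H (dE (u \<oplus> v)) \<oplus> \<iota> (\<pi> (u \<oplus> v)) = 
     (dE (H u) \<oplus> H (dE u) \<oplus> \<iota> (\<pi> u)) \<oplus> (dE (H v) \<oplus> H (dE v) \<oplus> \<iota> (\<pi> v))"
    using uv(1,2) ic by (simp add: h E.d_add \<iota>_simps(7) \<pi>_simps(6,7) E.a_ac)
  then have 1: "dE (H (u \<oplus> v)) \<oplus> H (dE (u \<oplus> v)) \<oplus> \<iota> (\<pi> (u \<oplus> v)) = u \<oplus> v"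
    using C by simp
  have 2: "\<pi> (H (u \<oplus> v)) = \<zero>\<^bsub>D\<^esub>" using C uv(1,2) by (simp add: h \<pi>_simps(7))
  have 3: "\<forall>n. H (hcomp E n (u \<oplus> v)) = hcomp E (n - 1) (H (u \<oplus> v))"
    using C uv(1,2) by (simp add: h E.hcomp_add)
  show "contracting H (u \<oplus> v)" unfolding contracting_def using 1 2 3 by blast
qed (rule g)

lemma \<pi>_pow_Suc: "\<pi> (y [^] Suc n) = \<zero>\<^bsub>D\<^esub>" "\<pi> (\<eta> [^] Suc n) = \<zero>\<^bsub>D\<^esub>"
  using \<pi>_simps(12)[of y "Suc n"] \<pi>_simps(12)[of \<eta> "Suc n"] by (simp_all add: \<pi>y \<pi>\<eta>)

lemma \<pi>_gen: "s \<in> carrier D \<Longrightarrow> \<pi> (\<iota> s \<otimes> (y [^] (m::nat) \<otimes> \<eta> [^] (n::nat))) = (if m = 0 \<and> n = 0 then s else \<zero>\<^bsub>D\<^esub>)"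
proof -
  assume s: "s \<in> carrier D"
  have "\<pi> (\<iota> s \<otimes> (y [^] m \<otimes> \<eta> [^] n)) = s \<otimes>\<^bsub>D\<^esub> (\<pi> (y [^] m) \<otimes>\<^bsub>D\<^esub> \<pi> (\<eta> [^] n))"
    using s \<iota>_simps(6)[OF s] \<pi>\<iota>[OF s] by (simp add: \<pi>_simps(3))
  moreover have "\<pi> (y [^] m) = (if m = 0 then \<one>\<^bsub>D\<^esub> else \<zero>\<^bsub>D\<^esub>)" "\<pi> (\<eta> [^] n) = (if n = 0 then \<one>\<^bsub>D\<^esub> else \<zero>\<^bsub>D\<^esub>)"
    using \<pi>_pow_Suc(1)[of "m - 1"] \<pi>_pow_Suc(2)[of "n - 1"] \<pi>_simps(2) by (cases m; cases n; simp)+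
  ultimately show ?thesis using s by simp
qed

lemma gen_homog: "s \<in> homog D k \<Longrightarrow> \<iota> s \<otimes> (y [^] (m::nat) \<otimes> \<eta> [^] (n::nat)) \<in> homog E (k + (int m * d + int n * (d - 1)))"
  using E.homog_mult[OF \<iota>_simps(5) E.homog_mult[OF E.homog_pow[OF y] E.homog_pow[OF \<eta>]]] by blast

lemma d_gen:
  assumes "s \<in> homog D k" "w \<in> carrier E"
  shows "dE (\<iota> s \<otimes> w) = \<iota> (differential D s) \<otimes> w \<oplus> sgn_mul E k (\<iota> s \<otimes> dE w)"
  using E.leibniz[OF \<iota>_simps(5) assms(2)] assms(1) \<iota>_d by (simp add: D.homog_carrier)

lemma contractingI:
  assumes "s \<in> homog D k"
    and "dE (H (\<iota> s \<otimes> (y [^] m \<otimes> \<eta> [^] n))) \<oplus> H (dE (\<iota> s \<otimes> (y [^] m \<otimes> \<eta> [^] n)))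
         \<oplus> (if m = 0 \<and> n = 0 then \<iota> s else \<zero>) = \<iota> s \<otimes> (y [^] m \<otimes> \<eta> [^] n)"
    and "\<pi> (H (\<iota> s \<otimes> (y [^] m \<otimes> \<eta> [^] n))) = \<zero>\<^bsub>D\<^esub>"
    and "H (\<iota> s \<otimes> (y [^] m \<otimes> \<eta> [^] n)) \<in> homog E (k + (int m * d + int n * (d - 1)) - 1)"
    and "H \<zero> = \<zero>"
  shows "contracting H (\<iota> s \<otimes> (y [^] m \<otimes> \<eta> [^] n))"
  unfolding contracting_def
proof (intro conjI allI)
  show "H (hcomp E n' (\<iota> s \<otimes> (y [^] m \<otimes> \<eta> [^] n))) = hcomp E (n' - 1) (H (\<iota> s \<otimes> (y [^] m \<otimes> \<eta> [^] n)))" for n'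
    unfolding E.hcomp_homog[OF gen_homog[OF assms(1)]] E.hcomp_homog[OF assms(4)] using assms(5) by simp
  show "dE (H (\<iota> s \<otimes> (y [^] m \<otimes> \<eta> [^] n))) \<oplus> H (dE (\<iota> s \<otimes> (y [^] m \<otimes> \<eta> [^] n)))
     \<oplus> \<iota> (\<pi> (\<iota> s \<otimes> (y [^] m \<otimes> \<eta> [^] n))) = \<iota> s \<otimes> (y [^] m \<otimes> \<eta> [^] n)"
    unfolding \<pi>_gen[OF D.homog_carrier[OF assms(1)]] if_distrib[of \<iota>] \<iota>_simps(8) by (rule assms(2))
qed (rule assms(3))

lemma par_additive: "add_map D E (carrier D) (\<lambda>s. \<iota> (par D s) \<otimes> w)" if "w \<in> carrier E" for w
  using that by (intro add_mapI) (auto simp: D.par_add \<iota>_simps(6,7) E.l_distr)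

lemma zero_additive: "add_map D E (carrier D) (\<lambda>s. \<zero>)"
  by (intro add_mapI) auto

lemma \<iota>_par: "s \<in> homog D k \<Longrightarrow> \<iota> (par D s) = sgn_mul E k (\<iota> s)"
  by (simp add: D.par_homog \<iota>_simps(10) D.homog_carrier)

lemma cancel_sgn: "w \<in> carrier E \<Longrightarrow> sgn_mul E k (sgn_mul E k w) = w"
  "w \<in> carrier E \<Longrightarrow> sgn_mul E k w \<oplus> sgn_mul E (k + 1) w = \<zero>"
  by (auto simp: sgn_mul_def E.r_neg E.l_neg)

text \<open>Now \<open>y\<close> is polynomial and \<open>\<eta>\<close> exterior. Since
  \<open>y^(m-1) \<eta>\<close> has differential \<open>y^m\<close>, the homotopy sends
  \<open>s y^m\<close> to that element times \<open>s\<close> up to the sign of \<open>s\<close>,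
  and kills \<open>D\<close> and all multiples of \<open>\<eta>\<close>.\<close>

lemma homotopy_even:
  assumes "even d"
  shows "\<exists>H. add_map E E (carrier E) H \<and> (\<forall>z\<in>carrier E. contracting H z)"
proof -
  define F where "F = (\<lambda>(m::nat, n::nat) s. if m = 0 \<or> n \<noteq> 0 then \<zero> else \<iota> (par D s) \<otimes> (y [^] (m - 1) \<otimes> \<eta>))"
  have "add_map D E (carrier D) (F p)" for p
  proof (cases p)
    case (Pair m n)
    then show ?thesis using par_additive zero_additive by (cases "m = 0 \<or> n \<noteq> 0") (simp_all add: F_def)
  qed
  then show ?thesis
  proof (rule fbasis_ext[OF D.abelian_group_axioms E.ring_axioms E.abelian_group_axioms B, unfolded sp])
    fix H assume H: "add_map E E (carrier E) H" and
      "\<And>i s. i \<in> pw d \<times> pw (d - 1) \<Longrightarrow> s \<in> carrier D \<Longrightarrow> H (\<iota> s \<otimes> (case i of (m, n) \<Rightarrow> y [^] m \<otimes> \<eta> [^] n)) = F i s"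
    then have HF: "H (\<iota> s \<otimes> (y [^] m \<otimes> \<eta> [^] n)) = F (m, n) s" if "m \<in> pw d" "n \<in> pw (d - 1)" "s \<in> carrier D" for m n s
      using that by force
    note h = add_mapD[OF H] and h0 = add_map_zero[OF E.abelian_group_axioms E.abelian_group_axioms E.asub_carrier H]
    note hm = add_map_minus[OF E.abelian_group_axioms E.abelian_group_axioms E.asub_carrier H]
    have hs: "H (sgn_mul E k w) = sgn_mul E k (H w)" if "w \<in> carrier E" for k w
      using hm[OF that] by (simp add: sgn_mul_def)
    have pwd: "m \<in> pw d" for m using assms by (simp add: pw_def)
    have "contracting H (\<iota> s \<otimes> (y [^] m \<otimes> \<eta> [^] n))"
      if s: "s \<in> homog D k" and m: "m \<in> pw d" and n: "n \<in> pw (d - 1)" for s k m n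
    proof (rule contractingI[where H = H, OF s _ _ _ h0])
      have sc: "s \<in> carrier D" "\<iota> s \<in> carrier E" "\<iota> (differential D s) \<in> carrier E" "differential D s \<in> carrier D" "differential D s \<in> homog D (k + 1)"
        using s \<iota>_simps(6) by blast+
      consider "n = 0" | "n = 1" using n assms by (fastforce simp: pw_def)
      note n01 = this
      let ?z = "\<iota> s \<otimes> (y [^] m \<otimes> \<eta> [^] n)"
      show "\<pi> (H ?z) = \<zero>\<^bsub>D\<^esub>"
        unfolding HF[OF m n sc(1)] F_def using sc \<pi>_simps(3,6,8) \<iota>_simps(6) \<pi>\<eta> by simp
      show "H ?z \<in> homog E (k + (int m * d + int n * (d - 1)) - 1)"
      proof (cases "m = 0 \<or> n \<noteq> 0")
        case True
        then show ?thesis unfolding HF[OF m n sc(1)] F_def by auto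
      next
        case False
        then obtain m' where "m = Suc m'" "n = 0" by (cases m) auto
        moreover have "\<iota> (par D s) \<otimes> (y [^] m' \<otimes> \<eta>) \<in> homog E (k + (int m' * d + (d - 1)))"
          using E.homog_mult[OF \<iota>_simps(5)[OF _ D.par_in_homog[OF s]] E.homog_mult[OF E.homog_pow[OF y] \<eta>]] sc by simp
        ultimately show ?thesis unfolding HF[OF m n sc(1)] F_def by (simp add: algebra_simps)
      qed
      have dyp: "dE (y [^] i) = \<zero>" for i :: nat by (rule E.d_pow_cocycle[OF y dy])
      have dy\<eta>: "dE (y [^] i \<otimes> \<eta>) = y [^] Suc i" for i
        using E.leibniz[OF E.homog_pow[OF y] \<eta>c, of i] assms by (simp add: dyp d\<eta> sgn_mul_def)
      from n01 show "dE (H ?z) \<oplus> H (dE ?z) \<oplus> (if m = 0 \<and> n = 0 then \<iota> s else \<zero>) = ?z"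
      proof cases
        case 1
        have dz: "dE ?z = \<iota> (differential D s) \<otimes> (y [^] m \<otimes> \<eta> [^] n)"
          using sc d_gen[OF s, of "y [^] m"] 1 by (simp add: dyp)
        show ?thesis
        proof (cases m)
          case 0
          then show ?thesis unfolding dz HF[OF m n sc(1)] HF[OF m n sc(4)] F_def using 1 sc by simp
        next
          case (Suc m')
          let ?w = "y [^] m' \<otimes> \<eta>"
          have wc: "?w \<in> carrier E" by simp
          have Hz: "H ?z = sgn_mul E k (\<iota> s \<otimes> ?w)"
            unfolding HF[OF m n sc(1)] F_def using 1 Suc sc by (simp add: \<iota>_par[OF s] E.sgn_mul_mult_l)
          \<comment> \<open>The coefficient is now of degree \<open>k + 1\<close>, so
            \<open>par\<close> gives the sign opposite to that of the matching term in
            \<open>dE (H ?z)\<close>, and the two cancel.\<close>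
          have Hdz: "H (dE ?z) = sgn_mul E (k + 1) (\<iota> (differential D s) \<otimes> ?w)"
            unfolding dz HF[OF m n sc(4)] F_def using 1 Suc sc by (simp add: \<iota>_par[OF sc(5)] E.sgn_mul_mult_l)
          have "dE (H ?z) = sgn_mul E k (\<iota> (differential D s) \<otimes> ?w \<oplus> sgn_mul E k (\<iota> s \<otimes> y [^] m))"
            unfolding Hz using sc Suc d_gen[OF s wc] by (simp add: E.d_sgn_mul dy\<eta> del: E.nat_pow_Suc)
          also have "\<dots> = sgn_mul E k (\<iota> (differential D s) \<otimes> ?w) \<oplus> \<iota> s \<otimes> y [^] m"
            using sc by (simp add: E.sgn_mul_add cancel_sgn)
          finally have "dE (H ?z) \<oplus> H (dE ?z) = \<iota> s \<otimes> y [^] m \<oplus> (sgn_mul E k (\<iota> (differential D s) \<otimes> ?w) \<oplus> sgn_mul E (k + 1) (\<iota> (differential D s) \<otimes> ?w))"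
            unfolding Hdz using sc by (simp add: E.a_ac)
          also have "\<dots> = ?z" using sc 1 by (simp add: cancel_sgn)
          finally show ?thesis using Suc sc by simp
        qed
      next
        \<comment> \<open>Here \<open>H ?z\<close> is zero. In the differential, the summand with
          the differential of \<open>s\<close> still contains \<open>\<eta>\<close> and is killed,
          while \<open>y^(m+1)\<close> is sent back to \<open>y^m \<eta>\<close>.\<close>
        case 2
        have z: "?z = \<iota> s \<otimes> (y [^] m \<otimes> \<eta>)" using 2 by simp
        have "dE ?z = \<iota> (differential D s) \<otimes> (y [^] m \<otimes> \<eta> [^] n) \<oplus> sgn_mul E k (\<iota> s \<otimes> (y [^] Suc m \<otimes> \<eta> [^] (0::nat)))"
          unfolding z using d_gen[OF s, of "y [^] m \<otimes> \<eta>"] 2 by (simp add: dy\<eta> del: E.nat_pow_Suc)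
        then have "H (dE ?z) = H (\<iota> (differential D s) \<otimes> (y [^] m \<otimes> \<eta> [^] n)) \<oplus> sgn_mul E k (H (\<iota> s \<otimes> (y [^] Suc m \<otimes> \<eta> [^] (0::nat))))"
          using sc by (simp add: h(2) hs)
        also have "\<dots> = sgn_mul E k (sgn_mul E k (\<iota> s \<otimes> (y [^] m \<otimes> \<eta>)))"
          unfolding HF[OF m n sc(4)] HF[OF pwd[of "Suc m"] pw_0 sc(1)] F_def using 2 sc by (simp add: \<iota>_par[OF s] E.sgn_mul_mult_l)
        also have "\<dots> = ?z" using sc 2 by (simp add: cancel_sgn)
        finally show ?thesis unfolding HF[OF m n sc(1)] using 2 sc by (simp add: F_def)
      qed
    qed
    then show ?thesis using H contracting_all[OF H] by blast
  qed
qed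

text \<open>Now \<open>y\<close> is exterior and \<open>\<eta>\<close> polynomial. As the
  differential of \<open>\<eta>^(n+1)\<close> is \<open>(n+1) y \<eta>^n\<close>, a primitive of
  \<open>y \<eta>^n\<close> is \<open>\<eta>^(n+1)\<close> divided by \<open>n+1\<close>, which
  exists in characteristic 0.\<close>

lemma homotopy_odd:
  assumes "odd d"
  shows "\<exists>H. add_map E E (carrier E) H \<and> (\<forall>z\<in>carrier E. contracting H z)"
proof -
  define F where "F = (\<lambda>(m::nat, n::nat) s. if m = 0 then \<zero> else \<iota> (par D s) \<otimes> ((1 / of_nat (Suc n)) \<odot> \<eta> [^] Suc n))"
  have "add_map D E (carrier D) (F p)" for p
  proof (cases p)
    case (Pair m n)
    then show ?thesis using par_additive zero_additive by (cases "m = 0") (simp_all add: F_def)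
  qed
  then show ?thesis
  proof (rule fbasis_ext[OF D.abelian_group_axioms E.ring_axioms E.abelian_group_axioms B, unfolded sp])
    fix H assume H: "add_map E E (carrier E) H" and
      "\<And>i s. i \<in> pw d \<times> pw (d - 1) \<Longrightarrow> s \<in> carrier D \<Longrightarrow> H (\<iota> s \<otimes> (case i of (m, n) \<Rightarrow> y [^] m \<otimes> \<eta> [^] n)) = F i s"
    then have HF: "H (\<iota> s \<otimes> (y [^] m \<otimes> \<eta> [^] n)) = F (m, n) s" if "m \<in> pw d" "n \<in> pw (d - 1)" "s \<in> carrier D" for m n s
      using that by force
    note h = add_mapD[OF H] and h0 = add_map_zero[OF E.abelian_group_axioms E.abelian_group_axioms E.asub_carrier H]
    note hm = add_map_minus[OF E.abelian_group_axioms E.abelian_group_axioms E.asub_carrier H]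
    have hs: "H (sgn_mul E k w) = sgn_mul E k (H w)" if "w \<in> carrier E" for k w
      using hm[OF that] by (simp add: sgn_mul_def)
    have pwd: "n \<in> pw (d - 1)" for n using assms by (simp add: pw_def)
    have yy: "y \<otimes> y = \<zero>" by (rule E.odd_square_zero[OF y assms])
    have comm: "\<eta> [^] n \<otimes> y = y \<otimes> \<eta> [^] n" for n :: nat
      using E.pow_comm[OF \<eta> y, of n] assms by (simp add: sgn_mul_def)
    have d\<eta>p: "dE (\<eta> [^] Suc n) = of_nat (Suc n) \<odot> (y \<otimes> \<eta> [^] n)" for n
    proof (induction n)
      case 0
      then show ?case by (simp add: d\<eta>)
    next
      case (Suc n)
      have "dE (\<eta> [^] Suc (Suc n)) = dE (\<eta> [^] Suc n) \<otimes> \<eta> \<oplus> \<eta> [^] Suc n \<otimes> y"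
        using E.leibniz[OF E.homog_pow[OF \<eta>] \<eta>c, of "Suc n"] assms by (simp add: d\<eta> sgn_mul_def)
      also have "\<dots> = of_nat (Suc n) \<odot> (y \<otimes> \<eta> [^] Suc n) \<oplus> y \<otimes> \<eta> [^] Suc n"
        unfolding Suc comm by (simp add: E.smult_mult_l E.m_assoc)
      also have "\<dots> = of_nat (Suc (Suc n)) \<odot> (y \<otimes> \<eta> [^] Suc n)"
        using E.smult_l_distr[of "y \<otimes> \<eta> [^] Suc n" "of_nat (Suc n)" 1] by (simp add: add.commute)
      finally show ?case .
    qed
    have "contracting H (\<iota> s \<otimes> (y [^] m \<otimes> \<eta> [^] n))"
      if s: "s \<in> homog D k" and m: "m \<in> pw d" and n: "n \<in> pw (d - 1)" for s k m n
    proof (rule contractingI[where H = H, OF s _ _ _ h0])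
      have sc: "s \<in> carrier D" "\<iota> s \<in> carrier E" "\<iota> (differential D s) \<in> carrier E" "differential D s \<in> carrier D" "differential D s \<in> homog D (k + 1)"
        using s \<iota>_simps(6) by blast+
      consider "m = 0" | "m = 1" using m assms by (fastforce simp: pw_def)
      note m01 = this
      let ?z = "\<iota> s \<otimes> (y [^] m \<otimes> \<eta> [^] n)"
      let ?c = "1 / of_nat (Suc n) :: 'k"
      let ?w = "?c \<odot> \<eta> [^] Suc n"
      have wc: "?w \<in> carrier E" by simp
      have \<pi>w: "\<pi> ?w = \<zero>\<^bsub>D\<^esub>" unfolding \<pi>_simps(4)[OF E.nat_pow_closed[OF \<eta>c]] \<pi>_pow_Suc by simp
      show "\<pi> (H ?z) = \<zero>\<^bsub>D\<^esub>"
        unfolding HF[OF m n sc(1)] F_def using sc \<pi>_simps(3,6,8) \<iota>_simps(6) \<pi>w wc by (simp del: E.nat_pow_Suc of_nat_Suc)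
      show "H ?z \<in> homog E (k + (int m * d + int n * (d - 1)) - 1)"
      proof (cases "m = 0")
        case True
        then show ?thesis unfolding HF[OF m n sc(1)] F_def by auto
      next
        case False
        then have "m = 1" using m01 by auto
        moreover have "\<iota> (par D s) \<otimes> ?w \<in> homog E (k + int (Suc n) * (d - 1))"
          by (rule E.homog_mult[OF \<iota>_simps(5)[OF _ D.par_in_homog[OF s]] E.homog_smult[OF E.homog_pow[OF \<eta>]]]) (use sc in simp)
        ultimately show ?thesis unfolding HF[OF m n sc(1)] F_def by (simp add: algebra_simps)
      qed
      have dw: "dE ?w = y \<otimes> \<eta> [^] n"
      proof -
        have "dE ?w = ?c \<odot> (of_nat (Suc n) \<odot> (y \<otimes> \<eta> [^] n))"
          unfolding d\<eta>p[symmetric] by (rule E.d_smult) simp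
        also have "\<dots> = (?c * of_nat (Suc n)) \<odot> (y \<otimes> \<eta> [^] n)" by (rule E.smult_assoc1[symmetric]) simp
        also have "?c * of_nat (Suc n) = 1" by (simp del: of_nat_Suc)
        finally show ?thesis by simp
      qed
      from m01 show "dE (H ?z) \<oplus> H (dE ?z) \<oplus> (if m = 0 \<and> n = 0 then \<iota> s else \<zero>) = ?z"
      proof cases
        case 1
        have Hz: "H ?z = \<zero>" unfolding HF[OF m n sc(1)] F_def using 1 by simp
        have z: "?z = \<iota> s \<otimes> \<eta> [^] n" using 1 by simp
        have Hd: "H (\<iota> (differential D s) \<otimes> \<eta> [^] n) = \<zero>"
          using HF[OF m n sc(4)] 1 by (simp add: F_def)
        show ?thesis
        proof (cases n)
          case 0
          then have "dE ?z = \<iota> (differential D s) \<otimes> \<eta> [^] n" unfolding z using \<iota>_d sc by simp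
          then show ?thesis using Hz Hd 0 1 sc by simp
        next
          case (Suc n')
          let ?m = "of_nat (Suc n') :: 'k"
          have sm: "?m \<odot>\<^bsub>D\<^esub> s \<in> carrier D" "?m \<odot>\<^bsub>D\<^esub> s \<in> homog D k" using s sc by blast+
          \<comment> \<open>The factor \<open>n\<close> from differentiating \<open>\<eta>^n\<close>
            is moved into the coefficient \<open>s\<close>, so that \<open>?v\<close> is literally a
            term on which \<open>H\<close> is prescribed. It cancels against the denominator
            below.\<close>
          let ?v = "\<iota> (?m \<odot>\<^bsub>D\<^esub> s) \<otimes> (y [^] (1::nat) \<otimes> \<eta> [^] n')"
          have vc: "?v \<in> carrier E" using \<iota>_simps(6) sm by simp
          have dn: "dE (\<eta> [^] n) = ?m \<odot> (y \<otimes> \<eta> [^] n')" unfolding Suc by (rule d\<eta>p)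
          have v: "\<iota> s \<otimes> dE (\<eta> [^] n) = ?v"
            unfolding dn using sc by (simp add: \<iota>_simps(4) E.smult_mult_l E.smult_mult_r del: of_nat_Suc)
          have "dE ?z = \<iota> (differential D s) \<otimes> \<eta> [^] n \<oplus> sgn_mul E k ?v"
            unfolding z using d_gen[OF s, of "\<eta> [^] n"] v by simp
          then have "H (dE ?z) = sgn_mul E k (H ?v)"
            using sc vc Hd h(1) by (simp add: h(2) hs del: of_nat_Suc)
          also have "H ?v = \<iota> (par D (?m \<odot>\<^bsub>D\<^esub> s)) \<otimes> ((1 / ?m) \<odot> \<eta> [^] n)"
            using HF[OF pw_1(2) pwd sm(1), of n'] Suc by (simp add: F_def del: of_nat_Suc E.nat_pow_Suc)
          also have "\<dots> = sgn_mul E k (\<iota> s \<otimes> \<eta> [^] n)"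
          proof -
            have "\<iota> (par D (?m \<odot>\<^bsub>D\<^esub> s)) = ?m \<odot> sgn_mul E k (\<iota> s)"
              using sc by (simp only: \<iota>_par[OF sm(2)] \<iota>_simps(4) E.sgn_mul_smult)
            then have "\<iota> (par D (?m \<odot>\<^bsub>D\<^esub> s)) \<otimes> ((1 / ?m) \<odot> \<eta> [^] n) = 
              ?m \<odot> ((1 / ?m) \<odot> sgn_mul E k (\<iota> s \<otimes> \<eta> [^] n))"
              using sc by (simp add: E.smult_mult_l E.smult_mult_r E.sgn_mul_mult_l del: of_nat_Suc flip: E.smult_assoc1)
            also have "\<dots> = (?m * (1 / ?m)) \<odot> sgn_mul E k (\<iota> s \<otimes> \<eta> [^] n)"
              by (rule E.smult_assoc1[symmetric]) (use sc in simp)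
            also have "?m * (1 / ?m) = 1" by (simp del: of_nat_Suc)
            finally show ?thesis using sc by simp
          qed
          finally have "H (dE ?z) = ?z" using sc z by (simp add: cancel_sgn)
          then show ?thesis using Hz Suc sc by simp
        qed
      next
        case 2
        have z: "?z = \<iota> s \<otimes> (y \<otimes> \<eta> [^] n)" using 2 by simp
        have Hz: "H ?z = sgn_mul E k (\<iota> s \<otimes> ?w)"
          unfolding HF[OF m n sc(1)] F_def using 2 sc wc by (simp add: \<iota>_par[OF s] E.sgn_mul_mult_l del: of_nat_Suc E.nat_pow_Suc)
        \<comment> \<open>The differential of \<open>\<eta>^n\<close> contains \<open>y\<close>, and
          \<open>y\<close> times \<open>y\<close> is zero for odd \<open>d\<close>.\<close>
        have d0: "dE (y \<otimes> \<eta> [^] n) = \<zero>"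
        proof (cases n)
          case 0
          then show ?thesis by (simp add: dy)
        next
          case (Suc n')
          have "y \<otimes> dE (\<eta> [^] n) = \<zero>"
            unfolding Suc d\<eta>p by (simp add: E.smult_mult_r yy flip: E.m_assoc)
          then show ?thesis using E.leibniz[OF y, of "\<eta> [^] n"] by (simp add: dy)
        qed
        have dz: "dE ?z = \<iota> (differential D s) \<otimes> (y [^] m \<otimes> \<eta> [^] n)"
          unfolding z using d_gen[OF s, of "y \<otimes> \<eta> [^] n"] d0 2 sc by simp
        have Hdz: "H (dE ?z) = sgn_mul E (k + 1) (\<iota> (differential D s) \<otimes> ?w)"
          unfolding dz HF[OF m n sc(4)] F_def using 2 sc wc
          by (simp add: \<iota>_par[OF sc(5)] E.sgn_mul_mult_l del: of_nat_Suc E.nat_pow_Suc)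
        have "dE (H ?z) = sgn_mul E k (\<iota> (differential D s) \<otimes> ?w \<oplus> sgn_mul E k (\<iota> s \<otimes> (y \<otimes> \<eta> [^] n)))"
          unfolding Hz dw[symmetric] d_gen[OF s wc, symmetric] by (rule E.d_sgn_mul) (use sc wc in blast)
        also have "\<dots> = sgn_mul E k (\<iota> (differential D s) \<otimes> ?w) \<oplus> ?z"
          unfolding z using sc wc by (simp add: E.sgn_mul_add cancel_sgn del: of_nat_Suc E.nat_pow_Suc)
        finally have "dE (H ?z) \<oplus> H (dE ?z) = ?z \<oplus> (sgn_mul E k (\<iota> (differential D s) \<otimes> ?w) \<oplus> sgn_mul E (k + 1) (\<iota> (differential D s) \<otimes> ?w))"
          unfolding Hdz using sc wc by (simp add: E.a_ac del: of_nat_Suc E.nat_pow_Suc)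
        also have "\<dots> = ?z" using sc wc by (simp add: cancel_sgn del: of_nat_Suc E.nat_pow_Suc)
        finally show ?thesis using 2 sc by simp
      qed
    qed
    then show ?thesis using H contracting_all[OF H] by blast
  qed
qed

text \<open>For a cocycle the homotopy identity loses the term \<open>H (dE z)\<close>, so
  \<open>c = H z\<close> works in either parity of \<open>d\<close>.\<close>

lemma cocycle_decomp:
  assumes z: "z \<in> homog E n" "dE z = \<zero>"
  shows "\<exists>c\<in>homog E (n - 1). z = dE c \<oplus> \<iota> (\<pi> z) \<and> \<pi> c = \<zero>\<^bsub>D\<^esub>"
proof -
  obtain H where H: "add_map E E (carrier E) H" "\<forall>z\<in>carrier E. contracting H z"
    using homotopy_even homotopy_odd by blast
  have zc: "z \<in> carrier E" using z by blast
  have h0: "H \<zero> = \<zero>" by (rule add_map_zero[OF E.abelian_group_axioms E.abelian_group_axioms E.asub_carrier H(1)])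
  have Hc: "H z \<in> carrier E" by (rule add_mapD(1)[OF H(1) zc])
  have c: "dE (H z) \<oplus> H (dE z) \<oplus> \<iota> (\<pi> z) = z" "\<pi> (H z) = \<zero>\<^bsub>D\<^esub>" "H (hcomp E n z) = hcomp E (n - 1) (H z)"
    using H(2) zc unfolding contracting_def by blast+
  have "H z \<in> homog E (n - 1)"
    using c(3) E.hcomp_homog[OF z(1), of n] E.hcomp_in[OF Hc, of "n - 1"] by simp
  moreover have "z = dE (H z) \<oplus> \<iota> (\<pi> z)" using c(1) z(2) h0 Hc by simp
  ultimately show ?thesis using c(2) by blast
qed

end

lemma dclosed_carrier: "is_dga A \<Longrightarrow> dclosed A (carrier A)"
proof -
  assume "is_dga A"
  then interpret A: dg_algebra A by unfold_locales
  show ?thesis by (simp add: dclosed_def)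
qed

lemma shom_id: "is_dga A \<Longrightarrow> gsub A S \<Longrightarrow> shom A S A (\<lambda>x. x)"
  by (auto simp: shom_def add_map_def gsub_def asub_def)

text \<open>With \<open>y\<close> a free cocycle and \<open>\<eta>\<close> a free variable whose
  differential is \<open>y\<close>, the generator returned is \<open>Y = y + b\<close>. Hence
  \<open>\<pi> Y = b\<close>, the differential of \<open>Y\<close> is that of \<open>b\<close>, and
  \<open>Y\<close>, \<open>\<eta>\<close> remain free over \<open>D\<close> by
  \<open>shift_basis\<close>. The contraction itself is computed in the unshifted variables.\<close>

lemma contractible_extension:
  fixes D :: "('k::field_char_0, 't) dga" and enc :: "(nat \<Rightarrow> 't) \<Rightarrow> 't"
  assumes D: "is_dga D" and b: "b \<in> homog D d" and enc: "inj enc"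
  obtains E :: "('k, 't) dga" and \<iota> \<pi> Y \<eta> where "is_dga E" "dga_hom D E \<iota>" "dga_hom E D \<pi>"
    "\<And>s. s \<in> carrier D \<Longrightarrow> \<pi> (\<iota> s) = s" "Y \<in> homog E d" "\<eta> \<in> homog E (d - 1)"
    "differential E Y = \<iota> (differential D b)" "\<pi> Y = b"
    "\<And>n z. z \<in> homog E n \<Longrightarrow> differential E z = \<zero>\<^bsub>E\<^esub> \<Longrightarrow>
       \<exists>c\<in>homog E (n - 1). z = differential E c \<oplus>\<^bsub>E\<^esub> \<iota> (\<pi> z) \<and> \<pi> c = \<zero>\<^bsub>D\<^esub>"
    "fbasis D (carrier D) E \<iota> (pw d \<times> pw (d - 1)) (\<lambda>(m, n). Y [^]\<^bsub>E\<^esub> m \<otimes>\<^bsub>E\<^esub> \<eta> [^]\<^bsub>E\<^esub> n)"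
    "fspan (carrier D) E \<iota> (pw d \<times> pw (d - 1)) (\<lambda>(m, n). Y [^]\<^bsub>E\<^esub> m \<otimes>\<^bsub>E\<^esub> \<eta> [^]\<^bsub>E\<^esub> n) = carrier E"
proof -
  interpret D: dg_algebra D by unfold_locales fact
  obtain E1 :: "('k, 't) dga" and \<iota>1 y1 where E1: "is_dga E1" "dga_hom D E1 \<iota>1" "y1 \<in> homog E1 d"
    "differential E1 y1 = \<iota>1 \<zero>\<^bsub>D\<^esub>" "fbasis D (carrier D) E1 \<iota>1 (pw d) (\<lambda>i. y1 [^]\<^bsub>E1\<^esub> i)"
    "fspan (carrier D) E1 \<iota>1 (pw d) (\<lambda>i. y1 [^]\<^bsub>E1\<^esub> i) = carrier E1"
    using adjoin_variable[OF D D.homog_zero D.d_zero enc] by blast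
  interpret E1: dg_algebra E1 by unfold_locales (rule E1(1))
  note i1 = dga_hom_iff_shom[OF D E1(1), THEN iffD1, OF E1(2)]
  interpret p1: pow_span D E1 "carrier D" \<iota>1 d y1
    by unfold_locales (rule D.gsub_carrier i1[THEN conjunct1] E1(3))+
  have dy1: "differential E1 y1 = \<zero>\<^bsub>E1\<^esub>" using E1(4) p1.\<iota>_simps(8) by simp
  have y1: "y1 \<in> homog E1 (d - 1 + 1)" using E1(3) by simp
  obtain E :: "('k, 't) dga" and \<iota>2 \<eta> where E: "is_dga E" "dga_hom E1 E \<iota>2" "\<eta> \<in> homog E (d - 1)"
    "differential E \<eta> = \<iota>2 y1" "fbasis E1 (carrier E1) E \<iota>2 (pw (d - 1)) (\<lambda>i. \<eta> [^]\<^bsub>E\<^esub> i)"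
    "fspan (carrier E1) E \<iota>2 (pw (d - 1)) (\<lambda>i. \<eta> [^]\<^bsub>E\<^esub> i) = carrier E"
    using adjoin_variable[OF E1(1) y1 dy1 enc] by blast
  interpret E: dg_algebra E by unfold_locales (rule E(1))
  note i2 = dga_hom_iff_shom[OF E1(1) E(1), THEN iffD1, OF E(2)]
  interpret p2: pow_span E1 E "carrier E1" \<iota>2 "d - 1" \<eta>
    by unfold_locales (rule E1.gsub_carrier i2[THEN conjunct1] E(3))+
  define \<iota> where "\<iota> s = \<iota>2 (\<iota>1 s)" for s
  have \<iota>: "dga_hom D E \<iota>" unfolding \<iota>_def by (rule dga_hom_comp[OF E1(2) E(2)])
  note i = dga_hom_iff_shom[OF D E(1), THEN iffD1, OF \<iota>]
  obtain \<pi>1 where \<pi>1: "shom E1 (carrier E1) D \<pi>1" "\<And>s. s \<in> carrier D \<Longrightarrow> \<pi>1 (\<iota>1 s) = s" "\<pi>1 y1 = \<zero>\<^bsub>D\<^esub>"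
    using p1.pow_ext[OF D E1(5) shom_id[OF D D.gsub_carrier] D.homog_zero, unfolded E1(6)] by metis
  have \<pi>1d: "dmap E1 (carrier E1) D \<pi>1"
    by (rule p1.pow_ext_dmap[OF D dclosed_carrier[OF D] i1[THEN conjunct2] _ D.zero_closed E1(4) _ _, of "\<lambda>x. x" \<pi>1, unfolded E1(6)])
      (use \<pi>1 in \<open>auto simp: dmap_def\<close>)
  obtain \<pi> where \<pi>: "shom E (carrier E) D \<pi>" "\<And>s. s \<in> carrier E1 \<Longrightarrow> \<pi> (\<iota>2 s) = \<pi>1 s" "\<pi> \<eta> = \<zero>\<^bsub>D\<^esub>"
    using p2.pow_ext[OF D E(5) \<pi>1(1) D.homog_zero, unfolded E(6)] by metis
  have \<pi>d: "dmap E (carrier E) D \<pi>"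
    by (rule p2.pow_ext_dmap[OF D dclosed_carrier[OF E1(1)] i2[THEN conjunct2] \<pi>1d _ E(4) _ _, of \<pi>, unfolded E(6)])
      (use \<pi> \<pi>1 in auto)
  have \<pi>\<iota>: "\<pi> (\<iota> s) = s" if "s \<in> carrier D" for s
    using \<pi>(2) \<pi>1(2) that by (simp add: \<iota>_def)
  have pow: "\<iota>2 (w [^]\<^bsub>E1\<^esub> k) = \<iota>2 w [^]\<^bsub>E\<^esub> k" if "w \<in> carrier E1" for w and k :: nat
    by (rule p2.\<iota>_simps(12)[OF that])
  \<comment> \<open>Stated for every \<open>w\<close> whose powers form a basis of
    \<open>E1\<close>, because it is used twice: for \<open>y1\<close> in the contraction and for
    the shifted variable in the conclusion.\<close>
  have basis: "fbasis D (carrier D) E \<iota> (pw d \<times> pw (d - 1)) (\<lambda>(m, n). \<iota>2 w [^]\<^bsub>E\<^esub> m \<otimes>\<^bsub>E\<^esub> \<eta> [^]\<^bsub>E\<^esub> n)"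
    "fspan (carrier D) E \<iota> (pw d \<times> pw (d - 1)) (\<lambda>(m, n). \<iota>2 w [^]\<^bsub>E\<^esub> m \<otimes>\<^bsub>E\<^esub> \<eta> [^]\<^bsub>E\<^esub> n) = carrier E"
    if w: "w \<in> carrier E1" and b: "fbasis D (carrier D) E1 \<iota>1 (pw d) (\<lambda>i. w [^]\<^bsub>E1\<^esub> i)"
      "fspan (carrier D) E1 \<iota>1 (pw d) (\<lambda>i. w [^]\<^bsub>E1\<^esub> i) = carrier E1" for w
    using fbasis_trans[OF D.abelian_group_axioms E1.ring_axioms E.ring_axioms b E(5) p2.\<iota>_simps(3)]
    unfolding pow[OF w] E(6) \<iota>_def by auto
  have y1c: "y1 \<in> carrier E1" using E1(3) by blast
  interpret K: contraction D E \<iota> \<pi> d "\<iota>2 y1" \<eta>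
  proof unfold_locales
    show "differential E (\<iota>2 y1) = \<zero>\<^bsub>E\<^esub>"
    proof -
      have "differential E (\<iota>2 y1) = \<iota>2 (differential E1 y1)" using i2[THEN conjunct2] y1c by (simp add: dmap_def)
      then show ?thesis using dy1 p2.\<iota>_simps(8) by simp
    qed
    show "\<pi> (\<iota>2 y1) = \<zero>\<^bsub>D\<^esub>" using \<pi>(2) \<pi>1(3) y1c by simp
    show "\<iota>2 y1 \<in> homog E d" using p2.\<iota>_simps(5)[OF y1c E1(3)] .
  qed (use i \<pi> \<pi>\<iota> E basis[OF y1c E1(5,6)] in auto)
  define w where "w = y1 \<oplus>\<^bsub>E1\<^esub> \<iota>1 b"
  have bc: "b \<in> carrier D" using b by blast
  have w: "w \<in> homog E1 d" unfolding w_def using E1(3) p1.\<iota>_simps(5)[OF bc b] by blast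
  then have wc: "w \<in> carrier E1" by blast
  note sh = p1.shift_basis[OF E1(5) bc b, folded w_def, unfolded E1(6)]
  show thesis
  proof (rule that[OF E(1) \<iota> _ \<pi>\<iota> p2.\<iota>_simps(5)[OF wc w] E(3)])
    show "dga_hom E D \<pi>" using \<pi>(1) \<pi>d dga_hom_iff_shom[OF E(1) D] by blast
    have "differential E1 w = \<iota>1 (differential D b)"
      unfolding w_def using y1c bc i1[THEN conjunct2] by (simp add: E1.d_add dy1 dmap_def)
    then show "differential E (\<iota>2 w) = \<iota> (differential D b)"
      using i2[THEN conjunct2] wc unfolding dmap_def \<iota>_def by metis
    show "\<pi> (\<iota>2 w) = b" using \<pi>(2)[OF wc] \<pi>1 y1c bc
      by (simp add: w_def shomD(7)[OF \<pi>1(1)])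
    show "\<exists>c\<in>homog E (n - 1). z = differential E c \<oplus>\<^bsub>E\<^esub> \<iota> (\<pi> z) \<and> \<pi> c = \<zero>\<^bsub>D\<^esub>"
      if "z \<in> homog E n" "differential E z = \<zero>\<^bsub>E\<^esub>" for n z
      by (rule K.cocycle_decomp[OF that])
  qed (use basis[OF wc sh] in auto)
qed

section \<open>Monomials\<close>

context dg_algebra begin

lemma foldr_acc:
  assumes "\<forall>i\<in>set l. y i \<in> carrier D" "z \<in> carrier D"
  shows "foldr (\<lambda>i acc. y i \<otimes> acc) l z = foldr (\<lambda>i acc. y i \<otimes> acc) l \<one> \<otimes> z" "foldr (\<lambda>i acc. y i \<otimes> acc) l z \<in> carrier D"
proof -
  have c: "foldr (\<lambda>i acc. y i \<otimes> acc) l z \<in> carrier D" if "\<forall>i\<in>set l. y i \<in> carrier D" "z \<in> carrier D" for l z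
    using that by (induction l) auto
  then show "foldr (\<lambda>i acc. y i \<otimes> acc) l z \<in> carrier D" using assms by blast
  show "foldr (\<lambda>i acc. y i \<otimes> acc) l z = foldr (\<lambda>i acc. y i \<otimes> acc) l \<one> \<otimes> z"
    using assms
  proof (induction l)
    case (Cons i l)
    have "foldr (\<lambda>i acc. y i \<otimes> acc) l \<one> \<in> carrier D" using Cons by (intro c) auto
    then show ?case using Cons by (simp add: m_assoc)
  qed simp
qed

definition mdeg :: "(nat \<Rightarrow> int) \<Rightarrow> nat \<Rightarrow> (nat \<Rightarrow> nat) \<Rightarrow> int" where
  "mdeg dg n e = (\<Sum>i<n. int (e i) * dg i)"

lemma monomial_0: "monomial D x 0 e = \<one>"
  by (simp add: monomial_def)

lemma monomial_Suc:
  assumes "\<forall>i<Suc n. x i \<in> carrier D"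
  shows "monomial D x (Suc n) e = monomial D x n e \<otimes> x n [^] e n"
  unfolding monomial_def using assms
  by (simp, subst foldr_acc) auto

lemma monomial_closed: "\<forall>i<n. x i \<in> carrier D \<Longrightarrow> monomial D x n e \<in> carrier D"
  by (induction n) (auto simp: monomial_0 monomial_Suc)

lemma monomial_cong: "(\<And>i. i < n \<Longrightarrow> x i = x' i) \<Longrightarrow> (\<And>i. i < n \<Longrightarrow> e i = e' i) \<Longrightarrow> monomial D x n e = monomial D x' n e'"
  unfolding monomial_def by (intro foldr_cong) auto

lemma monomial_zero_exps: "\<forall>i<n. x i \<in> carrier D \<Longrightarrow> monomial D x n (\<lambda>_. 0) = \<one>"
  by (induction n) (auto simp: monomial_0 monomial_Suc)

lemma monomial_homog: "\<forall>i<n. x i \<in> homog D (dg i) \<Longrightarrow> monomial D x n e \<in> homog D (mdeg dg n e)"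
proof (induction n)
  case 0
  then show ?case by (simp add: monomial_0 mdeg_def)
next
  case (Suc n)
  have "monomial D x n e \<otimes> x n [^] e n \<in> homog D (mdeg dg n e + int (e n) * dg n)"
    using Suc by (intro homog_mult homog_pow) auto
  then show ?case using Suc by (subst monomial_Suc) (auto simp: mdeg_def)
qed

lemma comm_up_to_sign:
  assumes "a \<in> homog D k" "b \<in> homog D l" shows "a \<otimes> b = b \<otimes> a \<or> a \<otimes> b = \<ominus> (b \<otimes> a)"
  using gcomm[OF assms] by (auto simp: sgn_mul_def split: if_splits)

text \<open>The power of \<open>x j\<close> travels left past the later variables, each time at the
  cost of at most a sign. Which sign is irrelevant, since \<open>fbasis_reindex\<close> absorbs
  it.\<close>

lemma monomial_upd:
  assumes "\<forall>i<n. x i \<in> homog D (dg i)" "j < n" "e j = 0"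
  shows "monomial D x n e \<otimes> x j [^] m = monomial D x n (e(j := m)) \<or>
     monomial D x n e \<otimes> x j [^] m = \<ominus> monomial D x n (e(j := m))"
  using assms
proof (induction n)
  case (Suc n)
  have c: "\<forall>i<Suc n. x i \<in> carrier D" using Suc(2) by blast
  have mc: "monomial D x n e' \<in> carrier D" for e' using c by (intro monomial_closed) simp
  show ?case
  proof (cases "j = n")
    case True
    define e' where "e' = e(j := m)"
    have "monomial D x n e' = monomial D x n e" "e' n = m" using True by (auto simp: e'_def intro: monomial_cong)
    then show ?thesis unfolding e'_def[symmetric] using Suc(4) True c mc by (simp add: monomial_Suc)
  next
    case False
    then have j: "j < n" using Suc(3) by simp
    have xj: "x j [^] m \<in> homog D (int m * dg j)" "x n [^] e n \<in> homog D (int (e n) * dg n)"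
      using Suc(2) Suc(3) by (auto intro!: homog_pow)
    have cc: "x j [^] m \<in> carrier D" "x n [^] e n \<in> carrier D" using xj by blast+
    let ?u = "monomial D x n e" and ?v = "monomial D x n (e(j := m))"
    have IH: "?u \<otimes> x j [^] m = ?v \<or> ?u \<otimes> x j [^] m = \<ominus> ?v"
      by (rule Suc.IH) (use Suc.prems j in auto)
    have L: "monomial D x (Suc n) e \<otimes> x j [^] m = ?u \<otimes> (x n [^] e n \<otimes> x j [^] m)"
      using c cc mc by (simp add: monomial_Suc m_assoc)
    have R: "monomial D x (Suc n) (e(j := m)) = ?v \<otimes> x n [^] e n"
      using c False by (simp add: monomial_Suc)
    have M: "?u \<otimes> (x j [^] m \<otimes> x n [^] e n) = ?u \<otimes> x j [^] m \<otimes> x n [^] e n"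
      using cc mc by (simp add: m_assoc)
    show ?thesis
      unfolding L R using comm_up_to_sign[OF xj(2,1)] IH M cc mc
      by (auto simp: l_minus r_minus)
  qed
qed simp

end

lemma shom_monomial:
  assumes "is_dga D" "is_dga E" "shom D (carrier D) E \<iota>" "\<forall>i<n. x i \<in> carrier D"
  shows "\<iota> (monomial D x n e) = monomial E (\<lambda>i. \<iota> (x i)) n e"
proof -
  interpret D: dg_algebra D by unfold_locales fact
  interpret E: dg_algebra E by unfold_locales fact
  note i = shomD[OF assms(3)] shom_zero[OF assms(1,2) D.gsub_carrier assms(3)]
  show ?thesis using assms(4)
  proof (induction n)
    case 0
    then show ?case by (simp add: D.monomial_0 E.monomial_0 i(2))
  next
    case (Suc n)
    have "monomial D x n e \<in> carrier D" using Suc by (intro D.monomial_closed) simp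
    then show ?case using Suc by (simp add: D.monomial_Suc E.monomial_Suc i(3,6,12))
  qed
qed

section \<open>Finite resolving morphisms in terms of bases\<close>

lemma ground_abelian: "abelian_group (ground_dga :: ('k::field_char_0, 'k) dga)"
  by (rule abelian_groupI) (auto simp: ground_dga_def intro: exI[of _ "- x" for x])

lemma ground_simps: "carrier ground_dga = UNIV" "\<zero>\<^bsub>ground_dga\<^esub> = 0" "x \<oplus>\<^bsub>ground_dga\<^esub> y = x + y"
  by (simp_all add: ground_dga_def)

lemma asub_ground: "asub (ground_dga :: ('k::field_char_0, 'k) dga) UNIV"
  by (auto simp: asub_def ground_simps)

lemma (in dg_algebra) unit_map: "add_map (ground_dga :: ('k, 'k) dga) D UNIV (\<lambda>c. c \<odot> \<one>)"
  by (auto simp: add_map_def ground_simps smult_l_distr)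

text \<open>Turns unique representation by finite sums into coordinate functions over the ground
  field, through \<open>dsum_of_independent\<close>.\<close>

lemma resolving_basis:
  fixes A :: "('k::field_char_0, 'a) dga"
  assumes "fin_resolving_alg A"
  obtains n x dg where "\<forall>i<n. dg i \<le> 0 \<and> x i \<in> homog A (dg i)"
    "fbasis (ground_dga :: ('k, 'k) dga) UNIV A (\<lambda>c. c \<odot>\<^bsub>A\<^esub> \<one>\<^bsub>A\<^esub>) (exps n dg) (monomial A x n)"
    "fspan UNIV A (\<lambda>c. c \<odot>\<^bsub>A\<^esub> \<one>\<^bsub>A\<^esub>) (exps n dg) (monomial A x n) = carrier A"
proof -
  let ?k = "ground_dga :: ('k, 'k) dga" and ?u = "\<lambda>c. c \<odot>\<^bsub>A\<^esub> \<one>\<^bsub>A\<^esub>"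
  have A: "is_dga A" and r: "fin_resolving ?k A ?u" using assms by (auto simp: fin_resolving_alg_def)
  interpret A: dg_algebra A by unfold_locales (rule A)
  from r obtain n x dg where deg: "\<forall>i<n. dg i \<le> 0 \<and> x i \<in> homog A (dg i)"
    and ex: "\<forall>b\<in>carrier A. \<exists>a. (\<forall>e\<in>exps n dg. a e \<in> carrier ?k) \<and> finite {e \<in> exps n dg. a e \<noteq> \<zero>\<^bsub>?k\<^esub>} \<and>
        b = finsum A (\<lambda>e. ?u (a e) \<otimes>\<^bsub>A\<^esub> monomial A x n e) {e \<in> exps n dg. a e \<noteq> \<zero>\<^bsub>?k\<^esub>}"
    and un: "\<forall>a. (\<forall>e\<in>exps n dg. a e \<in> carrier ?k) \<and> finite {e \<in> exps n dg. a e \<noteq> \<zero>\<^bsub>?k\<^esub>} \<and>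
        finsum A (\<lambda>e. ?u (a e) \<otimes>\<^bsub>A\<^esub> monomial A x n e) {e \<in> exps n dg. a e \<noteq> \<zero>\<^bsub>?k\<^esub>} = \<zero>\<^bsub>A\<^esub> \<longrightarrow> (\<forall>e\<in>exps n dg. a e = \<zero>\<^bsub>?k\<^esub>)"
    unfolding fin_resolving_def by blast
  have mc: "monomial A x n e \<in> carrier A" for e using deg by (intro A.monomial_closed) blast
  then have mc': "monomial A x n \<in> exps n dg \<rightarrow> carrier A" by blast
  note sub = fbasis_asubs[OF A.ring_axioms asub_ground A.unit_map mc']
  note F = fspan_props[OF ground_abelian A.ring_axioms asub_ground A.unit_map mc']
  have "dsum ?k A (exps n dg) (\<lambda>_. UNIV) (\<lambda>e s. ?u s \<otimes>\<^bsub>A\<^esub> monomial A x n e)"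
  proof (rule dsum_of_independent[OF ground_abelian A.abelian_group_axioms sub])
    fix g J assume J: "finite J" "J \<subseteq> exps n dg" and z: "finsum A (\<lambda>e. ?u (g e) \<otimes>\<^bsub>A\<^esub> monomial A x n e) J = \<zero>\<^bsub>A\<^esub>"
    \<comment> \<open>The defining sum runs over the support of the family, so \<open>g\<close> is
      cut off outside \<open>J\<close> before uniqueness is applied.\<close>
    define a where "a e = (if e \<in> J then g e else 0)" for e
    have s: "{e \<in> exps n dg. a e \<noteq> 0} \<subseteq> J" by (auto simp: a_def)
    have "finsum A (\<lambda>e. ?u (a e) \<otimes>\<^bsub>A\<^esub> monomial A x n e) {e \<in> exps n dg. a e \<noteq> 0} = finsum A (\<lambda>e. ?u (a e) \<otimes>\<^bsub>A\<^esub> monomial A x n e) J"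
      using J s mc by (intro A.finsum_enlarge) auto
    also have "\<dots> = finsum A (\<lambda>e. ?u (g e) \<otimes>\<^bsub>A\<^esub> monomial A x n e) J"
      using mc by (intro A.finsum_cong') (auto simp: a_def)
    finally have "finsum A (\<lambda>e. ?u (a e) \<otimes>\<^bsub>A\<^esub> monomial A x n e) {e \<in> exps n dg. a e \<noteq> 0} = \<zero>\<^bsub>A\<^esub>" using z by simp
    moreover have "finite {e \<in> exps n dg. a e \<noteq> 0}" using J(1) s finite_subset by blast
    ultimately have "(\<forall>e\<in>exps n dg. a e \<in> carrier ?k) \<and> finite {e \<in> exps n dg. a e \<noteq> \<zero>\<^bsub>?k\<^esub>} \<and>
        finsum A (\<lambda>e. ?u (a e) \<otimes>\<^bsub>A\<^esub> monomial A x n e) {e \<in> exps n dg. a e \<noteq> \<zero>\<^bsub>?k\<^esub>} = \<zero>\<^bsub>A\<^esub>"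
      by (simp add: ground_simps)
    then have "\<forall>e\<in>exps n dg. a e = \<zero>\<^bsub>?k\<^esub>" by (rule un[THEN spec, THEN mp])
    note a0 = this
    show "\<forall>e\<in>J. g e = \<zero>\<^bsub>?k\<^esub>"
    proof
      fix e assume "e \<in> J"
      then have "a e = \<zero>\<^bsub>?k\<^esub>" using a0 J(2) by blast
      then show "g e = \<zero>\<^bsub>?k\<^esub>" using \<open>e \<in> J\<close> by (simp add: a_def)
    qed
  qed
  then have B: "fbasis ?k UNIV A ?u (exps n dg) (monomial A x n)"
    unfolding fbasis_def dsum_def using mc asub_ground A.unit_map by blast
  have "carrier A \<subseteq> fspan UNIV A ?u (exps n dg) (monomial A x n)"
  proof
    fix b assume "b \<in> carrier A"
    then obtain a where "b = finsum A (\<lambda>e. ?u (a e) \<otimes>\<^bsub>A\<^esub> monomial A x n e) {e \<in> exps n dg. a e \<noteq> \<zero>\<^bsub>?k\<^esub>}"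
      using ex by blast
    also have "\<dots> \<in> fspan UNIV A ?u (exps n dg) (monomial A x n)"
      by (rule A.asub_finsum[OF F(1)]) (use F(2) in auto)
    finally show "b \<in> fspan UNIV A ?u (exps n dg) (monomial A x n)" .
  qed
  then have "fspan UNIV A ?u (exps n dg) (monomial A x n) = carrier A" using F(3) by blast
  from that[OF deg B this] show thesis .
qed

text \<open>The way back from coordinates: they are the coefficients for existence, and applying
  them to a vanishing sum gives independence.\<close>

lemma fin_resolvingI:
  assumes "is_dga A" "is_dga D" "dga_hom A D g" "\<forall>i<n. dg i \<le> 0 \<and> x i \<in> homog D (dg i)"
    and B: "fbasis A (carrier A) D g (exps n dg) (monomial D x n)"
    and sp: "fspan (carrier A) D g (exps n dg) (monomial D x n) = carrier D"
  shows "fin_resolving A D g"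
proof -
  interpret A: dg_algebra A by unfold_locales fact
  interpret D: dg_algebra D by unfold_locales fact
  let ?j = "\<lambda>e s. g s \<otimes>\<^bsub>D\<^esub> monomial D x n e"
  note b = fbasis_basic[OF B]
  obtain \<kappa> where \<kappa>: "coords A D (exps n dg) (\<lambda>_. carrier A) ?j \<kappa>"
    using B unfolding fbasis_def by blast
  note sub = fbasis_asubs[OF D.ring_axioms b(1-3)]
  note P = coords_props[OF A.abelian_group_axioms D.abelian_group_axioms sub \<kappa>, folded fspan_def, unfolded sp]
  note Q = coords_finsum[OF A.abelian_group_axioms D.abelian_group_axioms sub \<kappa>, folded fspan_def, unfolded sp]
  have "\<exists>a. (\<forall>e\<in>exps n dg. a e \<in> carrier A) \<and> finite {e \<in> exps n dg. a e \<noteq> \<zero>\<^bsub>A\<^esub>} \<and>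
      z = finsum D (\<lambda>e. ?j e (a e)) {e \<in> exps n dg. a e \<noteq> \<zero>\<^bsub>A\<^esub>}" if "z \<in> carrier D" for z
    using P[OF that] Q[OF that] by (intro exI[of _ "\<lambda>e. \<kappa> e z"]) blast
  moreover have "\<forall>e\<in>exps n dg. a e = \<zero>\<^bsub>A\<^esub>"
    if a: "\<forall>e\<in>exps n dg. a e \<in> carrier A" "finite {e \<in> exps n dg. a e \<noteq> \<zero>\<^bsub>A\<^esub>}"
      "finsum D (\<lambda>e. ?j e (a e)) {e \<in> exps n dg. a e \<noteq> \<zero>\<^bsub>A\<^esub>} = \<zero>\<^bsub>D\<^esub>" for a
  proof
    fix l assume l: "l \<in> exps n dg"
    have "\<kappa> l (finsum D (\<lambda>e. ?j e (a e)) {e \<in> exps n dg. a e \<noteq> \<zero>\<^bsub>A\<^esub>}) = 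
        (if l \<in> {e \<in> exps n dg. a e \<noteq> \<zero>\<^bsub>A\<^esub>} then a l else \<zero>\<^bsub>A\<^esub>)"
      by (rule coords_unique[OF A.abelian_group_axioms D.abelian_group_axioms sub \<kappa> a(2) _ _ l]) (use a in auto)
    moreover have "add_map D A (carrier D) (\<kappa> l)"
      using \<kappa> l sp by (simp add: coords_def fspan_def)
    then have "\<kappa> l \<zero>\<^bsub>D\<^esub> = \<zero>\<^bsub>A\<^esub>"
      by (rule add_map_zero[OF D.abelian_group_axioms A.abelian_group_axioms D.asub_carrier])
    ultimately show "a l = \<zero>\<^bsub>A\<^esub>" using a(3) l by (cases "a l = \<zero>\<^bsub>A\<^esub>") auto
  qed
  ultimately show ?thesis unfolding fin_resolving_def using assms(3,4) by blast
qed

section \<open>Attaching the generators one at a time\<close>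

locale resolving_data = A: dg_algebra A for A :: "('k::field_char_0, 'a) dga" +
  fixes n :: nat and x :: "nat \<Rightarrow> 'a" and dg :: "nat \<Rightarrow> int"
  assumes deg: "\<forall>i<n. dg i \<le> 0 \<and> x i \<in> homog A (dg i)"
    and basis: "fbasis (ground_dga :: ('k, 'k) dga) UNIV A (\<lambda>c. c \<odot>\<^bsub>A\<^esub> \<one>\<^bsub>A\<^esub>) (exps n dg) (monomial A x n)"
    and span: "fspan UNIV A (\<lambda>c. c \<odot>\<^bsub>A\<^esub> \<one>\<^bsub>A\<^esub>) (exps n dg) (monomial A x n) = carrier A"
begin

abbreviation unit :: "'k \<Rightarrow> 'a" where "unit \<equiv> \<lambda>c. c \<odot>\<^bsub>A\<^esub> \<one>\<^bsub>A\<^esub>"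
abbreviation kk :: "('k, 'k) dga" where "kk \<equiv> ground_dga"

definition exps_on :: "nat set \<Rightarrow> (nat \<Rightarrow> nat) set" where
  "exps_on J = {e \<in> exps n dg. \<forall>i. i \<notin> J \<longrightarrow> e i = 0}"

text \<open>By definition only a vector space spanned by monomials. Closure under products and the
  differential is carried in \<open>stage\<close> and obtained one variable at a time.\<close>

definition subalg :: "nat set \<Rightarrow> 'a set" where
  "subalg J = fspan UNIV A unit (exps_on J) (monomial A x n)"

lemma exps_on_sub: "exps_on J \<subseteq> exps n dg" by (auto simp: exps_on_def)

lemma x_homog: "\<forall>i<n. x i \<in> homog A (dg i)" using deg by blast

lemma mono_c [simp]: "monomial A x n e \<in> carrier A"
  using deg by (intro A.monomial_closed) blast

lemma exps_on_all: "exps_on {..<n} = exps n dg"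
  by (auto simp: exps_on_def exps_def)

lemma subalg_all: "subalg {..<n} = carrier A"
  by (simp add: subalg_def exps_on_all span)

lemma exps_on_empty: "exps_on {} = {\<lambda>_. 0}"
  by (auto simp: exps_on_def exps_def)

lemma mono_funcset: "monomial A x n \<in> I \<rightarrow> carrier A" by simp

lemmas subalg_props = fspan_props[OF ground_abelian A.ring_axioms asub_ground A.unit_map mono_funcset[of "exps_on J"], folded subalg_def] for J

lemma subalg_basis: "fbasis kk UNIV A unit (exps_on J) (monomial A x n)"
  by (rule fbasis_subset[OF ground_abelian A.ring_axioms basis exps_on_sub])

lemma unit_mult: "unit c \<otimes>\<^bsub>A\<^esub> unit c' = unit (c * c')"
  by (simp add: A.smult_mult_l A.smult_mult_r mult.commute flip: A.smult_assoc1)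

lemma subalg_empty: "subalg {} = range unit"
proof -
  have m1: "monomial A x n (\<lambda>_. 0) = \<one>\<^bsub>A\<^esub>" using deg by (intro A.monomial_zero_exps) blast
  have g: "unit c \<otimes>\<^bsub>A\<^esub> monomial A x n (\<lambda>_. 0) = unit c" for c by (simp add: m1)
  have sub: "asub A (range unit)"
    unfolding asub_def
  proof (intro conjI ballI)
    have "\<zero>\<^bsub>A\<^esub> = unit 0" by simp
    then show "\<zero>\<^bsub>A\<^esub> \<in> range unit" by blast
    fix u v assume "u \<in> range unit" "v \<in> range unit"
    then obtain a b where "u = unit a" "v = unit b" by blast
    then have "u \<oplus>\<^bsub>A\<^esub> v = unit (a + b)" "\<ominus>\<^bsub>A\<^esub> u = unit (- 1 * a)"
      by (simp_all only: A.smult_l_distr[OF A.one_closed] A.smult_assoc1[OF A.one_closed] A.smult_m1[OF A.smult_closed[OF A.one_closed]])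
    then show "u \<oplus>\<^bsub>A\<^esub> v \<in> range unit" "\<ominus>\<^bsub>A\<^esub> u \<in> range unit" by blast+
  qed auto
  show ?thesis
  proof
    show "subalg {} \<subseteq> range unit" unfolding subalg_def
      by (rule fspan_least[OF sub]) (auto simp: exps_on_empty g)
    show "range unit \<subseteq> subalg {}"
      using subalg_props(2)[of "\<lambda>_. 0" "{}"] by (auto simp: exps_on_empty g)
  qed
qed

lemma subalg_empty_gsub: "gsub A (subalg {})" "dclosed A (subalg {})"
proof -
  have u: "unit c \<in> homog A 0" for c by blast
  have m: "u \<otimes>\<^bsub>A\<^esub> v \<in> range unit" if "u \<in> range unit" "v \<in> range unit" for u v
  proof -
    obtain a b where "u = unit a" "v = unit b" using \<open>u \<in> range unit\<close> \<open>v \<in> range unit\<close> by blast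
    then have "u \<otimes>\<^bsub>A\<^esub> v = unit (a * b)" by (simp only: unit_mult)
    then show ?thesis by blast
  qed
  have sm: "c \<odot>\<^bsub>A\<^esub> unit b = unit (c * b)" for c b by (simp add: A.smult_assoc1)
  have z: "\<zero>\<^bsub>A\<^esub> = unit 0" by simp
  show "gsub A (subalg {})"
    unfolding gsub_def
  proof (intro conjI allI ballI)
    show "asub A (subalg {})" by (rule subalg_props(1))
    have "\<one>\<^bsub>A\<^esub> = unit 1" by simp
    then show "\<one>\<^bsub>A\<^esub> \<in> subalg {}" unfolding subalg_empty by blast
    fix u assume "u \<in> subalg {}"
    then obtain a where a: "u = unit a" unfolding subalg_empty by blast
    show "c \<odot>\<^bsub>A\<^esub> u \<in> subalg {}" for c unfolding subalg_empty a sm by blast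
    show "hcomp A k u \<in> subalg {}" for k
      unfolding subalg_empty a A.hcomp_homog[OF u] using z by (auto simp del: A.smult_0_left)
    show "u \<otimes>\<^bsub>A\<^esub> v \<in> subalg {}" if "v \<in> subalg {}" for v
      using that \<open>u \<in> subalg {}\<close> m unfolding subalg_empty by blast
  qed
  show "dclosed A (subalg {})"
  proof -
    have "differential A (unit c) = unit 0" for c by (simp add: A.d_smult)
    then show ?thesis unfolding dclosed_def subalg_empty by blast
  qed
qed

text \<open>Up to sign, a monomial on \<open>insert j J\<close> is a monomial on \<open>J\<close>
  times a power of \<open>x j\<close>. Regrouping the basis over the ground field with
  \<open>fbasis_factor\<close> turns these powers into a basis over \<open>subalg J\<close>.\<close>

lemma subalg_step:
  assumes J: "j \<notin> J" "j < n"
  shows "fbasis A (subalg J) A (\<lambda>s. s) (pw (dg j)) (\<lambda>m. x j [^]\<^bsub>A\<^esub> m)"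
    "fspan (subalg J) A (\<lambda>s. s) (pw (dg j)) (\<lambda>m. x j [^]\<^bsub>A\<^esub> m) = subalg (insert j J)"
proof -
  let ?v = "\<lambda>(e, m). monomial A x n e \<otimes>\<^bsub>A\<^esub> x j [^]\<^bsub>A\<^esub> (m::nat)"
  let ?\<beta> = "\<lambda>(e::nat \<Rightarrow> nat, m). e(j := m)"
  have xj: "x j \<in> carrier A" using deg J by blast
  have bij: "bij_betw ?\<beta> (exps_on J \<times> pw (dg j)) (exps_on (insert j J))"
    by (rule bij_betw_byWitness[where f' = "\<lambda>e. (e(j := 0), e j)"])
      (use J in \<open>auto simp: exps_on_def exps_def pw_def\<close>)
  have v: "?v p = monomial A x n (?\<beta> p) \<or> ?v p = \<ominus>\<^bsub>A\<^esub> monomial A x n (?\<beta> p)" if p: "p \<in> exps_on J \<times> pw (dg j)" for p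
  proof -
    obtain e m where "p = (e, m)" "e \<in> exps_on J" using p by blast
    then show ?thesis using A.monomial_upd[OF x_homog J(2), of e m] J(1) by (simp add: exps_on_def)
  qed
  have R: "fbasis kk UNIV A unit (exps_on J \<times> pw (dg j)) ?v"
    "fspan UNIV A unit (exps_on J \<times> pw (dg j)) ?v = subalg (insert j J)"
    unfolding subalg_def by (rule fbasis_reindex[OF ground_abelian A.ring_axioms subalg_basis bij]; rule v; assumption)+
  have F: "add_map A A (subalg J) (\<lambda>s. s)" using subalg_props(3) by (auto simp: add_map_def)
  have e: "add_map kk A UNIV (\<lambda>s. unit s \<otimes>\<^bsub>A\<^esub> monomial A x n i)" for i
    by (auto simp: add_map_def ground_simps A.smult_l_distr A.l_distr)
  note G = fbasis_factor[OF ground_abelian A.ring_axioms A.ring_axioms R(1) subalg_def[unfolded fspan_def] e F]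
  show "fbasis A (subalg J) A (\<lambda>s. s) (pw (dg j)) (\<lambda>m. x j [^]\<^bsub>A\<^esub> m)" by (rule G(1)) (use xj in auto)
  have "fspan (subalg J) A (\<lambda>s. s) (pw (dg j)) (\<lambda>m. x j [^]\<^bsub>A\<^esub> m) = fspan UNIV A unit (exps_on J \<times> pw (dg j)) ?v"
    by (rule G(2)) (use xj in auto)
  then show "fspan (subalg J) A (\<lambda>s. s) (pw (dg j)) (\<lambda>m. x j [^]\<^bsub>A\<^esub> m) = subalg (insert j J)" using R(2) by simp
qed

text \<open>As all generators have degree at most 0, a monomial of degree \<open>t\<close> involves only generators of
  degree at least \<open>t\<close>.\<close>
lemma high_degree_in_subalg:
  assumes z: "z \<in> homog A t" and J: "\<And>i. i < n \<Longrightarrow> i \<notin> J \<Longrightarrow> dg i < t"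
  shows "z \<in> subalg J"
proof -
  \<comment> \<open>Passing to the component of degree \<open>t\<close> makes the claim additive in
    an inhomogeneous \<open>w\<close>, hence accessible to induction over the span.\<close>
  have "hcomp A t w \<in> subalg J" if "w \<in> fspan UNIV A unit (exps n dg) (monomial A x n)" for w
  proof (rule fspan_induct[OF ground_abelian A.ring_axioms asub_ground A.unit_map mono_funcset that])
    show "hcomp A t \<zero>\<^bsub>A\<^esub> \<in> subalg J" using A.hcomp_homog[OF A.homog_zero] asubD(2)[OF subalg_props(1)] by simp
  next
    fix e s assume e: "e \<in> exps n dg"
    have h: "unit s \<otimes>\<^bsub>A\<^esub> monomial A x n e \<in> homog A (0 + A.mdeg dg n e)"
      by (rule A.homog_mult[OF A.homog_smult[OF A.homog_one] A.monomial_homog[OF x_homog]])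
    show "hcomp A t (unit s \<otimes>\<^bsub>A\<^esub> monomial A x n e) \<in> subalg J"
    proof (cases "t = A.mdeg dg n e")
      case True
      have "e i = 0" if i: "i \<notin> J" for i
      proof (rule ccontr)
        assume ei: "e i \<noteq> 0"
        moreover have "\<forall>i. n \<le> i \<longrightarrow> e i = 0" using e by (simp add: exps_def)
        ultimately have "i < n" by (meson not_le)
        have "(\<Sum>l<n. int (e l) * dg l) \<le> int (e i) * dg i"
        proof -
          have "(\<Sum>l<n. int (e l) * dg l) = int (e i) * dg i + (\<Sum>l\<in>{..<n} - {i}. int (e l) * dg l)"
            using \<open>i < n\<close> by (subst sum.remove[of _ i]) auto
          moreover have "(\<Sum>l\<in>{..<n} - {i}. int (e l) * dg l) \<le> 0"
            using deg by (intro sum_nonpos) (auto simp: mult_nonneg_nonpos)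
          ultimately show ?thesis by simp
        qed
        also have "\<dots> \<le> dg i"
        proof -
          have "1 \<le> int (e i)" "dg i \<le> 0" using ei deg \<open>i < n\<close> by auto
          then show ?thesis using mult_right_mono_neg[of 1 "int (e i)" "dg i"] by simp
        qed
        finally show False using J[OF \<open>i < n\<close> i] True by (simp add: A.mdeg_def)
      qed
      then have "e \<in> exps_on J" using e by (simp add: exps_on_def)
      then show ?thesis using A.hcomp_homog[OF h, of t] True subalg_props(2) by simp
    next
      case False
      then show ?thesis using A.hcomp_homog[OF h, of t] asubD(2)[OF subalg_props(1)] by simp
    qed
  next
    fix u v assume "u \<in> fspan UNIV A unit (exps n dg) (monomial A x n)" "v \<in> fspan UNIV A unit (exps n dg) (monomial A x n)"
      and "hcomp A t u \<in> subalg J" "hcomp A t v \<in> subalg J"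
    then show "hcomp A t (u \<oplus>\<^bsub>A\<^esub> v) \<in> subalg J"
      using span asubD(3)[OF subalg_props(1)] by (simp add: A.hcomp_add)
  qed
  from this[unfolded span, OF A.homog_carrier[OF z]] show ?thesis using A.hcomp_homog[OF z, of t] by simp
qed

end

text \<open>Surjectivity with acyclic kernel, the form of a surjective quasi-isomorphism that yields
  strict lifts and composes easily with the retraction of a contractible extension.\<close>

definition surj_acyclic :: "('k::field_char_0, 't) dga \<Rightarrow> ('k, 'b) dga \<Rightarrow> ('t \<Rightarrow> 'b) \<Rightarrow> bool" where
  "surj_acyclic D B h \<longleftrightarrow> dga_hom D B h \<and> (\<forall>m. \<forall>b\<in>homog B m. \<exists>u\<in>homog D m. h u = b) \<and>
     (\<forall>m. \<forall>z\<in>homog D m. differential D z = \<zero>\<^bsub>D\<^esub> \<longrightarrow> h z = \<zero>\<^bsub>B\<^esub> \<longrightarrow>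
        (\<exists>c\<in>homog D (m - 1). differential D c = z \<and> h c = \<zero>\<^bsub>B\<^esub>))"

text \<open>Take any preimage \<open>q0\<close> of \<open>b\<close>. The defect \<open>z\<close>,
  which is \<open>p\<close> minus the differential of \<open>q0\<close>, is a cocycle in the kernel
  of \<open>h\<close>, hence the differential of some \<open>r\<close> in that kernel; then
  \<open>q0 + r\<close> is the lift.\<close>

lemma surj_acyclic_lift:
  assumes D: "is_dga D" and B: "is_dga B" and h: "surj_acyclic D B h"
    and p: "p \<in> homog D (m + 1)" "differential D p = \<zero>\<^bsub>D\<^esub>" and b: "b \<in> homog B m" "h p = differential B b"
  shows "\<exists>q\<in>homog D m. differential D q = p \<and> h q = b"
proof -
  interpret D: dg_algebra D by unfold_locales fact
  interpret B: dg_algebra B by unfold_locales fact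
  have hh: "shom D (carrier D) B h" "dmap D (carrier D) B h"
    using h dga_hom_iff_shom[OF D B] by (auto simp: surj_acyclic_def)
  note hs = shomD[OF hh(1)] shom_zero[OF D B D.gsub_carrier hh(1)]
  obtain q0 where q0: "q0 \<in> homog D m" "h q0 = b" using h b unfolding surj_acyclic_def by blast
  have c: "q0 \<in> carrier D" "p \<in> carrier D" "differential D q0 \<in> carrier D" "differential D q0 \<in> homog D (m + 1)"
    using q0 p by blast+
  define z where "z = p \<oplus>\<^bsub>D\<^esub> \<ominus>\<^bsub>D\<^esub> differential D q0"
  have z: "z \<in> homog D (m + 1)" unfolding z_def using p c by blast
  have dz: "differential D z = \<zero>\<^bsub>D\<^esub>" unfolding z_def using c p by (simp add: D.d_add D.d_minus D.d_d)
  have hd: "h (differential D q0) = differential B b" using hh(2) c q0 by (simp add: dmap_def)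
  have hz: "h z = \<zero>\<^bsub>B\<^esub>" unfolding z_def using c b hd by (simp add: hs(7,9) B.r_neg B.homog_carrier)
  obtain r where r: "r \<in> homog D (m + 1 - 1)" "differential D r = z" "h r = \<zero>\<^bsub>B\<^esub>"
    using h z dz hz unfolding surj_acyclic_def by blast
  have rc: "r \<in> homog D m" "r \<in> carrier D" using r(1) by auto
  have "q0 \<oplus>\<^bsub>D\<^esub> r \<in> homog D m" using q0 rc by blast
  moreover have "differential D (q0 \<oplus>\<^bsub>D\<^esub> r) = p"
    using c rc r z_def by (simp add: D.d_add D.a_ac D.r_neg)
  moreover have "h (q0 \<oplus>\<^bsub>D\<^esub> r) = b" using c rc r q0 b by (simp add: hs(7) B.homog_carrier)
  ultimately show ?thesis by blast
qed

text \<open>Both halves are instances of \<open>surj_acyclic_lift\<close>: \<open>p = z\<close>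
  gives injectivity on cohomology, and \<open>p = 0\<close> lifts every cocycle of \<open>B\<close>
  to a cocycle.\<close>

lemma surj_acyclic_quasi_iso:
  assumes D: "is_dga D" and B: "is_dga B" and h: "surj_acyclic D B h"
  shows "quasi_iso D B h"
proof -
  interpret D: dg_algebra D by unfold_locales fact
  interpret B: dg_algebra B by unfold_locales fact
  have hom: "dga_hom D B h" using h by (simp add: surj_acyclic_def)
  have hh: "shom D (carrier D) B h" "dmap D (carrier D) B h"
    using hom dga_hom_iff_shom[OF D B] by auto
  note hs = shomD[OF hh(1)] shom_zero[OF D B D.gsub_carrier hh(1)]
  have 1: "\<exists>a\<in>homog D (n - 1). z = differential D a"
    if z: "z \<in> cocycles D n" and b: "b \<in> homog B (n - 1)" "h z = differential B b" for n z b
    using surj_acyclic_lift[OF D B h, of z "n - 1" b] z b by (auto simp: cocycles_def)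
  have 2: "\<exists>z'\<in>cocycles D n. \<exists>b\<in>homog B (n - 1). h z' = z \<oplus>\<^bsub>B\<^esub> differential B b" if z: "z \<in> cocycles B n" for n z
  proof -
    have z': "z \<in> homog B n" "differential B z = \<zero>\<^bsub>B\<^esub>" using z by (auto simp: cocycles_def)
    have "h \<zero>\<^bsub>D\<^esub> = differential B z" using z' hs(8) by simp
    then obtain q where "q \<in> homog D n" "differential D q = \<zero>\<^bsub>D\<^esub>" "h q = z"
      using surj_acyclic_lift[OF D B h D.homog_zero D.d_zero z'(1)] by auto
    then show ?thesis using z' by (intro bexI[of _ q] bexI[of _ "\<zero>\<^bsub>B\<^esub>"]) (auto simp: cocycles_def)
  qed
  show ?thesis unfolding quasi_iso_def using hom 1 2 by blast
qed

section \<open>Resolutions over the subalgebras of \<open>A\<close>\<close>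

locale resolving_map = resolving_data A n x dg + B: dg_algebra B
  for A :: "('k::field_char_0, 'a) dga" and n x dg and B :: "('k, 'b) dga" +
  fixes f :: "'a \<Rightarrow> 'b"
  assumes f: "dga_hom A B f"
begin

text \<open>A resolution of the restriction of \<open>f\<close> to the subalgebra generated by the \<open>x i\<close> with \<open>i \<in> J\<close>.\<close>
definition stage :: "nat set \<Rightarrow> ('k, 't) dga \<Rightarrow> bool" where
  "stage J D \<longleftrightarrow> is_dga D \<and> gsub A (subalg J) \<and> dclosed A (subalg J) \<and> (\<exists>h g m xs ds. surj_acyclic D B h \<and>
     shom A (subalg J) D g \<and> dmap A (subalg J) D g \<and> (\<forall>a\<in>subalg J. h (g a) = f a) \<and>
     (\<forall>i<m. ds i \<le> 0 \<and> xs i \<in> homog D (ds i)) \<and>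
     fbasis A (subalg J) D g (exps m ds) (monomial D xs m) \<and>
     fspan (subalg J) D g (exps m ds) (monomial D xs m) = carrier D)"

lemmas f_hom = dga_hom_iff_shom[OF A.dga B.dga, THEN iffD1, OF f]
lemmas f_simps = shomD[OF f_hom[THEN conjunct1]] shom_zero[OF A.dga B.dga A.gsub_carrier f_hom[THEN conjunct1]]

text \<open>A copy of \<open>B\<close> resolves the ground field: \<open>h\<close> is the decoding
  bijection, so its kernel is zero, and the free generators of \<open>B\<close> over the field serve
  unchanged. What remains is to replace the field by its copy \<open>subalg {}\<close> in
  \<open>A\<close>.\<close>

lemma stage_empty:
  fixes enc :: "'b \<Rightarrow> 't"
  assumes inj: "inj_on enc (carrier B)" and rB: "fin_resolving_alg B"
  shows "\<exists>D :: ('k, 't) dga. stage {} D"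
proof -
  define D where "D = transport enc B"
  note t = transport_dga[OF B.dga inj, folded D_def]
  interpret D: dg_algebra D by unfold_locales (rule t(1))
  have eh: "shom B (carrier B) D enc" "dmap B (carrier B) D enc"
    using t(2) dga_hom_iff_shom[OF B.dga t(1)] by blast+
  note es = shomD[OF eh(1)] shom_zero[OF B.dga t(1) B.gsub_carrier eh(1)]
  define h where "h = inv_into (carrier B) enc"
  have h: "h (enc b) = b" if "b \<in> carrier B" for b
    using inj that by (simp add: h_def inv_into_f_f)
  have surj: "\<exists>b\<in>carrier B. u = enc b" if "u \<in> carrier D" for u
    using t(3) that by (auto simp: bij_betw_def)
  have hhom: "dga_hom D B h"
    unfolding dga_hom_def
  proof (intro conjI ballI allI funcsetI)
    fix u assume "u \<in> carrier D"
    then obtain u' where u: "u' \<in> carrier B" "u = enc u'" using surj by blast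
    show "h u \<in> carrier B" using u h by simp
    show "h (c \<odot>\<^bsub>D\<^esub> u) = c \<odot>\<^bsub>B\<^esub> h u" for c using u h by (simp flip: es(4))
    have "differential D u = enc (differential B u')" using eh(2) u by (simp add: dmap_def)
    then show "h (differential D u) = differential B (h u)" using u h by simp
    fix v assume "v \<in> carrier D"
    then obtain v' where v: "v' \<in> carrier B" "v = enc v'" using surj by blast
    show "h (u \<oplus>\<^bsub>D\<^esub> v) = h u \<oplus>\<^bsub>B\<^esub> h v" using u v h by (simp flip: es(7))
    show "h (u \<otimes>\<^bsub>D\<^esub> v) = h u \<otimes>\<^bsub>B\<^esub> h v" using u v h by (simp flip: es(3))
  next
    show "h \<one>\<^bsub>D\<^esub> = \<one>\<^bsub>B\<^esub>" using h[OF B.one_closed] es(2) by simp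
    show "h u \<in> homog B k" if "u \<in> homog D k" for k u
      using that h by (auto simp: t(4) B.homog_carrier)
  qed
  have sa: "surj_acyclic D B h"
    unfolding surj_acyclic_def
  proof (intro conjI allI ballI impI)
    show "dga_hom D B h" by (rule hhom)
    show "\<exists>u\<in>homog D m. h u = b" if "b \<in> homog B m" for m b
      using that h by (intro bexI[of _ "enc b"]) (auto simp: t(4) B.homog_carrier)
    fix m z assume z: "z \<in> homog D m" "h z = \<zero>\<^bsub>B\<^esub>"
    then obtain b where b: "b \<in> carrier B" "z = enc b" using surj D.homog_carrier by blast
    then have "z = \<zero>\<^bsub>D\<^esub>" using z(2) h es(8) by simp
    moreover have "h \<zero>\<^bsub>D\<^esub> = \<zero>\<^bsub>B\<^esub>" using h[OF B.zero_closed] es(8) by simp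
    ultimately show "\<exists>c\<in>homog D (m - 1). differential D c = z \<and> h c = \<zero>\<^bsub>B\<^esub>"
      by (intro bexI[of _ "\<zero>\<^bsub>D\<^esub>"]) auto
  qed
  obtain m xs ds where B: "\<forall>i<m. ds i \<le> 0 \<and> xs i \<in> homog B (ds i)"
    "fbasis kk UNIV B (\<lambda>c. c \<odot>\<^bsub>B\<^esub> \<one>\<^bsub>B\<^esub>) (exps m ds) (monomial B xs m)"
    "fspan UNIV B (\<lambda>c. c \<odot>\<^bsub>B\<^esub> \<one>\<^bsub>B\<^esub>) (exps m ds) (monomial B xs m) = carrier B"
    by (rule resolving_basis[OF rB])
  define ys where "ys i = enc (xs i)" for i
  have ys: "\<forall>i<m. ds i \<le> 0 \<and> ys i \<in> homog D (ds i)"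
    using B(1) es(5) unfolding ys_def by (simp add: B.homog_carrier)
  have mon: "enc (monomial B xs m e) = monomial D ys m e" for e
    unfolding ys_def by (rule shom_monomial[OF B.dga t(1) eh(1)]) (use B(1) in blast)
  have unit: "enc (c \<odot>\<^bsub>B\<^esub> \<one>\<^bsub>B\<^esub>) = c \<odot>\<^bsub>D\<^esub> \<one>\<^bsub>D\<^esub>" for c using es(2,4) by simp
  have mult: "\<And>u v. u \<in> carrier B \<Longrightarrow> v \<in> carrier B \<Longrightarrow> enc (u \<otimes>\<^bsub>B\<^esub> v) = enc u \<otimes>\<^bsub>D\<^esub> enc v" by (rule es(3))
  have DB: "fbasis kk UNIV D (\<lambda>c. c \<odot>\<^bsub>D\<^esub> \<one>\<^bsub>D\<^esub>) (exps m ds) (monomial D ys m)"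
    "fspan UNIV D (\<lambda>c. c \<odot>\<^bsub>D\<^esub> \<one>\<^bsub>D\<^esub>) (exps m ds) (monomial D ys m) = carrier D"
    unfolding unit[symmetric] mon[symmetric, abs_def]
    by (rule fbasis_iso[OF ground_abelian B.ring_axioms D.ring_axioms B(2,3) es(1) t(3)]; simp only: mult)+
  let ?I = "{\<lambda>_::nat. 0::nat}"
  \<comment> \<open>A trivial factor, indexed by the only exponent in \<open>exps_on {}\<close>,
    gives the basis the product shape expected by \<open>fbasis_factor\<close>.\<close>
  let ?v = "\<lambda>(i, k). \<one>\<^bsub>D\<^esub> \<otimes>\<^bsub>D\<^esub> monomial D ys m k"
  have mc: "monomial D ys m e \<in> carrier D" for e using ys by (intro D.monomial_closed) blast
  have bij: "bij_betw snd (?I \<times> exps m ds) (exps m ds)"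
    by (rule bij_betw_byWitness[where f' = "\<lambda>e. (\<lambda>_. 0, e)"]) auto
  have R: "fbasis kk UNIV D (\<lambda>c. c \<odot>\<^bsub>D\<^esub> \<one>\<^bsub>D\<^esub>) (exps_on {} \<times> exps m ds) ?v"
    "fspan UNIV D (\<lambda>c. c \<odot>\<^bsub>D\<^esub> \<one>\<^bsub>D\<^esub>) (exps_on {} \<times> exps m ds) ?v = carrier D"
    unfolding exps_on_empty DB(2)[symmetric]
    by (rule fbasis_reindex[OF ground_abelian D.ring_axioms DB(1) bij]; use mc in force)+
  obtain \<kappa> where \<kappa>: "\<And>i. i \<in> exps_on {} \<Longrightarrow> add_map A kk (subalg {}) (\<kappa> i)"
    "\<And>i l s. i \<in> exps_on {} \<Longrightarrow> l \<in> exps_on {} \<Longrightarrow> s \<in> UNIV \<Longrightarrow> \<kappa> i (unit s \<otimes>\<^bsub>A\<^esub> monomial A x n l) = (if i = l then s else \<zero>\<^bsub>kk\<^esub>)"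
    using fbasisE[OF subalg_basis[of "{}"], folded subalg_def] by metis
  have m1: "monomial A x n (\<lambda>_. 0) = \<one>\<^bsub>A\<^esub>" using deg by (intro A.monomial_zero_exps) blast
  \<comment> \<open>Every element of \<open>subalg {}\<close> is a scalar multiple of one, and its
    coordinate at the constant monomial is that scalar.\<close>
  define g where "g a = \<kappa> (\<lambda>_. 0) a \<odot>\<^bsub>D\<^esub> \<one>\<^bsub>D\<^esub>" for a
  have g: "g (unit c) = c \<odot>\<^bsub>D\<^esub> \<one>\<^bsub>D\<^esub>" for c
    using \<kappa>(2)[of "\<lambda>_. 0" "\<lambda>_. 0" c] by (simp add: g_def m1 exps_on_empty)
  have SE: "\<exists>c. a = unit c" if "a \<in> subalg {}" for a using that unfolding subalg_empty by blast
  have ga: "add_map A D (subalg {}) g"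
    using add_mapD[OF \<kappa>(1)[of "\<lambda>_. 0"]] unfolding g_def
    by (intro add_mapI) (auto simp: exps_on_empty ground_simps D.smult_l_distr)
  have um: "(c \<odot>\<^bsub>D\<^esub> \<one>\<^bsub>D\<^esub>) \<otimes>\<^bsub>D\<^esub> (c' \<odot>\<^bsub>D\<^esub> \<one>\<^bsub>D\<^esub>) = (c * c') \<odot>\<^bsub>D\<^esub> \<one>\<^bsub>D\<^esub>" for c c'
    by (simp add: D.smult_mult_l D.smult_mult_r mult.commute flip: D.smult_assoc1)
  have gshom: "shom A (subalg {}) D g"
    unfolding shom_def
  proof (intro conjI ballI allI)
    show "add_map A D (subalg {}) g" by (rule ga)
    show "g \<one>\<^bsub>A\<^esub> = \<one>\<^bsub>D\<^esub>" using g[of 1] by simp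
    fix u assume "u \<in> subalg {}"
    then obtain a where a: "u = unit a" using SE by blast
    show "g (c \<odot>\<^bsub>A\<^esub> u) = c \<odot>\<^bsub>D\<^esub> g u" for c
      using g[of "c * a"] g[of a] by (simp add: a A.smult_assoc1 D.smult_assoc1)
    fix v assume "v \<in> subalg {}"
    then obtain b where b: "v = unit b" using SE by blast
    show "g (u \<otimes>\<^bsub>A\<^esub> v) = g u \<otimes>\<^bsub>D\<^esub> g v" unfolding a b unit_mult g um ..
  next
    fix k u assume u: "u \<in> subalg {} \<inter> homog A k"
    then obtain a where a: "u = unit a" using SE by blast
    have u0: "u \<in> homog A 0" unfolding a by blast
    show "g u \<in> homog D k"
    proof (cases "k = 0")
      case True
      then show ?thesis unfolding a g by blast
    next
      case False
      \<comment> \<open>Scalars sit in degree 0, so a scalar that is also homogeneous of another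
        degree vanishes.\<close>
      then have "u = \<zero>\<^bsub>A\<^esub>" using A.hcomp_homog[OF u0, of k] A.hcomp_homog[of u k k] u by simp
      then show ?thesis using g[of 0] by simp
    qed
  qed
  have gd: "dmap A (subalg {}) D g"
    unfolding dmap_def
  proof
    fix u assume "u \<in> subalg {}"
    then obtain a where a: "u = unit a" using SE by blast
    show "g (differential A u) = differential D (g u)"
      unfolding a g using g[of 0] by (simp add: A.d_smult D.d_smult)
  qed
  have hg: "h (g a) = f a" if a: "a \<in> subalg {}" for a
  proof -
    obtain c where c: "a = unit c" using SE[OF a] by blast
    have "h (g a) = c \<odot>\<^bsub>B\<^esub> \<one>\<^bsub>B\<^esub>" unfolding c g unit[symmetric] by (rule h) simp
    then show ?thesis using f_simps(2,4) by (simp add: c)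
  qed
  have e: "add_map kk A UNIV (\<lambda>s. unit s \<otimes>\<^bsub>A\<^esub> monomial A x n i)" for i
    by (auto simp: add_map_def ground_simps A.smult_l_distr A.l_distr)
  have ge: "g (unit s \<otimes>\<^bsub>A\<^esub> monomial A x n i) = (s \<odot>\<^bsub>D\<^esub> \<one>\<^bsub>D\<^esub>) \<otimes>\<^bsub>D\<^esub> \<one>\<^bsub>D\<^esub>" if "i \<in> exps_on {}" for s i
    using that g by (simp add: exps_on_empty m1)
  note G = fbasis_factor[OF ground_abelian A.ring_axioms D.ring_axioms R(1) subalg_def[unfolded fspan_def] e ga]
  have "fbasis A (subalg {}) D g (exps m ds) (monomial D ys m)"
    by (rule G(1)) (use ge mc in auto)
  moreover have "fspan (subalg {}) D g (exps m ds) (monomial D ys m) = fspan UNIV D (\<lambda>c. c \<odot>\<^bsub>D\<^esub> \<one>\<^bsub>D\<^esub>) (exps_on {} \<times> exps m ds) ?v"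
    by (rule G(2)) (use ge mc in auto)
  ultimately have "stage {} D"
    unfolding stage_def R(2) using t(1) subalg_empty_gsub sa gshom gd hg ys by blast
  then show ?thesis ..
qed

text \<open>The hypothesis \<open>mx\<close> makes every missing generator have degree below
  \<open>dg j + 1\<close>, the degree of \<open>\<partial> x_j\<close>, which therefore lies in
  \<open>subalg J\<close>. Of the two adjoined variables, the shifted \<open>y\<close> becomes the
  image of \<open>x j\<close> and moves into the base; only \<open>\<eta>\<close>, of degree
  \<open>dg j - 1\<close>, joins the generators.\<close>

lemma stage_step:
  fixes D :: "('k, 't) dga" and enc :: "(nat \<Rightarrow> 't) \<Rightarrow> 't"
  assumes st: "stage J D" and j: "j < n" "j \<notin> J" and mx: "\<And>i. i < n \<Longrightarrow> i \<notin> J \<Longrightarrow> dg i \<le> dg j" and enc: "inj enc"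
  shows "\<exists>E :: ('k, 't) dga. stage (insert j J) E"
proof -
  obtain h g m xs ds where D: "is_dga D" and S: "gsub A (subalg J)" "dclosed A (subalg J)" and h: "surj_acyclic D B h"
    and g: "shom A (subalg J) D g" "dmap A (subalg J) D g" and hg: "\<And>a. a \<in> subalg J \<Longrightarrow> h (g a) = f a"
    and xs: "\<forall>i<m. ds i \<le> 0 \<and> xs i \<in> homog D (ds i)"
    and DB: "fbasis A (subalg J) D g (exps m ds) (monomial D xs m)" "fspan (subalg J) D g (exps m ds) (monomial D xs m) = carrier D"
    using st unfolding stage_def by blast
  interpret D: dg_algebra D by unfold_locales (rule D)
  have hh: "dga_hom D B h" using h by (simp add: surj_acyclic_def)
  note h_hom = dga_hom_iff_shom[OF D B.dga, THEN iffD1, OF hh]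
  note hs = shomD[OF h_hom[THEN conjunct1]] shom_zero[OF D B.dga D.gsub_carrier h_hom[THEN conjunct1]]
  note gs = shomD[OF g(1)] shom_zero[OF A.dga D S(1) g(1)]
  define d where "d = dg j"
  have xj: "x j \<in> homog A d" "d \<le> 0" using deg j(1) by (auto simp: d_def)
  have xc: "x j \<in> carrier A" using xj by blast
  have dxh: "differential A (x j) \<in> homog A (d + 1)" using xj by blast
  have dx: "differential A (x j) \<in> subalg J"
    by (rule high_degree_in_subalg[OF dxh]) (use mx in \<open>force simp: d_def\<close>)
  define p where "p = g (differential A (x j))"
  have p: "p \<in> homog D (d + 1)" unfolding p_def by (rule gs(5)[OF dx dxh])
  have dp: "differential D p = \<zero>\<^bsub>D\<^esub>"
  proof -
    have "differential D p = g (differential A (differential A (x j)))" using g(2) dx by (simp add: p_def dmap_def)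
    then show ?thesis using gs(8) xc by (simp add: A.d_d)
  qed
  have hp: "h p = differential B (f (x j))"
    using hg[OF dx] f_hom[THEN conjunct2] xc by (simp add: p_def dmap_def)
  \<comment> \<open>A strict lift: the differential of \<open>b\<close> lets \<open>x j\<close> be
    mapped to the shifted variable as a dg map, and its image under \<open>h\<close> keeps the
    composite equal to \<open>f\<close>.\<close>
  obtain b where b: "b \<in> homog D d" "differential D b = p" "h b = f (x j)"
    using surj_acyclic_lift[OF D B.dga h p dp f_simps(5)[OF xc xj(1)] hp] by blast
  show ?thesis
  proof (rule contractible_extension[OF D b(1) enc])
    fix E :: "('k, 't) dga" and \<iota> \<pi> Y \<eta>
    assume E: "is_dga E" and \<iota>: "dga_hom D E \<iota>" and \<pi>: "dga_hom E D \<pi>" and \<pi>\<iota>: "\<And>s. s \<in> carrier D \<Longrightarrow> \<pi> (\<iota> s) = s"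
      and Y: "Y \<in> homog E d" and \<eta>: "\<eta> \<in> homog E (d - 1)"
      and dY: "differential E Y = \<iota> (differential D b)" and \<pi>Y: "\<pi> Y = b"
      and con: "\<And>n z. z \<in> homog E n \<Longrightarrow> differential E z = \<zero>\<^bsub>E\<^esub> \<Longrightarrow>
         \<exists>c\<in>homog E (n - 1). z = differential E c \<oplus>\<^bsub>E\<^esub> \<iota> (\<pi> z) \<and> \<pi> c = \<zero>\<^bsub>D\<^esub>"
      and EB: "fbasis D (carrier D) E \<iota> (pw d \<times> pw (d - 1)) (\<lambda>(m, n). Y [^]\<^bsub>E\<^esub> m \<otimes>\<^bsub>E\<^esub> \<eta> [^]\<^bsub>E\<^esub> n)"
        "fspan (carrier D) E \<iota> (pw d \<times> pw (d - 1)) (\<lambda>(m, n). Y [^]\<^bsub>E\<^esub> m \<otimes>\<^bsub>E\<^esub> \<eta> [^]\<^bsub>E\<^esub> n) = carrier E"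
    interpret E: dg_algebra E by unfold_locales (rule E)
    note \<iota>h = dga_hom_iff_shom[OF D E, THEN iffD1, OF \<iota>] and \<pi>h = dga_hom_iff_shom[OF E D, THEN iffD1, OF \<pi>]
    note i_simps = shomD[OF \<iota>h[THEN conjunct1]] shom_zero[OF D E D.gsub_carrier \<iota>h[THEN conjunct1]]
    note ps = shomD[OF \<pi>h[THEN conjunct1]] shom_zero[OF E D E.gsub_carrier \<pi>h[THEN conjunct1]]
    have Yc: "Y \<in> carrier E" and \<eta>c: "\<eta> \<in> carrier E" using Y \<eta> by blast+
    interpret P: pow_span A A "subalg J" "\<lambda>s. s" d "x j"
      by unfold_locales (rule S(1) shom_id[OF A.dga S(1)] xj(1))+
    note step = subalg_step[OF j(2,1), folded d_def]
    let ?S' = "subalg (insert j J)"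
    define \<phi> where "\<phi> s = \<iota> (g s)" for s
    have \<phi>: "shom A (subalg J) E \<phi>" unfolding \<phi>_def
      by (rule shom_comp[OF g(1) \<iota>h[THEN conjunct1] gs(6) A.gsubD(2)[OF S(1)]])
    have \<phi>d: "dmap A (subalg J) E \<phi>"
      using g(2) \<iota>h[THEN conjunct2] gs(6) unfolding dmap_def \<phi>_def by simp
    obtain \<psi> where \<psi>: "shom A ?S' E \<psi>" "\<And>s. s \<in> subalg J \<Longrightarrow> \<psi> s = \<phi> s" "\<psi> (x j) = Y"
      "\<And>s i. s \<in> subalg J \<Longrightarrow> \<psi> (s \<otimes>\<^bsub>A\<^esub> x j [^]\<^bsub>A\<^esub> (i::nat)) = \<phi> s \<otimes>\<^bsub>E\<^esub> Y [^]\<^bsub>E\<^esub> i"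
      using P.pow_ext[OF E step(1) \<phi> Y, unfolded step(2)] by metis
    have S'g: "gsub A ?S'" using P.PS_gsub unfolding step(2) .
    have idd: "dmap A (subalg J) A (\<lambda>s. s)" by (simp add: dmap_def)
    have S'd: "dclosed A ?S'" using P.PS_dclosed(1)[OF S(2) idd dx refl] unfolding step(2) .
    have d\<psi>: "differential E (\<psi> (x j)) = \<phi> (differential A (x j))"
      unfolding \<psi>(3) dY b(2) p_def \<phi>_def ..
    have \<psi>d: "dmap A ?S' E \<psi>"
      by (rule P.pow_ext_dmap[where \<phi> = \<phi> and \<psi> = \<psi> and p = "differential A (x j)", OF E S(2) idd \<phi>d dx refl _ _ d\<psi>, unfolded step(2), OF \<psi>(1)]) (rule \<psi>(2))
    define h' where "h' z = h (\<pi> z)" for z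
    have h'hom: "dga_hom E B h'" using dga_hom_comp[OF \<pi> hh] unfolding h'_def .
    have h'\<iota>: "h' (\<iota> s) = h s" if "s \<in> carrier D" for s using \<pi>\<iota>[OF that] by (simp add: h'_def)
    have bc: "b \<in> carrier D" using b(1) by blast
    have h'\<psi>: "h' (\<psi> a) = f a" if "a \<in> ?S'" for a
    proof -
      have "a \<in> P.PS" using that step(2) by simp
      then show ?thesis
      proof (induction rule: P.PS_induct)
        case (gen s k i)
        have sc: "s \<in> carrier A" using gen(2) by blast
        have "\<pi> (\<psi> (s \<otimes>\<^bsub>A\<^esub> x j [^]\<^bsub>A\<^esub> i)) = g s \<otimes>\<^bsub>D\<^esub> b [^]\<^bsub>D\<^esub> i"
          unfolding \<psi>(4)[OF gen(1)] \<phi>_def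
          using gs(6)[OF gen(1)] i_simps(6) Yc by (simp add: ps(3,12) \<pi>\<iota> \<pi>Y)
        then have "h' (\<psi> (s \<otimes>\<^bsub>A\<^esub> x j [^]\<^bsub>A\<^esub> i)) = f s \<otimes>\<^bsub>B\<^esub> f (x j) [^]\<^bsub>B\<^esub> i"
          unfolding h'_def using gs(6)[OF gen(1)] bc by (simp add: hs(3,12) hg[OF gen(1)] b(3))
        then show ?case using sc xc by (simp add: f_simps(3,12))
      next
        case (add u v)
        have "u \<in> ?S'" "v \<in> ?S'" "u \<in> carrier A" "v \<in> carrier A" using add(1,2) P.PS_carrier step(2) by auto
        then show ?case using add(3,4) shomD(6,7)[OF \<psi>(1)] by (simp add: h'_def ps(6,7) hs(7) f_simps(7))
      qed
    qed
    have h': "surj_acyclic E B h'"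
      unfolding surj_acyclic_def
    proof (intro conjI allI ballI impI)
      show "dga_hom E B h'" by (rule h'hom)
      show "\<exists>u\<in>homog E k. h' u = b'" if b': "b' \<in> homog B k" for k b'
      proof -
        obtain u where u: "u \<in> homog D k" "h u = b'" using h b' unfolding surj_acyclic_def by blast
        then have "\<iota> u \<in> homog E k" "h' (\<iota> u) = b'" using i_simps(5) h'\<iota> by (auto simp: D.homog_carrier)
        then show ?thesis by blast
      qed
      fix k z assume z: "z \<in> homog E k" "differential E z = \<zero>\<^bsub>E\<^esub>" "h' z = \<zero>\<^bsub>B\<^esub>"
      have zc: "z \<in> carrier E" using z by blast
      \<comment> \<open>The contraction moves \<open>z\<close> to \<open>\<iota> (\<pi> z)\<close>
        modulo the boundary of \<open>c\<close>. The acyclic kernel of \<open>h\<close> writes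
        \<open>\<pi> z\<close> as the boundary of some \<open>c'\<close>, so
        \<open>c + \<iota> c'\<close> bounds \<open>z\<close>; \<open>h'\<close> kills both
        summands.\<close>
      obtain c where c: "c \<in> homog E (k - 1)" "z = differential E c \<oplus>\<^bsub>E\<^esub> \<iota> (\<pi> z)" "\<pi> c = \<zero>\<^bsub>D\<^esub>"
        using con[OF z(1,2)] by blast
      have "differential D (\<pi> z) = \<pi> (differential E z)" using \<pi>h[THEN conjunct2] zc by (simp add: dmap_def)
      then have "\<pi> z \<in> homog D k" "differential D (\<pi> z) = \<zero>\<^bsub>D\<^esub>" "h (\<pi> z) = \<zero>\<^bsub>B\<^esub>"
        using z ps(5,8) zc by (simp_all add: h'_def)
      then obtain c' where c': "c' \<in> homog D (k - 1)" "differential D c' = \<pi> z" "h c' = \<zero>\<^bsub>B\<^esub>"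
        using h unfolding surj_acyclic_def by blast
      have cc: "c \<in> carrier E" "c' \<in> carrier D" "\<iota> c' \<in> carrier E" "\<iota> c' \<in> homog E (k - 1)"
        using c(1) c'(1) i_simps(5,6) by blast+
      have "differential E (\<iota> c') = \<iota> (\<pi> z)" using \<iota>h[THEN conjunct2] cc(2) unfolding c'(2)[symmetric] dmap_def by simp
      then have "differential E (c \<oplus>\<^bsub>E\<^esub> \<iota> c') = z" using cc c(2) by (simp add: E.d_add)
      moreover have "h' (c \<oplus>\<^bsub>E\<^esub> \<iota> c') = \<zero>\<^bsub>B\<^esub>" using cc c(3) c'(3) by (simp add: h'_def ps(7) \<pi>\<iota>)
      moreover have "c \<oplus>\<^bsub>E\<^esub> \<iota> c' \<in> homog E (k - 1)" using c(1) cc(4) by blast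
      ultimately show "\<exists>c\<in>homog E (k - 1). differential E c = z \<and> h' c = \<zero>\<^bsub>B\<^esub>" by blast
    qed
    \<comment> \<open>The old generators keep the positions below \<open>m\<close>;
      \<open>\<eta>\<close> is appended at position \<open>m\<close> with degree
      \<open>d - 1\<close>, which is negative because \<open>d \<le> 0\<close>.\<close>
    define zs where "zs = (\<lambda>i. \<iota> (xs i))(m := \<eta>)"
    define es where "es = ds(m := d - 1)"
    have zs: "\<forall>i<Suc m. es i \<le> 0 \<and> zs i \<in> homog E (es i)"
      using xs \<eta> xj(2) i_simps(5) by (auto simp: zs_def es_def less_Suc_eq D.homog_carrier)
    let ?me = "monomial E zs m"
    have zh: "\<forall>i<m. zs i \<in> homog E (es i)" using zs by simp
    have mec: "?me e \<in> carrier E" for e using E.monomial_homog[OF zh] by blast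
    have \<iota>mon: "\<iota> (monomial D xs m e) = ?me e" for e
    proof -
      have "\<iota> (monomial D xs m e) = monomial E (\<lambda>i. \<iota> (xs i)) m e"
        by (rule shom_monomial[OF D E \<iota>h[THEN conjunct1]]) (use xs in blast)
      also have "\<dots> = ?me e" by (rule E.monomial_cong) (auto simp: zs_def)
      finally show ?thesis .
    qed
    let ?v1 = "\<lambda>(e, k). ?me e \<otimes>\<^bsub>E\<^esub> (\<lambda>(i, k). Y [^]\<^bsub>E\<^esub> i \<otimes>\<^bsub>E\<^esub> \<eta> [^]\<^bsub>E\<^esub> k) k"
    have T: "fbasis A (subalg J) E \<phi> (exps m ds \<times> (pw d \<times> pw (d - 1))) ?v1"
      "fspan (subalg J) E \<phi> (exps m ds \<times> (pw d \<times> pw (d - 1))) ?v1 = carrier E"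
      using fbasis_trans[OF A.abelian_group_axioms D.ring_axioms E.ring_axioms DB EB(1) i_simps(3)]
      unfolding \<iota>mon EB(2) \<phi>_def by auto
    let ?w = "\<lambda>(e, k). ?me e \<otimes>\<^bsub>E\<^esub> \<eta> [^]\<^bsub>E\<^esub> (k::nat)"
    \<comment> \<open>Powers of \<open>Y\<close> are moved to the front, up to sign, where
      \<open>fbasis_factor\<close> can absorb them into the base as images of powers of
      \<open>x j\<close>.\<close>
    let ?v2 = "\<lambda>(i, q). Y [^]\<^bsub>E\<^esub> (i::nat) \<otimes>\<^bsub>E\<^esub> ?w q"
    have bij: "bij_betw (\<lambda>(i, (e, k)). (e, (i, k))) (pw d \<times> (exps m ds \<times> pw (d - 1))) (exps m ds \<times> (pw d \<times> pw (d - 1)))"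
      by (rule bij_betw_byWitness[where f' = "\<lambda>(e, (i, k)). (i, (e, k))"]) auto
    have v2: "?v2 q = ?v1 ((\<lambda>(i, (e, k)). (e, (i, k))) q) \<or> ?v2 q = \<ominus>\<^bsub>E\<^esub> ?v1 ((\<lambda>(i, (e, k)). (e, (i, k))) q)" for q
    proof -
      obtain i e k where q: "q = (i, (e, k))" by (cases q) auto
      have "Y [^]\<^bsub>E\<^esub> i \<otimes>\<^bsub>E\<^esub> ?me e = ?me e \<otimes>\<^bsub>E\<^esub> Y [^]\<^bsub>E\<^esub> i \<or> Y [^]\<^bsub>E\<^esub> i \<otimes>\<^bsub>E\<^esub> ?me e = \<ominus>\<^bsub>E\<^esub> (?me e \<otimes>\<^bsub>E\<^esub> Y [^]\<^bsub>E\<^esub> i)"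
        by (rule E.comm_up_to_sign[OF E.homog_pow[OF Y] E.monomial_homog[OF zh]])
      moreover have "?v2 q = (Y [^]\<^bsub>E\<^esub> i \<otimes>\<^bsub>E\<^esub> ?me e) \<otimes>\<^bsub>E\<^esub> \<eta> [^]\<^bsub>E\<^esub> k"
        using mec Yc \<eta>c by (simp add: q E.m_assoc)
      moreover have "?v1 ((\<lambda>(i, (e, k)). (e, (i, k))) q) = (?me e \<otimes>\<^bsub>E\<^esub> Y [^]\<^bsub>E\<^esub> i) \<otimes>\<^bsub>E\<^esub> \<eta> [^]\<^bsub>E\<^esub> k"
        using mec Yc \<eta>c by (simp add: q E.m_assoc)
      ultimately show ?thesis using mec Yc \<eta>c by (auto simp: E.l_minus)
    qed
    have R: "fbasis A (subalg J) E \<phi> (pw d \<times> (exps m ds \<times> pw (d - 1))) ?v2"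
      "fspan (subalg J) E \<phi> (pw d \<times> (exps m ds \<times> pw (d - 1))) ?v2 = carrier E"
      unfolding T(2)[symmetric] by (rule fbasis_reindex[OF A.abelian_group_axioms E.ring_axioms T(1) bij]; rule v2)+
    have sp: "?S' = aspan A (dgen (pw d) (\<lambda>_. subalg J) (\<lambda>i s. s \<otimes>\<^bsub>A\<^esub> x j [^]\<^bsub>A\<^esub> i))"
      using step(2) by (simp add: fspan_def)
    have am: "add_map A A (subalg J) (\<lambda>s. s \<otimes>\<^bsub>A\<^esub> x j [^]\<^bsub>A\<^esub> i)" for i :: nat
      using A.gsubD(6)[OF S(1)] xc by (intro add_mapI) (auto simp: A.l_distr)
    \<comment> \<open>Here \<open>W i\<close> is the power \<open>Y^i\<close>, and
      \<open>e i\<close> multiplies coefficients by the same power of \<open>x j\<close>;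
      \<open>\<psi>(4)\<close> is the required compatibility.\<close>
    note G = fbasis_factor[OF A.abelian_group_axioms A.ring_axioms E.ring_axioms R(1) sp am shomD(1)[OF \<psi>(1)] \<psi>(4)]
    have G1: "fbasis A ?S' E \<psi> (exps m ds \<times> pw (d - 1)) ?w" by (rule G(1)) (use mec Yc \<eta>c in auto)
    have "fspan ?S' E \<psi> (exps m ds \<times> pw (d - 1)) ?w = fspan (subalg J) E \<phi> (pw d \<times> (exps m ds \<times> pw (d - 1))) ?v2"
      by (rule G(2)) (use mec Yc \<eta>c in auto)
    then have G2: "fspan ?S' E \<psi> (exps m ds \<times> pw (d - 1)) ?w = carrier E" using R(2) by simp
    \<comment> \<open>Splits off the last exponent. Its parity condition is that of
      \<open>pw (d - 1)\<close>, because \<open>es m = d - 1\<close>.\<close>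
    have bij2: "bij_betw (\<lambda>e. (e(m := 0), e m)) (exps (Suc m) es) (exps m ds \<times> pw (d - 1))"
      by (rule bij_betw_byWitness[where f' = "\<lambda>(e, k). e(m := k)"])
        (auto simp: exps_def pw_def es_def less_Suc_eq Suc_le_eq intro!: ext)
    have zc: "\<forall>i<Suc m. zs i \<in> carrier E" using zs by blast
    have v3: "monomial E zs (Suc m) e = ?w (e(m := 0), e m)" for e
    proof -
      have "?me (e(m := 0)) = ?me e" by (rule E.monomial_cong) auto
      moreover have "zs m = \<eta>" by (simp add: zs_def)
      ultimately show ?thesis unfolding E.monomial_Suc[OF zc] prod.case by simp
    qed
    have "fbasis A ?S' E \<psi> (exps (Suc m) es) (monomial E zs (Suc m))"
      "fspan ?S' E \<psi> (exps (Suc m) es) (monomial E zs (Suc m)) = carrier E"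
      unfolding G2[symmetric]
      by (rule fbasis_reindex[OF A.abelian_group_axioms E.ring_axioms G1 bij2]; rule disjI1; rule v3)+
    then have "stage (insert j J) E"
      unfolding stage_def using E S'g S'd h' \<psi>(1) \<psi>d h'\<psi> zs by blast
    then show ?thesis by blast
  qed
qed

text \<open>The generators of \<open>A\<close> are not sorted beforehand. Induction on the size of
  \<open>J\<close> attaches at each step a remaining generator of maximal degree.\<close>

lemma stage_exists:
  fixes enc :: "'b \<Rightarrow> 't" and enc' :: "(nat \<Rightarrow> 't) \<Rightarrow> 't"
  assumes "inj_on enc (carrier B)" "inj enc'" "fin_resolving_alg B"
  shows "\<exists>D :: ('k, 't) dga. stage {..<n} D"
proof -
  have "\<exists>J \<subseteq> {..<n}. card J = k \<and> (\<exists>D :: ('k, 't) dga. stage J D)" if "k \<le> n" for k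
    using that
  proof (induction k)
    case 0
    then show ?case using stage_empty[OF assms(1,3)] by (intro exI[of _ "{}"]) auto
  next
    case (Suc k)
    then obtain J and D :: "('k, 't) dga" where J: "J \<subseteq> {..<n}" "card J = k" "stage J D" by auto
    have fin: "finite ({..<n} - J)" by simp
    have "card J < card {..<n}" using J Suc by simp
    then have ne: "{..<n} - J \<noteq> {}" using J(1) by (metis Diff_eq_empty_iff less_irrefl subset_antisym)
    have mi: "Max (dg ` ({..<n} - J)) \<in> dg ` ({..<n} - J)" by (rule Max_in) (use fin ne in auto)
    then obtain j where j: "j \<in> {..<n} - J" "dg j = Max (dg ` ({..<n} - J))" by auto
    have mx: "dg i \<le> dg j" if "i < n" "i \<notin> J" for i
      unfolding j(2) by (rule Max_ge) (use fin that in auto)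
    have "\<exists>E :: ('k, 't) dga. stage (insert j J) E"
      by (rule stage_step[OF J(3) _ _ mx assms(2)]) (use j in auto)
    moreover have "card (insert j J) = Suc k" using J j finite_subset[OF J(1)] by simp
    ultimately show ?case using J(1) j(1) by (intro exI[of _ "insert j J"]) auto
  qed
  then obtain J and D :: "('k, 't) dga" where J: "J \<subseteq> {..<n}" "card J = n" "stage J D" by blast
  then have "J = {..<n}" by (simp add: card_subset_eq)
  then show ?thesis using J(3) by blast
qed

end

text \<open>The prescribed carrier type is large enough: elements of \<open>B\<close> have scalar
  coordinates indexed by exponent functions, the scalars embed into \<open>A\<close> through the
  unit, and sequences of such functions can again be encoded as one such function.\<close>

theorem theorem5p3:
  fixes A :: "('k::field_char_0, 'a) dga" and B :: "('k, 'b) dga" and f :: "'a \<Rightarrow> 'b"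
  assumes "fin_resolving_alg A" and "fin_resolving_alg B" and "dga_hom A B f"
  shows "\<exists>(B' :: ('k, (nat \<Rightarrow> nat) \<Rightarrow> 'a) dga) g h.
           is_dga B' \<and> fin_resolving A B' g \<and> quasi_iso B' B h \<and>
           (\<forall>x \<in> carrier A. h (g x) = f x)"
proof -
  have A: "is_dga A" and B: "is_dga B" using assms by (auto simp: fin_resolving_alg_def)
  obtain n x dg where X: "\<forall>i<n. dg i \<le> 0 \<and> x i \<in> homog A (dg i)"
    "fbasis (ground_dga :: ('k, 'k) dga) UNIV A (\<lambda>c. c \<odot>\<^bsub>A\<^esub> \<one>\<^bsub>A\<^esub>) (exps n dg) (monomial A x n)"
    "fspan UNIV A (\<lambda>c. c \<odot>\<^bsub>A\<^esub> \<one>\<^bsub>A\<^esub>) (exps n dg) (monomial A x n) = carrier A"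
    by (rule resolving_basis[OF assms(1)])
  obtain m y es where Y: "\<forall>i<m. es i \<le> 0 \<and> y i \<in> homog B (es i)"
    "fbasis (ground_dga :: ('k, 'k) dga) UNIV B (\<lambda>c. c \<odot>\<^bsub>B\<^esub> \<one>\<^bsub>B\<^esub>) (exps m es) (monomial B y m)"
    "fspan UNIV B (\<lambda>c. c \<odot>\<^bsub>B\<^esub> \<one>\<^bsub>B\<^esub>) (exps m es) (monomial B y m) = carrier B"
    by (rule resolving_basis[OF assms(2)])
  interpret resolving_map A n x dg B f
    by unfold_locales (rule A B assms(3) X)+
  obtain \<kappa> where \<kappa>: "coords kk B (exps m es) (\<lambda>_. UNIV) (\<lambda>e s. (s \<odot>\<^bsub>B\<^esub> \<one>\<^bsub>B\<^esub>) \<otimes>\<^bsub>B\<^esub> monomial B y m e) \<kappa>"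
    using Y(2) unfolding fbasis_def by blast
  have mc: "monomial B y m \<in> exps m es \<rightarrow> carrier B" using Y(1) by (intro funcsetI B.monomial_closed) blast
  note repr = coords_finsum[OF ground_abelian B.abelian_group_axioms
      fbasis_asubs[OF B.ring_axioms asub_ground B.unit_map mc] \<kappa>, folded fspan_def, unfolded Y(3)]
  \<comment> \<open>The constant monomial belongs to the basis of \<open>A\<close>, and its
    coordinate recovers the scalar.\<close>
  have unit_inj: "a = b" if "unit a = unit b" for a b
  proof -
    have z: "(\<lambda>_. 0) \<in> exps n dg" by (auto simp: exps_def)
    obtain \<mu> where mu: "\<And>i l s. i \<in> exps n dg \<Longrightarrow> l \<in> exps n dg \<Longrightarrow> s \<in> UNIV \<Longrightarrow>
        \<mu> i (unit s \<otimes>\<^bsub>A\<^esub> monomial A x n l) = (if i = l then s else \<zero>\<^bsub>kk\<^esub>)"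
      using fbasisE[OF basis] by metis
    have 1: "\<mu> (\<lambda>_. 0) (unit c \<otimes>\<^bsub>A\<^esub> monomial A x n (\<lambda>_. 0)) = c" for c
      using mu[OF z z UNIV_I, of c] by simp
    have "a = \<mu> (\<lambda>_. 0) (unit a \<otimes>\<^bsub>A\<^esub> monomial A x n (\<lambda>_. 0))" by (rule 1[symmetric])
    also have "\<dots> = b" unfolding that by (rule 1)
    finally show ?thesis .
  qed
  \<comment> \<open>An element of \<open>B\<close> is recorded by its coordinates, written as
    scalars in \<open>A\<close>; the value 0 outside \<open>exps m es\<close> is a mere
    default.\<close>
  define enc where "enc b = (\<lambda>e. unit (if e \<in> exps m es then \<kappa> e b else 0))" for b
  have inj: "inj_on enc (carrier B)"
  proof (rule inj_onI)
    fix u v assume u: "u \<in> carrier B" and v: "v \<in> carrier B" and uv: "enc u = enc v"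
    have k: "\<kappa> e u = \<kappa> e v" if "e \<in> exps m es" for e
      using fun_cong[OF uv, of e] unit_inj that by (auto simp: enc_def)
    have "{i \<in> exps m es. \<kappa> i u \<noteq> \<zero>\<^bsub>kk\<^esub>} = {i \<in> exps m es. \<kappa> i v \<noteq> \<zero>\<^bsub>kk\<^esub>}" using k by auto
    moreover have mcl: "monomial B y m e \<in> carrier B" for e using Y(1) by (intro B.monomial_closed) blast
    ultimately have "finsum B (\<lambda>i. (\<kappa> i u \<odot>\<^bsub>B\<^esub> \<one>\<^bsub>B\<^esub>) \<otimes>\<^bsub>B\<^esub> monomial B y m i) {i \<in> exps m es. \<kappa> i u \<noteq> \<zero>\<^bsub>kk\<^esub>} =
        finsum B (\<lambda>i. (\<kappa> i v \<odot>\<^bsub>B\<^esub> \<one>\<^bsub>B\<^esub>) \<otimes>\<^bsub>B\<^esub> monomial B y m i) {i \<in> exps m es. \<kappa> i v \<noteq> \<zero>\<^bsub>kk\<^esub>}"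
      using k by (intro B.finsum_cong') auto
    then show "u = v" using repr[OF u] repr[OF v] by simp
  qed
  \<comment> \<open>A pair of a natural number and a function on the naturals is one such function:
    the number is stored at position 0 and the function is shifted by one.\<close>
  define enc' :: "(nat \<Rightarrow> (nat \<Rightarrow> nat) \<Rightarrow> 'a) \<Rightarrow> (nat \<Rightarrow> nat) \<Rightarrow> 'a" where
    "enc' p = (\<lambda>e. p (e 0) (\<lambda>i. e (Suc i)))" for p
  have inj': "inj enc'"
  proof (rule injI)
    fix p q assume pq: "enc' p = enc' q"
    show "p = q"
    proof (intro ext)
      fix k e
      \<comment> \<open>Evaluating at \<open>case_nat k e\<close> undoes this packing and recovers
        the arguments \<open>k\<close> and \<open>e\<close>.\<close>
      show "p k e = q k e" using fun_cong[OF pq, of "case_nat k e"] by (simp add: enc'_def)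
    qed
  qed
  obtain D :: "('k, (nat \<Rightarrow> nat) \<Rightarrow> 'a) dga" where "stage {..<n} D"
    using stage_exists[OF inj inj' assms(2)] by blast
  then obtain h g m' xs ds where D: "is_dga D" "surj_acyclic D B h" "shom A (carrier A) D g" "dmap A (carrier A) D g"
    "\<forall>a\<in>carrier A. h (g a) = f a" "\<forall>i<m'. ds i \<le> 0 \<and> xs i \<in> homog D (ds i)"
    "fbasis A (carrier A) D g (exps m' ds) (monomial D xs m')"
    "fspan (carrier A) D g (exps m' ds) (monomial D xs m') = carrier D"
    unfolding stage_def subalg_all by blast
  have "dga_hom A D g" using D(3,4) dga_hom_iff_shom[OF A D(1)] by blast
  then have "fin_resolving A D g" by (rule fin_resolvingI[OF A D(1) _ D(6-8)])
  moreover have "quasi_iso D B h" by (rule surj_acyclic_quasi_iso[OF D(1) B D(2)])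
  ultimately show ?thesis using D(1,5) by blast
qed

end
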